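(* Let $k$ be a field of characteristic $0$, let $p=(1:0:0)\in\mathbb{P}^2_k$, and let $\nu$ be a plane divisorial valuation at infinity (type A) of the quotient field of $R=\mathcal{O}_{\mathbb{P}^2,p}$ centered at $R$. Let $\Delta=\{\delta_0,\delta_1,\dots,\delta_g,\delta_{g+1}\}$ be a $\delta$-sequence of type A generating the semigroup $S_{\nu,\infty}=\{-\nu(f)\mid f\in k[x,y]\setminus\{0\}\}$. Let $f(x,y)=0$ be an equation of a curve $C$ with only one place at infinity (the point $p$) whose germ at $p$ is a general element of $\nu$, and assume that $f(x,y)=y^m+a_1(x)y^{m-1}+\cdots+a_m(x)$ with $a_i(x)\in k[x]$ and $m$ the total degree of $f$, and that $\delta_0,\dots,\delta_g$ are the values $\delta_i=-\nu_{C,p}(q_i)$ of a family of approximates $\{q_i\}_{i=0}^g$ for $C$ (in particular $\delta_0=\deg C$). Let $$\cdots\to X_i\to X_{i-1}\to\cdots\to X_1\to X_0=\mathbb{P}^2$$ be the infinite sequence in which $X_1\to X_0$ is the blowing-up at $p_0:=p$ and, for $i\ge2$, $X_i\to X_{i-1}$ is the blowing-up at the intersection point $p_{i-1}$ of the strict transform of $C$ in $X_{i-1}$ with the exceptional divisor of the preceding blowing-up. Let $\Lambda$ be the pencil of plane curves with affine equations $f(x,y)=\lambda$, $\lambda\in k$, and let $\mathbf{m}$ be the least integer such that the composition of the first $\mathbf{m}+1$ of these blowing-ups eliminates the base points of $\Lambda$. Write $\mathcal{C}_\nu=\{p_i\}_{i=0}^{\mathbf{n}}$. Then: (a) if $\mathbf{n}\le\mathbf{m}$,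 then $\delta_{g+1}\ge0$ and $S_{\nu,\infty}$ is a well-ordered semigroup (with the natural ordering of $\mathbb{Z}$); (b) if $\mathbf{n}>\mathbf{m}$, then $\delta_{g+1}<0$ and $S_{\nu,\infty}$ is not well-ordered.
   Context: **Coordinates.** $(X:Y:Z)$ are homogeneous coordinates on $\mathbb{P}^2=\mathbb{P}^2_k$; $Z=0$ is the line at infinity $L$; $(x,y)$ are affine coordinates in the chart $Z\ne0$; $(u=y/x,\ v=1/x)$ are local coordinates at $p$. For $g(x,y)\in k[x,y]$ write $g(x,y)=v^{-\deg g}\,\bar g(u,v)$. **Curves with one place at infinity.** A projective absolutely irreducible curve $C\subset\mathbb{P}^2$ has only one place at infinity if $C\cap L$ is a single point $p$ and $C$ has only one analytic branch at $p$. $\nu_{C,p}$ denotes the discrete valuation defined by the germ of $C$ at $p$ (applied to the classes of polynomials on $C$). **Divisorial valuations at infinity.** A plane divisorial valuation $\nu$ centered at $R$ is given by a finite sequence of blowing-ups $X_{N+1}\to\cdots\to X_1\to X_0$, $X_1\to X_0$ being centered at $p_0=p$ and $X_{i+1}\to X_i$ at a closed point $p_i$ (defined over $k$) of the last exceptional divisor $E_i$; $\nu$ is the $m_N$-adic valuation, $m_N$ the maximal ideal of $\mathcal{O}_{X_N,p_N}$. Put $\mathcal{C}_\nu=\{p_0,\dots,p_N\}$. A general element of $\nu$ is an element of the maximal ideal of $R$ whose germ is analytically irreducible and whose strict transform on $X_{N+1}$ is smooth and meets $E_{N+1}$ transversely at a non-singular point of the total exceptional divisor. $\nu$ is at infinity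 if it has a general element giving the germ at $p$ of a curve with only one place at infinity. A center $p_i$ is satellite if it belongs to the intersection of the strict transforms of two exceptional divisors, and free otherwise. **$\delta$-sequences of type A.** A $\delta$-sequence in $\mathbb{N}_{>0}$ is a finite sequence $\{\delta_0,\dots,\delta_g\}$ of positive integers such that, with $d_i=\gcd(\delta_0,\dots,\delta_{i-1})$ for $1\le i\le g+1$ and $n_i=d_i/d_{i+1}$ for $1\le i\le g$: (1) $d_{g+1}=1$ and $n_i>1$ for $1\le i\le g$; (2) $n_i\delta_i$ belongs to the subsemigroup of $\mathbb{N}$ generated by $\delta_0,\dots,\delta_{i-1}$, for $1\le i\le g$; (3) $\delta_0>\delta_1$ and $\delta_i<\delta_{i-1}n_{i-1}$ for $2\le i\le g$. A $\delta$-sequence of type A is $\{\delta_0,\dots,\delta_g,\delta_{g+1}\}\subset\mathbb{Z}$ with $g\ge 1$, $\{\delta_0,\dots,\delta_g\}$ a $\delta$-sequence in $\mathbb{N}_{>0}$ and $\delta_{g+1}\le n_g\delta_g$. **Curvettes and approximates.** In the minimal embedded resolution of the germ of $C$ at $p$, the centers form successive blocks, one for each characteristic pair, the $i$-th block consisting of free points followed by satellite points. An analytically irreducible germ $\psi$ at $p$ is an $i$-curvette of the germ of $C$ if, on the surface obtained by blowing up the last free point of the $i$-th block, its strict transform is non-singular and meets transversely the exceptional divisor so created and no other exceptional curves. A family of approximates for $C$ is a sequence of polynomials $\{q_0,q_1,\dots,q_g\}$ in $k[x,y]$ such that, with $\delta_i:=-\nu_{C,p}(q_i)$ and $d_i=\gcd(\delta_0,\dots,\delta_{i-1})$: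 $q_0=x$, $q_1=y$; for $1<i\le g$, $q_i$ is monic in $y$ with $\deg(q_i)=\deg_y(q_i)=\delta_0/d_i$; and for $1<i\le g$ the germ at $p$ defined by $\bar q_i(u,v)$ is an $i$-curvette (respectively, an $(i-1)$-curvette) of the germ of $C$ at $p$ when $\delta_0-\delta_1$ does not divide (respectively, divides) $\delta_0$. Here $g$ is the number of characteristic pairs of $C$ at $p$ in the first case, and that number plus one in the second. **Existence of $\mathbf{m}$.** By a theorem of Moh, in characteristic $0$ all curves in $\Lambda$ have only one place at infinity, and there is an integer $\mathbf m$ (the least one such that the composition of the first $\mathbf m+1$ blowing-ups eliminates the base points of $\Lambda$), not smaller than the index of the last center of the minimal embedded resolution of $C$ at $p$, such that the strict transforms of all curves of $\Lambda$ pass through $p_i$ for all $i\le\mathbf m$. *)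

theory Defs
  imports
    "HOL-Algebra.Algebraic_Closure_Type"
    "HOL-Computational_Algebra.Computational_Algebra"
    "HOL-Library.Extended_Nat"
begin

section \<open>Polynomials in two variables and homogenization\<close>

text \<open>
  A polynomial in two variables is a \<open>'a poly poly\<close>. The elements of $k[x,y]$ are read with outer
  variable $y$ and inner variable $x$, those of $k[u,v]$ with outer variable $u$ and inner
  variable $v$, where $(u,v) = (y/x, 1/x)$ are the local coordinates at $p = (1:0:0)$.
\<close>

definition outer_var :: "'a::comm_ring_1 poly poly" where
  "outer_var = [:0, 1:]"

definition inner_var :: "'a::comm_ring_1 poly poly" where
  "inner_var = [:[:0, 1:]:]"

abbreviation uvar :: "'a::comm_ring_1 poly poly" where "uvar \<equiv> outer_var"
abbreviation vvar :: "'a::comm_ring_1 poly poly" where "vvar \<equiv> inner_var"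
abbreviation xvar :: "'a::comm_ring_1 poly poly" where "xvar \<equiv> inner_var"
abbreviation yvar :: "'a::comm_ring_1 poly poly" where "yvar \<equiv> outer_var"

definition cst :: "'a::comm_ring_1 \<Rightarrow> 'a poly poly" where
  "cst a = [:[:a:]:]"

text \<open>Value at outer variable \<open>a\<close>, inner variable \<open>b\<close>; \<open>h\<close> embeds the coefficients.\<close>

definition eval2 :: "('a::comm_ring_1 \<Rightarrow> 'b::comm_ring_1) \<Rightarrow> 'a poly poly \<Rightarrow> 'b \<Rightarrow> 'b \<Rightarrow> 'b" where
  "eval2 h P a b = poly (map_poly (\<lambda>r. poly (map_poly h r) b) P) a"

definition at_origin :: "'a::comm_ring_1 poly poly \<Rightarrow> 'a" where
  "at_origin P = coeff (coeff P 0) 0"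

definition tdeg :: "'a::comm_ring_1 poly poly \<Rightarrow> nat" where
  "tdeg f = Max (insert 0 {a + b | a b. coeff (coeff f b) a \<noteq> 0})"

text \<open>The homogenization $F(X,Y,Z) = Z^{\deg f} f(X/Z, Y/Z)$, evaluated at a triple.\<close>

definition homog_eval ::
  "('a::comm_ring_1 \<Rightarrow> 'b::comm_ring_1) \<Rightarrow> 'a poly poly \<Rightarrow> 'b \<Rightarrow> 'b \<Rightarrow> 'b \<Rightarrow> 'b" where
  "homog_eval h f \<xi> \<eta> \<zeta> =
     (\<Sum>b\<le>degree f. \<Sum>a\<le>degree (coeff f b).
        h (coeff (coeff f b) a) * \<xi> ^ a * \<eta> ^ b * \<zeta> ^ (tdeg f - a - b))"

text \<open>$\bar f(u,v) = F(1,u,v)$, so that $f(x,y) = v^{-\deg f}\,\bar f(u,v)$.\<close>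

definition bar :: "'a::comm_ring_1 poly poly \<Rightarrow> 'a poly poly" where
  "bar f = homog_eval cst f 1 uvar vvar"


section \<open>Infinitely near points\<close>

text \<open>
  Let $(u_i,v_i)$ be local coordinates at $p_i$. The $k$-points of the exceptional divisor
  $E_{i+1}$ of the blowing-up at $p_i$ form a projective line: \<open>Fin c\<close> is the point where
  $u_i/v_i$ takes the value \<open>c\<close>, with local coordinates given by $u_i = v_{i+1}(u_{i+1}+c)$,
  $v_i = v_{i+1}$ and $E_{i+1}: v_{i+1}=0$; and \<open>Inf\<close> is the point where $u_i/v_i=\infty$, with
  $u_i = u_{i+1}$, $v_i = u_{i+1}v_{i+1}$ and $E_{i+1}: u_{i+1}=0$.

  A list \<open>[c\<^sub>0, \<dots>, c\<^bsub>N-1\<^esub>]\<close> of such data, with $(u_0,v_0)=(u,v)$, encodes the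
  sequence of centers $p_0=p, p_1, \dots, p_N$, where $p_{i+1}$ is the point \<open>c\<^sub>i\<close> of $E_{i+1}$
  (so the list has length $N$, one less than the number of centers, and the empty list encodes $p$).
\<close>

datatype 'a direction = Fin 'a | Inf

fun total_step :: "'a::comm_ring_1 direction \<Rightarrow> 'a poly poly \<Rightarrow> 'a poly poly" where
  "total_step (Fin c) P = eval2 cst P (vvar * (uvar + cst c)) vvar"
| "total_step Inf P = eval2 cst P uvar (uvar * vvar)"

fun exceptional :: "'a::comm_ring_1 direction \<Rightarrow> 'a poly poly" where
  "exceptional (Fin c) = vvar"
| "exceptional Inf = uvar"

definition mult_origin :: "'a::comm_ring_1 poly poly \<Rightarrow> nat" where
  "mult_origin P = (LEAST n. \<exists>i j. n = i + j \<and> coeff (coeff P i) j \<noteq> 0)"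

definition strict_step :: "'a::field direction \<Rightarrow> 'a poly poly \<Rightarrow> 'a poly poly" where
  "strict_step s P = total_step s P div exceptional s ^ mult_origin P"

text \<open>Total and strict transforms, as equations in the local coordinates at the last point.\<close>

definition total_transform :: "'a::comm_ring_1 direction list \<Rightarrow> 'a poly poly \<Rightarrow> 'a poly poly" where
  "total_transform ss P = fold total_step ss P"

definition strict_transform :: "'a::field direction list \<Rightarrow> 'a poly poly \<Rightarrow> 'a poly poly" where
  "strict_transform ss P = fold strict_step ss P"

text \<open>The strict transform of $E_{j+1}$ at the last point of \<open>ss\<close>, for \<open>j < length ss\<close>.\<close>

definition exceptional_at :: "'a::field direction list \<Rightarrow> nat \<Rightarrow> 'a poly poly" where
  "exceptional_at ss j = strict_transform (drop (Suc j) ss) (exceptional (ss ! j))"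

definition satellite :: "'a::field direction list \<Rightarrow> bool" where
  "satellite ss \<longleftrightarrow> (\<exists>i j. i < j \<and> j < length ss \<and>
     at_origin (exceptional_at ss i) = 0 \<and> at_origin (exceptional_at ss j) = 0)"

text \<open>Both curves pass through the origin, and their linear parts there are independent.\<close>

definition transversal :: "'a::field poly poly \<Rightarrow> 'a poly poly \<Rightarrow> bool" where
  "transversal P Q \<longleftrightarrow> at_origin P = 0 \<and> at_origin Q = 0 \<and>
     coeff (coeff P 1) 0 * coeff (coeff Q 0) 1 \<noteq> coeff (coeff P 0) 1 * coeff (coeff Q 1) 0"


section \<open>Germs and curves with one place at infinity\<close>

definition germ :: "'a::field poly poly \<Rightarrow> 'a fps fps" where
  "germ P = fps_of_poly (map_poly fps_of_poly P)"

definition analytically_irreducible :: "'a::field poly poly \<Rightarrow> bool" where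
  "analytically_irreducible P \<longleftrightarrow> irreducible (germ P)"

definition absolutely_irreducible :: "'a::field poly poly \<Rightarrow> bool" where
  "absolutely_irreducible f \<longleftrightarrow> irreducible (map_poly (map_poly to_ac) f)"

text \<open>
  The second condition says $C \cap L = \{(1:0:0)\}$, with the points \<open>(\<xi> : \<eta> : 0)\<close> over the algebraic closure.
\<close>

definition one_place_at_infinity :: "'a::field poly poly \<Rightarrow> bool" where
  "one_place_at_infinity f \<longleftrightarrow>
     absolutely_irreducible f \<and>
     (\<forall>\<xi> \<eta>. (\<xi>, \<eta>) \<noteq> (0, 0) \<longrightarrow> (homog_eval to_ac f \<xi> \<eta> 0 = 0 \<longleftrightarrow> \<eta> = 0)) \<and>
     analytically_irreducible (bar f)"

text \<open>
  The germ of \<open>P\<close> is analytically irreducible and, after blowing up all the points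
  $p_0,\dots,p_N$ encoded by \<open>ss\<close>, its strict transform is smooth and meets $E_{N+1}$
  transversely at a point (over $k$) lying on no other exceptional curve. This is both the
  condition defining general elements of a divisorial valuation and the one defining curvettes.
  Up to a unit every element of $R$ is a polynomial in $u,v$, and only the germ matters here.
\<close>

definition curvette_of :: "'a::field direction list \<Rightarrow> 'a poly poly \<Rightarrow> bool" where
  "curvette_of ss P \<longleftrightarrow>
     analytically_irreducible P \<and>
     (\<exists>d. transversal (strict_transform (ss @ [d]) P) (exceptional d) \<and>
          \<not> satellite (ss @ [d]))"


section \<open>Divisorial valuations at infinity\<close>

text \<open>
  The quotient field of $R$ is the fraction field of $k[u,v]$. The valuation is the
  $m_N$-adic one: on $k[u,v]$ it is the multiplicity at $p_N$ of the total transform.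
\<close>

definition divisorial_valuation :: "'a::field direction list \<Rightarrow> 'a poly poly fract \<Rightarrow> int" where
  "divisorial_valuation ss z =
     (THE n. \<exists>a b. a \<noteq> 0 \<and> b \<noteq> 0 \<and> z = Fract a b \<and>
        n = int (mult_origin (total_transform ss a)) - int (mult_origin (total_transform ss b)))"

abbreviation general_element :: "'a::field direction list \<Rightarrow> 'a poly poly \<Rightarrow> bool" where
  "general_element ss P \<equiv> curvette_of ss P"

definition valuation_at_infinity :: "'a::field direction list \<Rightarrow> bool" where
  "valuation_at_infinity ss \<longleftrightarrow> (\<exists>h. one_place_at_infinity h \<and> general_element ss (bar h))"

text \<open>The element $f(x,y)$ of the quotient field, where $x = 1/v$ and $y = u/v$.\<close>

definition affine_function :: "'a::field poly poly \<Rightarrow> 'a poly poly fract" where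
  "affine_function f = eval2 (\<lambda>a. Fract (cst a) 1) f (Fract uvar vvar) (Fract 1 vvar)"

definition value_semigroup :: "('a::field poly poly fract \<Rightarrow> int) \<Rightarrow> int set" where
  "value_semigroup \<nu> = {- \<nu> (affine_function f) | f. f \<noteq> 0}"

definition well_ordered :: "int set \<Rightarrow> bool" where
  "well_ordered S \<longleftrightarrow> well_order_on S {(a, b). a \<in> S \<and> b \<in> S \<and> a \<le> b}"

definition additive_semigroup :: "int set \<Rightarrow> bool" where
  "additive_semigroup S \<longleftrightarrow> (\<forall>a\<in>S. \<forall>b\<in>S. a + b \<in> S)"


section \<open>Delta-sequences\<close>

definition dseq :: "(nat \<Rightarrow> int) \<Rightarrow> nat \<Rightarrow> int" where
  "dseq \<delta> i = Gcd (\<delta> ` {..<i})"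

definition nseq :: "(nat \<Rightarrow> int) \<Rightarrow> nat \<Rightarrow> int" where
  "nseq \<delta> i = dseq \<delta> i div dseq \<delta> (i + 1)"

text \<open>Semigroups contain $0$: \<open>generated \<delta> n\<close> is $\mathbb{N}\delta_0+\dots+\mathbb{N}\delta_{n-1}$.\<close>

definition generated :: "(nat \<Rightarrow> int) \<Rightarrow> nat \<Rightarrow> int set" where
  "generated \<delta> n = {\<Sum>j<n. int (a j) * \<delta> j | a. True}"

definition delta_sequence :: "nat \<Rightarrow> (nat \<Rightarrow> int) \<Rightarrow> bool" where
  "delta_sequence g \<delta> \<longleftrightarrow>
     (\<forall>i\<le>g. \<delta> i > 0) \<and>
     dseq \<delta> (g + 1) = 1 \<and>
     (\<forall>i\<in>{1..g}. nseq \<delta> i > 1) \<and>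
     (\<forall>i\<in>{1..g}. nseq \<delta> i * \<delta> i \<in> generated \<delta> i) \<and>
     (g \<ge> 1 \<longrightarrow> \<delta> 0 > \<delta> 1) \<and>
     (\<forall>i\<in>{2..g}. \<delta> i < \<delta> (i - 1) * nseq \<delta> (i - 1))"

definition delta_sequence_A :: "nat \<Rightarrow> (nat \<Rightarrow> int) \<Rightarrow> bool" where
  "delta_sequence_A g \<delta> \<longleftrightarrow> g \<ge> 1 \<and> delta_sequence g \<delta> \<and> \<delta> (g + 1) \<le> nseq \<delta> g * \<delta> g"


section \<open>The points of a curve at infinity and families of approximates\<close>

text \<open>The sequence of centers encoded by \<open>c\<close> consists of the infinitely near points of $C$.\<close>

definition centers_along :: "'a::field poly poly \<Rightarrow> (nat \<Rightarrow> 'a direction) \<Rightarrow> bool" where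
  "centers_along f c \<longleftrightarrow> (\<forall>i. at_origin (strict_transform (map c [0..<i]) (bar f)) = 0)"

text \<open>
  The discrete valuation of the germ \<open>\<psi>\<close>: the normalized valuation of the fraction field of
  the domain $k[[u,v]]/(\psi)$ that is nonnegative on this domain, lifted to $k[[u,v]]$.
\<close>

definition germ_valuation :: "'a::field fps fps \<Rightarrow> ('a fps fps \<Rightarrow> enat) \<Rightarrow> bool" where
  "germ_valuation \<psi> w \<longleftrightarrow>
     (\<forall>a. w a = \<infinity> \<longleftrightarrow> \<psi> dvd a) \<and>
     (\<forall>a b. w (a * b) = w a + w b) \<and>
     (\<forall>a b. w (a + b) \<ge> min (w a) (w b)) \<and>
     (\<exists>a b. w b \<noteq> \<infinity> \<and> w a = w b + 1)"

text \<open>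
  The value of (the class of) $q(x,y)=v^{-\deg q}\,\bar q(u,v)$, for \<open>q\<close> not vanishing on $C$.
\<close>

definition curve_value :: "('a::field fps fps \<Rightarrow> enat) \<Rightarrow> 'a poly poly \<Rightarrow> int" where
  "curve_value w q =
     int (the_enat (w (germ (bar q)))) - int (tdeg q) * int (the_enat (w (germ vvar)))"

text \<open>After \<open>r\<close> blowing-ups the total transform of the germ of $C$ has normal crossings.\<close>

definition resolved_after :: "'a::field poly poly \<Rightarrow> (nat \<Rightarrow> 'a direction) \<Rightarrow> nat \<Rightarrow> bool" where
  "resolved_after P c r \<longleftrightarrow> (let ss = map c [0..<r]; Q = strict_transform ss P in
     mult_origin Q = 1 \<and> \<not> satellite ss \<and>
     (\<forall>j<r. at_origin (exceptional_at ss j) = 0 \<longrightarrow> transversal Q (exceptional_at ss j)))"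

definition resolution_length :: "'a::field poly poly \<Rightarrow> (nat \<Rightarrow> 'a direction) \<Rightarrow> nat" where
  "resolution_length P c = (LEAST r. resolved_after P c r)"

text \<open>
  The indices of the last free points of the blocks: free centers of the minimal embedded
  resolution that are followed by a satellite one.
\<close>

definition last_free_points :: "'a::field poly poly \<Rightarrow> (nat \<Rightarrow> 'a direction) \<Rightarrow> nat set" where
  "last_free_points P c = {j. Suc j < resolution_length P c \<and>
     \<not> satellite (map c [0..<j]) \<and> satellite (map c [0..<Suc j])}"

definition num_characteristic_pairs :: "'a::field poly poly \<Rightarrow> (nat \<Rightarrow> 'a direction) \<Rightarrow> nat" where
  "num_characteristic_pairs P c = card (last_free_points P c)"

definition curvette ::
  "'a::field poly poly \<Rightarrow> (nat \<Rightarrow> 'a direction) \<Rightarrow> nat \<Rightarrow> 'a poly poly \<Rightarrow> bool" where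
  "curvette P c i Q \<longleftrightarrow> (\<exists>j \<in> last_free_points P c.
     card {l \<in> last_free_points P c. l \<le> j} = i \<and> curvette_of (map c [0..<j]) Q)"

definition family_of_approximates ::
  "'a::field poly poly \<Rightarrow> (nat \<Rightarrow> 'a direction) \<Rightarrow> ('a fps fps \<Rightarrow> enat) \<Rightarrow>
     nat \<Rightarrow> (nat \<Rightarrow> int) \<Rightarrow> (nat \<Rightarrow> 'a poly poly) \<Rightarrow> bool" where
  "family_of_approximates f c w g \<delta> q \<longleftrightarrow>
     (\<forall>i\<le>g. w (germ (bar (q i))) \<noteq> \<infinity> \<and> \<delta> i = - curve_value w (q i)) \<and>
     q 0 = xvar \<and> q 1 = yvar \<and>
     (\<forall>i. 1 < i \<and> i \<le> g \<longrightarrow>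
        lead_coeff (q i) = 1 \<and> degree (q i) = tdeg (q i) \<and>
        int (tdeg (q i)) = \<delta> 0 div dseq \<delta> i \<and>
        curvette (bar f) c (if (\<delta> 0 - \<delta> 1) dvd \<delta> 0 then i - 1 else i) (bar (q i))) \<and>
     g = num_characteristic_pairs (bar f) c + (if (\<delta> 0 - \<delta> 1) dvd \<delta> 0 then 1 else 0)"


section \<open>Elimination of the base points of the pencil\<close>

text \<open>
  The geometric points over $p$ of the surface obtained by blowing up $p_0,\dots,p_M$: each of
  them is a point of some $E_{j+1}$ with $j \le M$ which is not blown up further.
\<close>

definition points_above ::
  "(nat \<Rightarrow> 'a::field direction) \<Rightarrow> nat \<Rightarrow> 'a alg_closure direction list set" where
  "points_above c M = {map (map_direction to_ac \<circ> c) [0..<j] @ [d] | j d.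
     j \<le> M \<and> (j < M \<longrightarrow> d \<noteq> map_direction to_ac (c j))}"

text \<open>The member $f = \lambda$ of the pencil, over the algebraic closure.\<close>

definition pencil_member :: "'a::field poly poly \<Rightarrow> 'a \<Rightarrow> 'a alg_closure poly poly" where
  "pencil_member f l = map_poly (map_poly to_ac) (bar (f - cst l))"

text \<open>
  At each of these points, once the common (fixed) part \<open>H\<close> of the total transforms of the members
  is removed, not all members pass through the point. Outside $p$ the pencil has no base
  points, as its members meet the line at infinity only at $p$.
\<close>

definition eliminates_base_points ::
  "'a::field poly poly \<Rightarrow> (nat \<Rightarrow> 'a direction) \<Rightarrow> nat \<Rightarrow> bool" where
  "eliminates_base_points f c M \<longleftrightarrow> (\<forall>ss \<in> points_above c M.
     \<exists>H A. (\<forall>l. total_transform ss (pencil_member f l) = H * A l) \<and>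
           (\<exists>l. at_origin (A l) \<noteq> 0))"

end

theory Submission
  imports Defs
begin


text \<open>
  Let $d = \deg f$, let $e_i$ be the multiplicity of the strict transform of $C$ at $p_i$, and let $N_i$ and $V_i$ be
  the orders along $E_{i+1}$ of $\bar f$ and of $v$. Then $\nu(f)$ is $\sum_{i \le n} e_i^2 - d^2$, and the pencil is
  generated by $\bar f$ and $v^d$.

  If the base points are eliminated before $p_n$ is reached, then $\bar f / v^d$ vanishes at a point of $C$ preceding
  or equal to $p_n$, so $\nu(f) > 0$ and the semigroup contains a negative number.

  Conversely, suppose $\nu(h) > 0$. The approximates yield for each degree in $y$ below $\delta_0$ a monic polynomial, and
  the pole orders of these along $C$ are pairwise incongruent modulo $\delta_0$; hence a polynomial of degree less than
  $d$ in $y$ has a nonnegative pole order on $C$, which bounds $-\nu$ from below, and division by $f$ gives $\nu(f) > 0$.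
  So the partial sums of the $e_i^2$ exceed $d^2$. The sum over all points up to the last satellite one is at most
  $d^2$: the last approximate is a curvette through the same free points, and its pole order is positive. From there
  on $e_i = 1$, so some partial sum is exactly $d^2$. At that stage $N_i = d V_i$, at the earlier ones $N_i \le d V_i$,
  and the base points are eliminated before $p_n$.
\<close>

section \<open>Homomorphisms on polynomials in two variables\<close>

text \<open>Pole orders along the curve and multiplicities at its points come from unrelated
  sources: \<open>germ_valuation\<close> is given by axioms that mention no points, while
  multiplicities are computed in explicit charts. The link is to carry the abstract valuation from
  each blowing-up to the next. This works because an irreducible germ has a single tangent
  direction, even over the algebraic closure, and that is what Weierstrass preparation is for. The
  comparison leaves a scale factor free; it is fixed late, by the fact that \<open>f\<close> itself
  has infinite value.

  The inequality N_i <= d V_i needs more than a bound on the square sum at points on two axes. There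
  the product of the intersection numbers of the curve with the two axes is added. The resulting
  quantity \<open>sq'\<close> never decreases and is constant along a chain of satellite points,
  because Euclid's algorithm cuts a rectangle into squares. The same fact evaluates the contribution
  of the last chain as one product, which the last approximate can bound.\<close>

abbreviation cf :: "'a::zero poly poly \<Rightarrow> nat \<Rightarrow> nat \<Rightarrow> 'a" where
  "cf P i j \<equiv> coeff (coeff P i) j"

definition rhom :: "('a::comm_ring_1 \<Rightarrow> 'b::comm_ring_1) \<Rightarrow> bool" where
  "rhom h \<longleftrightarrow> h 1 = 1 \<and> (\<forall>x y. h (x + y) = h x + h y) \<and> (\<forall>x y. h (x * y) = h x * h y)"

lemma rhomI:
  "h 1 = 1 \<Longrightarrow> (\<And>x y. h (x + y) = h x + h y) \<Longrightarrow> (\<And>x y. h (x * y) = h x * h y) \<Longrightarrow> rhom h"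
  by (simp add: rhom_def)

lemma rhom_1: "rhom h \<Longrightarrow> h 1 = 1"
  and rhom_add: "rhom h \<Longrightarrow> h (x + y) = h x + h y"
  and rhom_mult: "rhom h \<Longrightarrow> h (x * y) = h x * h y"
  by (simp_all add: rhom_def)

lemma rhom_0: "rhom h \<Longrightarrow> h 0 = 0"
  using rhom_add[of h 0 0] by simp

lemma rhom_minus: "rhom h \<Longrightarrow> h (- x) = - h x"
  using rhom_add[of h x "- x"] by (simp add: rhom_0 eq_neg_iff_add_eq_0 add.commute)

lemma rhom_diff: "rhom h \<Longrightarrow> h (x - y) = h x - h y"
  using rhom_add[of h x "- y"] by (simp add: rhom_minus)

lemma rhom_power: "rhom h \<Longrightarrow> h (x ^ n) = h x ^ n"
  by (induction n) (simp_all add: rhom_1 rhom_mult)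

lemma rhom_sum: "rhom h \<Longrightarrow> h (sum f A) = (\<Sum>x\<in>A. h (f x))"
  by (induction A rule: infinite_finite_induct) (simp_all add: rhom_0 rhom_add)

lemmas rhom_simps = rhom_0 rhom_1 rhom_add rhom_mult rhom_minus rhom_diff rhom_power rhom_sum

lemma rhom_comp: "rhom h \<Longrightarrow> rhom k \<Longrightarrow> rhom (\<lambda>x. h (k x))"
  by (simp add: rhom_def)

lemma rhom_id: "rhom (\<lambda>x. x)"
  by (simp add: rhom_def)

lemma rhom_map_poly:
  assumes h: "rhom h" shows "rhom (map_poly h)"
proof (rule rhomI)
  show "map_poly h (p + q) = map_poly h p + map_poly h q" for p q
    by (rule poly_eqI) (simp add: coeff_map_poly rhom_simps[OF h])
  show "map_poly h (p * q) = map_poly h p * map_poly h q" for p q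
    by (rule poly_eqI) (simp add: coeff_map_poly coeff_mult rhom_simps[OF h])
  show "map_poly h 1 = 1" by (simp add: rhom_1[OF h])
qed

lemma rhom_poly: "rhom (\<lambda>p. poly p a)"
  by (simp add: rhom_def)

lemma rhom_pcompose: "rhom (\<lambda>p. p \<circ>\<^sub>p q)"
  by (simp add: rhom_def pcompose_1 pcompose_add pcompose_mult)

lemma rhom_cst: "rhom cst"
  by (simp add: rhom_def cst_def one_pCons)

lemma rhom_eval2: assumes "rhom h" shows "rhom (\<lambda>P. eval2 h P a b)"
proof -
  have "rhom (\<lambda>r. poly (map_poly h r) b)"
    using rhom_comp[OF rhom_poly rhom_map_poly[OF assms]] .
  from rhom_comp[OF rhom_poly rhom_map_poly[OF this]] show ?thesis
    by (simp add: eval2_def)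
qed

lemma eval2_cst: "rhom h \<Longrightarrow> eval2 h (cst c) a b = h c"
  and eval2_outer: "rhom h \<Longrightarrow> eval2 h outer_var a b = a"
  and eval2_inner: "rhom h \<Longrightarrow> eval2 h inner_var a b = b"
  by (simp_all add: eval2_def cst_def outer_var_def inner_var_def map_poly_pCons rhom_simps)

lemma poly_poly_induct [case_names cst outer inner add mult]:
  fixes P :: "'a::comm_ring_1 poly poly"
  assumes c: "\<And>a. Q (cst a)" and u: "Q outer_var" and v: "Q inner_var"
    and add: "\<And>A B. Q A \<Longrightarrow> Q B \<Longrightarrow> Q (A + B)" and mult: "\<And>A B. Q A \<Longrightarrow> Q B \<Longrightarrow> Q (A * B)"
  shows "Q P"
proof -
  have const: "Q [:p:]" for p :: "'a poly"
  proof (induction p)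
    case 0 show ?case using c[of 0] by (simp add: cst_def)
  next
    case (pCons a p)
    have "[:pCons a p:] = cst a + inner_var * [:p:]"
      by (simp add: cst_def inner_var_def)
    with pCons show ?case by (metis c v add mult)
  qed
  show ?thesis
  proof (induction P)
    case 0 show ?case using c[of 0] by (simp add: cst_def)
  next
    case (pCons p P)
    have "pCons p P = [:p:] + outer_var * P" by (simp add: outer_var_def)
    with pCons const show ?case by (metis u add mult)
  qed
qed

text \<open>The constants and the two variables generate the polynomial ring. Identities between
  substitutions, such as charts and changes of coordinates, are verified in this way
  throughout.\<close>

lemma rhom_eqI:
  fixes \<phi> :: "'a::comm_ring_1 poly poly \<Rightarrow> 'b::comm_ring_1"
  assumes "rhom \<phi>" "rhom \<psi>" "\<And>a. \<phi> (cst a) = \<psi> (cst a)"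
    "\<phi> outer_var = \<psi> outer_var" "\<phi> inner_var = \<psi> inner_var"
  shows "\<phi> P = \<psi> P"
  by (induction P rule: poly_poly_induct) (simp_all add: assms rhom_simps)

lemma inner_var_neq_0: "inner_var \<noteq> (0 :: 'a::comm_ring_1 poly poly)"
  and outer_var_neq_0: "outer_var \<noteq> (0 :: 'a::comm_ring_1 poly poly)"
  by (simp_all add: inner_var_def outer_var_def)

section \<open>Value at the origin and exchange of the coordinates\<close>

lemma rhom_at_origin: "rhom at_origin"
  by (rule rhomI) (simp_all add: at_origin_def coeff_mult_0)

lemma at_origin_simps [simp]: "at_origin (cst a) = a" "at_origin uvar = 0" "at_origin vvar = 0"
  by (simp_all add: at_origin_def cst_def outer_var_def inner_var_def)

definition swap_vars :: "'a::comm_ring_1 poly poly \<Rightarrow> 'a poly poly" where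
  "swap_vars P = eval2 cst P vvar uvar"

lemma rhom_swap_vars: "rhom swap_vars"
  unfolding swap_vars_def by (rule rhom_eval2[OF rhom_cst])

lemma swap_vars_simps [simp]:
  "swap_vars (cst a) = cst a" "swap_vars uvar = vvar" "swap_vars vvar = uvar"
  by (simp_all add: swap_vars_def eval2_cst eval2_outer eval2_inner rhom_cst)

lemma swap_swap [simp]: "swap_vars (swap_vars P) = P"
  by (rule rhom_eqI[of "\<lambda>P. swap_vars (swap_vars P)" "\<lambda>P. P"])
     (simp_all add: rhom_comp rhom_swap_vars rhom_id)

lemma swap_vars_0_iff [simp]: "swap_vars P = 0 \<longleftrightarrow> P = 0"
  using swap_swap rhom_0[OF rhom_swap_vars] by metis

lemma cf_cst: "cf (cst a) i j = (if i = 0 \<and> j = 0 then a else 0)"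
  by (cases i; cases j) (auto simp: cst_def)

lemma cf_outer_mult: "cf (outer_var * P) i j = (if i = 0 then 0 else cf P (i - 1) j)"
  by (cases i) (auto simp: outer_var_def)

lemma cf_inner_mult: "cf (inner_var * P) i j = (if j = 0 then 0 else cf P i (j - 1))"
  by (cases j) (auto simp: inner_var_def)

text \<open>Multiplication by a variable only shifts coefficients, whereas a general product
  convolves them; statements about \<open>cf\<close> need this form of the induction.\<close>

lemma poly_poly_induct' [case_names cst outer inner add]:
  fixes P :: "'a::comm_ring_1 poly poly"
  assumes c: "\<And>a. Q (cst a)" and u: "\<And>P. Q P \<Longrightarrow> Q (outer_var * P)"
    and v: "\<And>P. Q P \<Longrightarrow> Q (inner_var * P)"
    and add: "\<And>A B. Q A \<Longrightarrow> Q B \<Longrightarrow> Q (A + B)"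
  shows "Q P"
proof -
  have const: "Q [:p:]" for p :: "'a poly"
  proof (induction p)
    case 0 show ?case using c[of 0] by (simp add: cst_def)
  next
    case (pCons a p)
    have "[:pCons a p:] = cst a + inner_var * [:p:]"
      by (simp add: cst_def inner_var_def)
    with pCons show ?case by (metis c v add)
  qed
  show ?thesis
  proof (induction P)
    case 0 show ?case using c[of 0] by (simp add: cst_def)
  next
    case (pCons p P)
    have "pCons p P = [:p:] + outer_var * P" by (simp add: outer_var_def)
    with pCons const show ?case by (metis u add)
  qed
qed

lemma cf_swap: "cf (swap_vars P) i j = cf P j i"
proof (induction P arbitrary: i j rule: poly_poly_induct')
  case (cst a) then show ?case by (simp add: cf_cst)
qed (simp_all add: rhom_simps[OF rhom_swap_vars] cf_outer_mult cf_inner_mult)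

lemma at_origin_swap [simp]: "at_origin (swap_vars P) = at_origin P"
  by (simp add: at_origin_def cf_swap)

section \<open>Multiplicities and strict transforms\<close>

definition restr_v :: "'a::comm_ring_1 poly poly \<Rightarrow> 'a poly" where
  "restr_v P = map_poly (\<lambda>p. poly p 0) P"

lemma coeff_restr_v: "coeff (restr_v P) i = cf P i 0"
  by (simp add: restr_v_def coeff_map_poly poly_0_coeff_0)

lemma rhom_restr_v: "rhom restr_v"
  unfolding restr_v_def[abs_def] by (rule rhom_map_poly[OF rhom_poly])

lemma restr_v_simps [simp]: "restr_v (cst a) = [:a:]" "restr_v uvar = [:0, 1:]" "restr_v vvar = 0"
  by (simp_all add: restr_v_def cst_def outer_var_def inner_var_def map_poly_pCons)

lemma poly_restr_v_0: "poly (restr_v P) 0 = at_origin P"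
  by (simp add: poly_0_coeff_0 coeff_restr_v at_origin_def)

lemma coeff_coeff_inner_power_mult:
  "cf (vvar ^ n * P) i j = (if j < n then 0 else cf P i (j - n))"
  by (induction n arbitrary: j) (auto simp: mult.assoc cf_inner_mult)

lemma restr_v_eq_0_iff: "restr_v P = 0 \<longleftrightarrow> vvar dvd (P :: 'a::field poly poly)"
proof
  assume "vvar dvd P"
  then show "restr_v P = 0" by (auto simp: rhom_mult[OF rhom_restr_v])
next
  assume "restr_v P = 0"
  then have "cf P i 0 = 0" for i by (metis coeff_restr_v coeff_0)
  then have "[:0,1:] dvd coeff P i" for i by (simp add: dvd_iff_poly_eq_0 poly_0_coeff_0)
  then show "vvar dvd P" by (simp add: inner_var_def const_poly_dvd_iff)
qed

section \<open>The charts of one blowing-up\<close>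

lemma rhom_total_step: "rhom (total_step s)"
proof (cases s)
  case (Fin c)
  have "total_step (Fin c) = (\<lambda>P. eval2 cst P (vvar * (uvar + cst c)) vvar)" by (rule ext) simp
  with Fin show ?thesis by (simp only: rhom_eval2 rhom_cst)
next
  case Inf
  have "total_step Inf = (\<lambda>P. eval2 cst P uvar (uvar * vvar) :: 'a poly poly)" by (rule ext) simp
  with Inf show ?thesis by (simp only: rhom_eval2 rhom_cst)
qed

lemma total_step_vars:
  "total_step s (cst a) = cst a"
  "total_step (Fin c) uvar = vvar * (uvar + cst c)" "total_step (Fin c) vvar = vvar"
  "total_step Inf uvar = uvar" "total_step Inf vvar = uvar * vvar"
  by (cases s) (simp_all add: eval2_cst eval2_outer eval2_inner rhom_cst)

lemma cst_0 [simp]: "cst 0 = 0" and cst_1 [simp]: "cst 1 = 1"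
  by (simp_all add: cst_def one_pCons)

declare total_step.simps [simp del]

text \<open>Reduces the chart at infinity to the chart \<open>Fin 0\<close>; together with
  \<open>total_step_Fin_shift\<close> this leaves a single chart for explicit computation.\<close>

lemma total_step_Inf: "total_step Inf P = swap_vars (total_step (Fin 0) (swap_vars P))"
  by (rule rhom_eqI[of "total_step Inf" "\<lambda>P. swap_vars (total_step (Fin 0) (swap_vars P))"])
     (simp_all add: rhom_comp[OF rhom_swap_vars rhom_comp[OF rhom_total_step rhom_swap_vars]]
        rhom_total_step total_step_vars rhom_simps[OF rhom_swap_vars])

lemma at_origin_total_step [simp]: "at_origin (total_step s P) = at_origin P"
  by (rule rhom_eqI[of "\<lambda>P. at_origin (total_step s P)" at_origin])
     (cases s; simp_all add: rhom_comp rhom_at_origin rhom_total_step total_step_vars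
        rhom_simps[OF rhom_at_origin])+

definition shift_u :: "'a::comm_ring_1 \<Rightarrow> 'a poly poly \<Rightarrow> 'a poly poly" where
  "shift_u c P = P \<circ>\<^sub>p [:[:c:], 1:]"

lemma rhom_shift_u: "rhom (shift_u c)"
  unfolding shift_u_def by (rule rhom_pcompose)

lemma shift_u_simps [simp]:
  "shift_u c (cst a) = cst a" "shift_u c uvar = uvar + cst c" "shift_u c vvar = vvar"
  by (simp_all add: shift_u_def cst_def outer_var_def inner_var_def pcompose_pCons)

lemma total_step_Fin_shift: "total_step (Fin c) P = shift_u c (total_step (Fin 0) P)"
  by (rule rhom_eqI[of "total_step (Fin c)" "\<lambda>P. shift_u c (total_step (Fin 0) P)"])
     (simp_all add: rhom_comp rhom_shift_u rhom_total_step total_step_vars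
        rhom_simps[OF rhom_shift_u])

lemma restr_v_shift_u: "restr_v (shift_u c P) = restr_v P \<circ>\<^sub>p [:c, 1:]"
  by (rule rhom_eqI[of "\<lambda>P. restr_v (shift_u c P)" "\<lambda>P. restr_v P \<circ>\<^sub>p [:c, 1:]"])
     (simp_all add: rhom_comp[OF rhom_restr_v rhom_shift_u] rhom_comp[OF rhom_pcompose rhom_restr_v]
       rhom_simps[OF rhom_restr_v] pcompose_pCons)

text \<open>The substitution \<open>u = u' v'\<close>, \<open>v = v'\<close> sends
  \<open>u^i v^k\<close> to \<open>u'^i v'^(i+k)\<close>.\<close>

lemma cf_total_step_0: "cf (total_step (Fin 0) P) i j = (if i \<le> j then cf P i (j - i) else 0)"
proof (induction P arbitrary: i j rule: poly_poly_induct')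
  case (cst a) then show ?case by (auto simp: total_step_vars cf_cst)
next
  case (outer P)
  have "total_step (Fin 0) (uvar * P) = vvar * (uvar * total_step (Fin 0) P)"
    by (simp add: rhom_mult[OF rhom_total_step] total_step_vars algebra_simps)
  then show ?case using outer by (auto simp: cf_outer_mult cf_inner_mult)
next
  case (inner P)
  then show ?case by (auto simp: cf_inner_mult rhom_mult[OF rhom_total_step] total_step_vars)
next
  case (add A B)
  then show ?case by (auto simp: rhom_add[OF rhom_total_step])
qed

lemma inner_power_dvd_iff: "vvar ^ n dvd (P :: 'a::field poly poly) \<longleftrightarrow> (\<forall>i j. j < n \<longrightarrow> cf P i j = 0)"
proof
  assume "vvar ^ n dvd P"
  then show "\<forall>i j. j < n \<longrightarrow> cf P i j = 0"
    by (auto simp: coeff_coeff_inner_power_mult)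
next
  assume *: "\<forall>i j. j < n \<longrightarrow> cf P i j = 0"
  then have "monom 1 n dvd coeff P i" for i by (simp add: monom_1_dvd_iff')
  moreover have "vvar ^ n = [:monom (1::'a) n:]"
    by (induction n) (simp_all add: inner_var_def monom_Suc)
  ultimately show "vvar ^ n dvd P" by (simp add: const_poly_dvd_iff)
qed

text \<open>The tangent cone: the leading form of \<open>P\<close> at \<open>(u, 1)\<close>.\<close>

definition tcone :: "'a::comm_ring_1 poly poly \<Rightarrow> 'a poly" where
  "tcone P = (\<Sum>i\<le>mult_origin P. monom (cf P i (mult_origin P - i)) i)"

lemma coeff_tcone: "coeff (tcone P) i = (if i \<le> mult_origin P then cf P i (mult_origin P - i) else 0)"
  by (simp add: tcone_def coeff_sum)

lemma mult_origin_witness: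
  assumes "P \<noteq> 0"
  obtains i j where "mult_origin P = i + j" "cf P i j \<noteq> 0"
proof -
  from assms obtain i where "coeff P i \<noteq> 0" by (metis coeff_0 poly_eqI)
  then obtain j where "cf P i j \<noteq> 0" by (metis coeff_0 poly_eqI)
  then have "\<exists>n i j. n = i + j \<and> cf P i j \<noteq> 0" by blast
  from LeastI_ex[OF this] show ?thesis using that by (auto simp: mult_origin_def)
qed

lemma mult_origin_le: "cf P i j \<noteq> 0 \<Longrightarrow> mult_origin P \<le> i + j"
  unfolding mult_origin_def by (rule Least_le) blast

lemma mult_originI: "cf P i j \<noteq> 0 \<Longrightarrow> (\<And>i' j'. i' + j' < i + j \<Longrightarrow> cf P i' j' = 0) \<Longrightarrow> mult_origin P = i + j"
  using mult_origin_le[of P i j] mult_origin_witness[of P]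
  by (metis coeff_0 le_neq_implies_less)

lemma tcone_neq_0: "P \<noteq> 0 \<Longrightarrow> tcone P \<noteq> 0"
proof -
  assume "P \<noteq> 0"
  then obtain i j where "mult_origin P = i + j" "cf P i j \<noteq> 0" by (rule mult_origin_witness)
  then have "coeff (tcone P) i \<noteq> 0" by (simp add: coeff_tcone)
  then show ?thesis by auto
qed

lemma degree_tcone: "degree (tcone P) \<le> mult_origin P"
  by (rule degree_le) (simp add: coeff_tcone)

lemma mult_origin_swap: "mult_origin (swap_vars P) = mult_origin P"
  unfolding mult_origin_def cf_swap by (metis add.commute)

context
  fixes P :: "'a::field poly poly"
  assumes P: "P \<noteq> 0"
begin

text \<open>Since \<open>u^i v^k\<close> becomes \<open>u^i v^(i+k)\<close>, the monomials of lowest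
  degree acquire exactly the exponent \<open>mult_origin P\<close> of \<open>v\<close>. After
  division they are what survives on \<open>v = 0\<close>, which gives the tangent cone.\<close>

lemma total_step_0_factor: "total_step (Fin 0) P = vvar ^ mult_origin P * strict_step (Fin 0) P"
  and restr_v_strict_step_0: "restr_v (strict_step (Fin 0) P) = tcone P"
proof -
  have "vvar ^ mult_origin P dvd total_step (Fin 0) P"
    unfolding inner_power_dvd_iff cf_total_step_0 using mult_origin_le
    by (metis le_add_diff_inverse not_less)
  then obtain R where R: "total_step (Fin 0) P = vvar ^ mult_origin P * R" by (elim dvdE)
  then have S: "strict_step (Fin 0) P = R"
    by (simp add: strict_step_def inner_var_neq_0)
  with R show 1: "total_step (Fin 0) P = vvar ^ mult_origin P * strict_step (Fin 0) P" by simp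
  show "restr_v (strict_step (Fin 0) P) = tcone P"
  proof (rule poly_eqI)
    fix i
    have "cf (strict_step (Fin 0) P) i 0 = cf (total_step (Fin 0) P) i (mult_origin P)"
      unfolding 1 coeff_coeff_inner_power_mult by simp
    then show "coeff (restr_v (strict_step (Fin 0) P)) i = coeff (tcone P) i"
      by (simp add: coeff_restr_v coeff_tcone cf_total_step_0)
  qed
qed

lemma total_step_Fin_factor: "total_step (Fin c) P = vvar ^ mult_origin P * strict_step (Fin c) P"
  and strict_step_Fin: "strict_step (Fin c) P = shift_u c (strict_step (Fin 0) P)"
proof -
  have *: "total_step (Fin c) P = vvar ^ mult_origin P * shift_u c (strict_step (Fin 0) P)"
    by (simp add: total_step_Fin_shift[of c] total_step_0_factor rhom_simps[OF rhom_shift_u])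
  show "strict_step (Fin c) P = shift_u c (strict_step (Fin 0) P)"
    by (simp add: strict_step_def[of "Fin c"] * inner_var_neq_0)
  with * show "total_step (Fin c) P = vvar ^ mult_origin P * strict_step (Fin c) P" by simp
qed

lemma restr_v_strict_step: "restr_v (strict_step (Fin c) P) = tcone P \<circ>\<^sub>p [:c, 1:]"
  by (subst strict_step_Fin) (simp only: restr_v_shift_u restr_v_strict_step_0)

lemma at_origin_strict_step_Fin: "at_origin (strict_step (Fin c) P) = poly (tcone P) c"
  by (simp flip: poly_restr_v_0 add: restr_v_strict_step poly_pcompose)

end

context
  fixes P :: "'a::field poly poly"
  assumes P: "P \<noteq> 0"
begin

lemma total_step_Inf_factor: "total_step Inf P = uvar ^ mult_origin P * strict_step Inf P"
  and strict_step_Inf: "strict_step Inf P = swap_vars (strict_step (Fin 0) (swap_vars P))"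
proof -
  have *: "total_step Inf P = uvar ^ mult_origin P * swap_vars (strict_step (Fin 0) (swap_vars P))"
    using total_step_0_factor[of "swap_vars P"] P
    by (simp add: total_step_Inf rhom_simps[OF rhom_swap_vars] mult_origin_swap)
  show "strict_step Inf P = swap_vars (strict_step (Fin 0) (swap_vars P))"
    by (simp add: strict_step_def[of "Inf"] * outer_var_neq_0)
  with * show "total_step Inf P = uvar ^ mult_origin P * strict_step Inf P" by simp
qed

lemma total_step_factor: "total_step s P = exceptional s ^ mult_origin P * strict_step s P"
  by (cases s) (simp_all add: total_step_Inf_factor total_step_Fin_factor P)

lemma at_origin_strict_step_Inf: "at_origin (strict_step Inf P) = coeff (tcone P) (mult_origin P)"
  using at_origin_strict_step_Fin[of "swap_vars P" 0] P
  by (simp add: strict_step_Inf poly_0_coeff_0 coeff_tcone mult_origin_swap cf_swap)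

end

text \<open>On the exceptional curve the strict transform restricts to a translate of the tangent
  cone, which is nonzero; the chart \<open>Inf\<close> follows by the exchange of
  coordinates.\<close>

lemma total_step_eq_0_iff [simp]: "total_step s P = 0 \<longleftrightarrow> P = (0::'a::field poly poly)"
proof
  assume *: "total_step s P = 0"
  show "P = 0"
  proof (rule ccontr)
    assume P: "P \<noteq> 0"
    have r0: "restr_v (strict_step (Fin c) Q) \<noteq> 0" if "Q \<noteq> 0" for c and Q :: "'a poly poly"
    proof
      assume "restr_v (strict_step (Fin c) Q) = 0"
      then have "tcone Q \<circ>\<^sub>p [:c, 1:] = 0" using restr_v_strict_step[OF that] by metis
      then show False using pcompose_eq_0[of "tcone Q" "[:c, 1:]"] tcone_neq_0[OF that] by simp
    qed
    have "strict_step (Fin c) Q \<noteq> 0" if "Q \<noteq> 0" for c and Q :: "'a poly poly"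
      using r0[OF that] rhom_0[OF rhom_restr_v] by metis
    then have "strict_step s P \<noteq> 0"
      using P by (cases s) (auto simp: strict_step_Inf)
    moreover have "exceptional s \<noteq> (0 :: 'a poly poly)"
      by (cases s) (simp_all add: inner_var_neq_0 outer_var_neq_0)
    ultimately show False using * total_step_factor[OF P, of s] by simp
  qed
qed (simp add: rhom_0[OF rhom_total_step])

lemma strict_step_neq_0: "P \<noteq> 0 \<Longrightarrow> strict_step s P \<noteq> 0"
  using total_step_factor[of P s] total_step_eq_0_iff[of s P] by auto

text \<open>The multiplicity is the exact power of \<open>v\<close> in the chart
  \<open>Fin 0\<close>. Multiplicativity then follows, because \<open>total_step\<close> and
  \<open>restr_v\<close> are homomorphisms into domains.\<close>

lemma mult_origin_unique:
  fixes P :: "'a::field poly poly"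
  assumes "total_step (Fin 0) P = vvar ^ n * R" "restr_v R \<noteq> 0"
  shows "mult_origin P = n"
proof -
  have P: "P \<noteq> 0" using assms by (auto simp: rhom_simps[OF rhom_total_step] rhom_simps[OF rhom_restr_v] inner_var_neq_0)
  let ?S = "strict_step (Fin 0) P"
  have S: "restr_v ?S \<noteq> 0" using restr_v_strict_step_0[OF P] tcone_neq_0[OF P] by simp
  have eq: "vvar ^ n * R = vvar ^ mult_origin P * ?S" using assms total_step_0_factor[OF P] by simp
  have "a = b" if "a \<le> b" "vvar ^ a * A = vvar ^ b * B" "restr_v A \<noteq> 0" for a b and A B :: "'a poly poly"
  proof (rule ccontr)
    assume "a \<noteq> b"
    with that(1) obtain k where "b = a + Suc k" using less_imp_Suc_add[of a b] by auto
    with that(2) have "A = vvar ^ Suc k * B" by (simp add: power_add inner_var_neq_0 mult.assoc)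
    with that(3) show False by (simp add: rhom_simps[OF rhom_restr_v])
  qed
  then show ?thesis using eq S assms(2) by (metis le_cases)
qed

lemma mult_origin_mult:
  fixes P Q :: "'a::field poly poly"
  assumes "P \<noteq> 0" "Q \<noteq> 0"
  shows "mult_origin (P * Q) = mult_origin P + mult_origin Q"
proof (rule mult_origin_unique)
  show "total_step (Fin 0) (P * Q) = vvar ^ (mult_origin P + mult_origin Q) *
      (strict_step (Fin 0) P * strict_step (Fin 0) Q)"
    using assms by (simp add: rhom_simps[OF rhom_total_step] total_step_0_factor power_add mult_ac)
  show "restr_v (strict_step (Fin 0) P * strict_step (Fin 0) Q) \<noteq> 0"
    using assms by (simp add: rhom_simps[OF rhom_restr_v] restr_v_strict_step_0 tcone_neq_0)
qed

lemma mult_origin_eq_0_iff: "P \<noteq> 0 \<Longrightarrow> mult_origin P = 0 \<longleftrightarrow> at_origin P \<noteq> 0"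
proof -
  assume P: "P \<noteq> 0"
  obtain i j where ij: "mult_origin P = i + j" "cf P i j \<noteq> 0"
    using P by (rule mult_origin_witness)
  have "cf P 0 0 \<noteq> 0 \<Longrightarrow> mult_origin P = 0"
    using mult_origin_le[of P 0 0] by simp
  with ij show ?thesis by (auto simp: at_origin_def)
qed

lemma mult_origin_power:
  fixes P :: "'a::field poly poly"
  shows "P \<noteq> 0 \<Longrightarrow> mult_origin (P ^ n) = n * mult_origin P"
proof (induction n)
  case 0 show ?case by (simp add: mult_origin_eq_0_iff rhom_1[OF rhom_at_origin])
qed (simp add: mult_origin_mult)

lemma mult_origin_vars [simp]: "mult_origin (uvar :: 'a::field poly poly) = 1" "mult_origin (vvar :: 'a::field poly poly) = 1"
proof -
  show "mult_origin (vvar :: 'a poly poly) = 1"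
    by (rule mult_origin_unique[of _ _ 1]) (simp_all add: total_step_vars rhom_1[OF rhom_restr_v])
  then show "mult_origin (uvar :: 'a poly poly) = 1"
    using mult_origin_swap[of "uvar :: 'a poly poly"] by simp
qed


section \<open>Weierstrass preparation in \<open>k[[u, v]]\<close>\<close>

text \<open>Here the outer variable of a double power series is \<open>u\<close> and the inner one \<open>v\<close>.\<close>

definition swap_fps :: "'a::comm_ring_1 fps fps \<Rightarrow> 'a fps fps" where
  "swap_fps G = Abs_fps (\<lambda>i. Abs_fps (\<lambda>j. G $ j $ i))"

lemma swap_fps_nth [simp]: "swap_fps G $ i $ j = G $ j $ i"
  by (simp add: swap_fps_def)

lemma swap_swap_fps [simp]: "swap_fps (swap_fps G) = G"
  by (simp add: fps_eq_iff)

lemma fps2_mult_nth: "(F * G) $ i $ j = (\<Sum>a=0..i. \<Sum>b=0..j. F $ a $ b * G $ (i - a) $ (j - b))"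
  by (simp add: fps_mult_nth fps_sum_nth)

lemma rhom_swap_fps: "rhom swap_fps"
proof (rule rhomI)
  show "swap_fps 1 = (1 :: 'a fps fps)"
    by (simp add: fps_eq_iff fps_one_nth)
  show "swap_fps (F + G) = swap_fps F + swap_fps G" for F G :: "'a fps fps"
    by (simp add: fps_eq_iff)
  show "swap_fps (F * G) = swap_fps F * swap_fps G" for F G :: "'a fps fps"
    unfolding fps_eq_iff swap_fps_nth fps2_mult_nth by (auto intro: sum.swap)
qed

lemma swap_fps_eq_0_iff [simp]: "swap_fps G = 0 \<longleftrightarrow> G = 0"
  by (metis rhom_0 rhom_swap_fps swap_swap_fps)

lemma fps2_unit_iff: "G dvd 1 \<longleftrightarrow> G $ 0 $ 0 \<noteq> (0 :: 'a::field)"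
proof
  assume "G dvd 1"
  then obtain K where "1 = G * K" by (elim dvdE)
  then have "(1 :: 'a) = G $ 0 $ 0 * K $ 0 $ 0" by (metis fps_mult_nth_0 fps_one_nth)
  then show "G $ 0 $ 0 \<noteq> 0" by auto
next
  assume "G $ 0 $ 0 \<noteq> 0"
  then have "G $ 0 * inverse (G $ 0) = 1" by (metis inverse_mult_eq_1 mult.commute)
  from fps_right_inverse[OF this] show "G dvd 1" by (metis dvd_triv_left)
qed

definition restr_fps :: "'a::comm_ring_1 fps fps \<Rightarrow> 'a fps" where
  "restr_fps G = swap_fps G $ 0"

lemma restr_fps_nth: "restr_fps G $ i = G $ i $ 0"
  by (simp add: restr_fps_def)

lemma rhom_restr_fps: "rhom restr_fps"
  by (rule rhomI) (simp_all add: restr_fps_def rhom_simps[OF rhom_swap_fps])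

text \<open>The quotient is solved for by powers of the outer variable. Once the earlier
  coefficients are known, the terms of \<open>H $ n\<close> still left in degrees at least the order
  of \<open>G $ 0\<close> must be matched by \<open>Q $ n * G $ 0\<close>, and \<open>G $ 0\<close>
  is a power of the inner variable times a unit.\<close>

fun weierstrass_quotient :: "'a::field fps fps \<Rightarrow> 'a fps fps \<Rightarrow> nat \<Rightarrow> 'a fps" where
  "weierstrass_quotient G H n =
     fps_shift (subdegree (G $ 0)) (H $ n - (\<Sum>i<n. weierstrass_quotient G H i * G $ (n - i))) *
     inverse (fps_shift (subdegree (G $ 0)) (G $ 0))"

declare weierstrass_quotient.simps [simp del]

text \<open>Division with the two variables swapped, so that the quotient can be built up coefficientwise.\<close>

lemma weierstrass_division_swapped:
  fixes G H :: "'a::field fps fps"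
  assumes "G $ 0 \<noteq> 0"
  obtains Q where "\<And>n k. subdegree (G $ 0) \<le> k \<Longrightarrow> (H - Q * G) $ n $ k = 0"
proof
  define x where "x = subdegree (G $ 0)"
  define Q where "Q = Abs_fps (weierstrass_quotient G H)"
  fix n k assume k: "subdegree (G $ 0) \<le> k"
  define R where "R = H $ n - (\<Sum>i<n. Q $ i * G $ (n - i))"
  have Qn: "Q $ n = fps_shift x R * inverse (fps_shift x (G $ 0))"
    by (simp add: Q_def R_def x_def weierstrass_quotient.simps[of G H n])
  have "fps_shift x (G $ 0) $ 0 \<noteq> 0" using assms by (simp add: x_def)
  then have inv: "inverse (fps_shift x (G $ 0)) * fps_shift x (G $ 0) = 1" by (rule inverse_mult_eq_1)
  have "(Q * G) $ n = (\<Sum>i<n. Q $ i * G $ (n - i)) + Q $ n * G $ 0"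
    by (simp add: fps_mult_nth atLeast0AtMost lessThan_Suc_atMost[symmetric])
  then have "(H - Q * G) $ n = R - Q $ n * G $ 0" by (simp add: R_def)
  also have "G $ 0 = fps_shift x (G $ 0) * fps_X ^ x"
    unfolding x_def by (rule subdegree_decompose)
  also have "Q $ n * (fps_shift x (G $ 0) * fps_X ^ x) = fps_shift x R * fps_X ^ x"
    unfolding Qn using inv by (simp add: mult.assoc flip: mult.assoc[of "inverse _" "fps_shift x (G $ 0)"])
  finally show "(H - Q * G) $ n $ k = 0"
    using k by (simp add: fps_X_power_mult_right_nth x_def)
qed

text \<open>The lowest nonzero coefficient of \<open>Q\<close> times \<open>G $ 0\<close> is a
  nonzero series whose order is at least that of \<open>G $ 0\<close>.\<close>

lemma weierstrass_unique_swapped: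
  fixes G Q :: "'a::field fps fps"
  assumes "G $ 0 \<noteq> 0" "\<And>n k. subdegree (G $ 0) \<le> k \<Longrightarrow> (Q * G) $ n $ k = 0"
  shows "Q = 0"
proof (rule ccontr)
  assume Q: "Q \<noteq> 0"
  let ?n = "subdegree Q"
  have "(Q * G) $ ?n = Q $ ?n * G $ 0" by simp
  moreover have nz: "Q $ ?n * G $ 0 \<noteq> 0" using Q assms(1) by simp
  moreover have "subdegree (Q $ ?n * G $ 0) \<ge> subdegree (G $ 0)"
    using Q assms(1) by (subst subdegree_mult) auto
  ultimately show False using assms(2)[of "subdegree (Q $ ?n * G $ 0)" ?n] by (metis nth_subdegree_zero_iff)
qed

lemma weierstrass_unique:
  fixes G Q :: "'a::field fps fps"
  assumes "restr_fps G \<noteq> 0" "\<And>n k. subdegree (restr_fps G) \<le> k \<Longrightarrow> (Q * G) $ k $ n = 0"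
  shows "Q = 0"
proof -
  have "swap_fps Q = 0"
    by (rule weierstrass_unique_swapped[of "swap_fps G"])
       (use assms in \<open>simp_all add: restr_fps_def flip: rhom_mult[OF rhom_swap_fps]\<close>)
  then show ?thesis by simp
qed

text \<open>Dividing \<open>u^x\<close> by \<open>G\<close>, with \<open>x\<close> the order of
  \<open>G\<close> on \<open>v = 0\<close>, leaves a remainder of degree below \<open>x\<close> in
  \<open>u\<close>. Hence \<open>Q * G\<close> is a monic polynomial in \<open>u\<close>, and it
  remains to see that \<open>Q\<close> is a unit.\<close>

lemma weierstrass_preparation:
  fixes G :: "'a::field fps fps"
  assumes "restr_fps G \<noteq> 0"
  obtains A :: "'a fps poly" and U where "degree A = subdegree (restr_fps G)" "lead_coeff A = 1"
    "fps_of_poly A * U = G" "U dvd 1" "restr_fps (fps_of_poly A) = fps_X ^ degree A"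
proof -
  define x where "x = subdegree (restr_fps G)"
  have "swap_fps G $ 0 \<noteq> 0" using assms by (simp add: restr_fps_def)
  from weierstrass_division_swapped[OF this, of "swap_fps (fps_X ^ x)"]
  obtain Q' where Q': "\<And>n k. x \<le> k \<Longrightarrow> (swap_fps (fps_X ^ x) - Q' * swap_fps G) $ n $ k = 0"
    unfolding x_def restr_fps_def by metis
  define Q where "Q = swap_fps Q'"
  have "swap_fps (fps_X ^ x) - Q' * swap_fps G = swap_fps (fps_X ^ x - Q * G)"
    by (simp add: Q_def rhom_diff[OF rhom_swap_fps] rhom_mult[OF rhom_swap_fps])
  then have "(fps_X ^ x - Q * G) $ k $ n = 0" if "x \<le> k" for n k
    using Q'[OF that, of n] by simp
  then have Q: "(Q * G) $ k = (fps_X ^ x) $ k" if "x \<le> k" for k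
    using that by (simp add: fps_eq_iff)
  define A where "A = Poly (map (\<lambda>k. (Q * G) $ k) [0..<Suc x])"
  have cA: "coeff A k = (Q * G) $ k" for k
    using Q[of k] by (simp add: A_def coeff_Poly_eq nth_default_def del: upt_Suc)
  then have A: "fps_of_poly A = Q * G" by (simp add: fps_eq_iff)
  have top: "coeff A x = 1" by (simp add: cA Q)
  have "degree A = x"
    by (rule antisym[OF degree_le le_degree]) (use top in \<open>simp_all add: cA Q\<close>)
  have X0: "restr_fps (fps_X ^ x :: 'a fps fps) = fps_X ^ x"
  proof -
    have "restr_fps (fps_X :: 'a fps fps) = fps_X" by (simp add: fps_eq_iff restr_fps_nth fps_X_nth)
    then show ?thesis by (simp add: rhom_simps[OF rhom_restr_fps])
  qed
  have eq: "restr_fps (fps_of_poly A) = restr_fps Q * restr_fps G"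
    by (simp add: A rhom_mult[OF rhom_restr_fps])
  have "restr_fps (fps_of_poly A) $ k = fps_X ^ x $ k" for k
  proof (cases "k < x")
    case True
    have "(restr_fps Q * restr_fps G) $ k = 0"
      using True unfolding x_def fps_mult_nth by (intro sum.neutral) (auto intro: nth_less_subdegree_zero)
    then show ?thesis using True eq by simp
  next
    case False
    then have "restr_fps (fps_of_poly A) $ k = restr_fps (fps_X ^ x) $ k"
      using Q[of k] by (simp add: restr_fps_nth cA)
    then show ?thesis by (simp add: X0)
  qed
  then have rA: "restr_fps (fps_of_poly A) = fps_X ^ x" by (simp add: fps_eq_iff)
  \<comment> \<open>On \<open>v = 0\<close> the coefficient of \<open>u^x\<close> in
    \<open>Q * G\<close> is the constant term of \<open>Q\<close> times the lowest coefficient of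
    \<open>G\<close>. It equals 1, so \<open>Q\<close> is invertible.\<close>
  have "(restr_fps Q * restr_fps G) $ x = restr_fps Q $ 0 * restr_fps G $ x"
    unfolding x_def by simp
  moreover have "(restr_fps Q * restr_fps G) $ x = 1" using rA eq by (metis fps_X_power_nth)
  ultimately have "Q $ 0 $ 0 \<noteq> 0" by (auto simp: restr_fps_nth)
  then have "Q dvd 1" by (simp add: fps2_unit_iff)
  then obtain U where U: "1 = Q * U" by (elim dvdE)
  show ?thesis
  proof
    show "degree A = subdegree (restr_fps G)" using \<open>degree A = x\<close> by (simp add: x_def)
    show "lead_coeff A = 1" using \<open>degree A = x\<close> top by simp
    show "fps_of_poly A * U = G" using U A by (metis mult.assoc mult.commute mult_1)
    show "U dvd 1" using U by (metis dvd_triv_right)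
    show "restr_fps (fps_of_poly A) = fps_X ^ degree A" using rA \<open>degree A = x\<close> by simp
  qed
qed

lemma monic_division:
  fixes A :: "'a::idom poly"
  assumes "lead_coeff A = 1"
  obtains B r where "P = A * B + r" "r = 0 \<or> degree r < degree A"
proof -
  have "A \<noteq> 0" using assms by auto
  obtain q r where "pseudo_divmod P A = (q, r)" by (cases "pseudo_divmod P A")
  from pseudo_divmod[OF \<open>A \<noteq> 0\<close> this] show ?thesis using assms that by auto
qed

section \<open>Germs of irreducible curves have a single tangent\<close>

definition fps_coeffs :: "'a::comm_ring_1 poly poly \<Rightarrow> 'a fps poly" where
  "fps_coeffs P = map_poly fps_of_poly P"

lemma germ_fps_coeffs: "germ P = fps_of_poly (fps_coeffs P)"
  by (simp add: germ_def fps_coeffs_def)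

lemma coeff_fps_coeffs: "coeff (fps_coeffs P) i = fps_of_poly (coeff P i)"
  by (simp add: fps_coeffs_def coeff_map_poly)

lemma germ_nth: "germ P $ i $ j = cf P i j"
  by (simp add: germ_fps_coeffs coeff_fps_coeffs)

lemma rhom_fps_of_poly: "rhom fps_of_poly"
  by (simp add: rhom_def fps_of_poly_add fps_of_poly_mult)

lemma rhom_fps_coeffs: "rhom fps_coeffs"
  unfolding fps_coeffs_def[abs_def] by (rule rhom_map_poly[OF rhom_fps_of_poly])

lemma rhom_germ: "rhom germ"
proof -
  have "germ = (\<lambda>P. fps_of_poly (fps_coeffs P :: 'a fps poly))" by (rule ext) (rule germ_fps_coeffs)
  then show ?thesis using rhom_comp[OF rhom_fps_of_poly rhom_fps_coeffs] by metis
qed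

lemma germ_eq_0_iff [simp]: "germ P = 0 \<longleftrightarrow> P = 0"
proof
  assume "germ P = 0"
  then have "cf P i j = 0" for i j by (metis germ_nth fps_zero_nth)
  then show "P = 0" by (metis coeff_0 poly_eqI)
qed (simp add: rhom_0[OF rhom_germ])

lemma germ_unit_iff: "germ P dvd 1 \<longleftrightarrow> at_origin P \<noteq> 0"
  by (simp add: fps2_unit_iff germ_nth at_origin_def)

lemma restr_fps_germ: "restr_fps (germ P) = fps_of_poly (restr_v P)"
  by (simp add: fps_eq_iff restr_fps_nth germ_nth coeff_restr_v)

lemma germ_swap: "germ (swap_vars P) = swap_fps (germ P)"
  by (simp add: fps_eq_iff germ_nth cf_swap)

lemma irreducible_germ_swap: "irreducible (germ (swap_vars P)) \<longleftrightarrow> irreducible (germ P)"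
proof -
  have unit: "swap_fps G dvd 1 \<longleftrightarrow> G dvd 1" for G :: "'a fps fps" by (simp add: fps2_unit_iff)
  have *: "irreducible (swap_fps G)" if "irreducible G" for G :: "'a fps fps"
  proof (rule irreducibleI)
    show "swap_fps G \<noteq> 0" "\<not> swap_fps G dvd 1" using that by (auto simp: unit irreducible_def)
    fix A B assume "swap_fps G = A * B"
    then have "G = swap_fps A * swap_fps B" by (metis rhom_mult rhom_swap_fps swap_swap_fps)
    then show "A dvd 1 \<or> B dvd 1" using that unit irreducibleD by blast
  qed
  show ?thesis using *[of "germ P"] *[of "germ (swap_vars P)"] by (auto simp: germ_swap)
qed

text \<open>The polynomial \<open>v\<^sup>n A((u - c v) / v, v)\<close> where \<open>n\<close> is the degree of \<open>A\<close>.\<close>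

definition push_down :: "'a::field \<Rightarrow> 'a fps poly \<Rightarrow> 'a fps poly" where
  "push_down c A = (\<Sum>i\<le>degree A. smult (fps_X ^ (degree A - i) * coeff A i) ([:- fps_const c * fps_X, 1:] ^ i))"

abbreviation (input) chart :: "'a::field \<Rightarrow> 'a fps poly" where
  "chart c \<equiv> [:fps_const c * fps_X, fps_X:]"

text \<open>In the chart \<open>u = v (u' + c)\<close> the form \<open>u - c v\<close> is
  \<open>v u'\<close>, so every term of \<open>push_down c A\<close> acquires the same power of
  \<open>v\<close>.\<close>

lemma push_down_chart: "push_down c A \<circ>\<^sub>p chart c = smult (fps_X ^ degree A) A"
proof -
  have "[:- fps_const c * fps_X, 1:] \<circ>\<^sub>p chart c = [:0, fps_X:]"
    by (simp add: pcompose_pCons)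
  moreover have "smult (fps_X ^ (degree A - i) * coeff A i) ([:0, fps_X:] ^ i) =
      smult (fps_X ^ degree A) (monom (coeff A i) i)" if "i \<le> degree A" for i
  proof -
    have m: "[:0, fps_X:] ^ i = monom (fps_X ^ i) i" for i
      by (induction i) (simp_all add: monom_Suc one_pCons monom_0 mult.commute[of _ "fps_X::'a fps"] smult_monom)
    have e: "fps_X ^ (degree A - i) * fps_X ^ i = (fps_X ^ degree A :: 'a fps)"
      using that by (simp flip: power_add)
    have "fps_X ^ (degree A - i) * coeff A i * fps_X ^ i = fps_X ^ degree A * coeff A i"
      unfolding e[symmetric] by (simp only: mult_ac)
    then show ?thesis by (simp only: m smult_monom)
  qed
  ultimately have "push_down c A \<circ>\<^sub>p chart c = (\<Sum>i\<le>degree A. smult (fps_X ^ degree A) (monom (coeff A i) i))"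
    by (simp add: push_down_def pcompose_sum pcompose_smult rhom_power[OF rhom_pcompose])
  also have "\<dots> = smult (fps_X ^ degree A) (\<Sum>i\<le>degree A. monom (coeff A i) i)"
    by (rule poly_eqI) (simp add: coeff_sum flip: sum_distrib_left)
  finally show ?thesis by (simp add: poly_as_sum_of_monoms)
qed

lemma degree_linear_power: "degree ([:a, 1:] ^ i :: 'a::idom poly) = i"
  by (simp add: degree_power_eq)

lemma lead_coeff_linear_power: "coeff ([:a, 1:] ^ i :: 'a::idom poly) i = 1"
  by (metis degree_linear_power lead_coeff_power lead_coeff_pCons(1) one_neq_zero pCons_one power_one lead_coeff_1)

lemma push_down_monic:
  assumes "lead_coeff A = 1"
  shows "degree (push_down c A) = degree A" "lead_coeff (push_down c A) = 1"
proof -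
  let ?l = "[:- fps_const c * fps_X, 1:]"
  have top: "coeff (push_down c A) (degree A) = 1"
  proof -
    have "coeff (push_down c A) (degree A) =
      (\<Sum>i\<le>degree A. (fps_X ^ (degree A - i) * coeff A i) * coeff (?l ^ i) (degree A))"
      by (simp add: push_down_def coeff_sum)
    also have "\<dots> = (\<Sum>i\<in>{degree A}. (fps_X ^ (degree A - i) * coeff A i) * coeff (?l ^ i) (degree A))"
      by (rule sum.mono_neutral_right) (auto simp: degree_linear_power intro!: coeff_eq_0)
    finally show ?thesis using assms by (simp add: lead_coeff_linear_power)
  qed
  have "degree (push_down c A) \<le> degree A"
    unfolding push_down_def
    by (rule degree_sum_le) (auto intro: order.trans[OF degree_smult_le] simp: degree_linear_power)
  with top show "degree (push_down c A) = degree A" by (metis le_antisym le_degree one_neq_zero)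
  with top show "lead_coeff (push_down c A) = 1" by simp
qed

lemma push_down_origin:
  assumes "degree A > 0" shows "coeff (push_down c A) 0 $ 0 = 0"
proof -
  have "coeff ([:- fps_const c * fps_X, 1:] ^ i) 0 = (- fps_const c * fps_X) ^ i" for i
    by (simp add: coeff_0_power)
  then show ?thesis using assms
    by (auto simp: push_down_def coeff_sum fps_sum_nth fps_nth_power_0 intro!: sum.neutral)
qed

lemma chart_inj: "P \<circ>\<^sub>p chart c = 0 \<longleftrightarrow> P = (0 :: 'a::field fps poly)"
  using pcompose_eq_0[of P "chart c"] by auto

lemma fps_coeffs_total_step: "fps_coeffs (total_step (Fin c) P) = fps_coeffs P \<circ>\<^sub>p chart c"
proof (rule rhom_eqI[of "\<lambda>P. fps_coeffs (total_step (Fin c) P)" "\<lambda>P. fps_coeffs P \<circ>\<^sub>p chart c"])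
  show "rhom (\<lambda>P. fps_coeffs (total_step (Fin c) P))"
    by (rule rhom_comp[OF rhom_fps_coeffs rhom_total_step])
  show "rhom (\<lambda>P. fps_coeffs P \<circ>\<^sub>p chart c)"
    by (rule rhom_comp[OF rhom_pcompose rhom_fps_coeffs])
qed (simp_all add: total_step_vars,
  simp_all add: fps_coeffs_def cst_def inner_var_def outer_var_def map_poly_pCons fps_of_poly_const
    pcompose_pCons fps_of_poly_pCons mult.commute)

text \<open>A factorization of the strict transform descends: the Weierstrass polynomials of the
  factors are pushed down, and their product divides \<open>P\<close>. The equation between the
  cofactors \<open>B\<close> and \<open>Q\<close> keeps the powers of \<open>v\<close> from which
  the multiplicity is read off later.\<close>

lemma factor_below:
  fixes P :: "'a::field poly poly"
  assumes P: "P \<noteq> 0" and G: "germ (strict_step (Fin c) P) = G1 * G2"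
  obtains A1 A2 B :: "'a fps poly" and Q where
    "fps_coeffs (strict_step (Fin c) P) = A1 * A2 * B"
    "fps_coeffs P = push_down c A1 * push_down c A2 * Q"
    "smult (fps_X ^ mult_origin P) B = smult (fps_X ^ (degree A1 + degree A2)) (Q \<circ>\<^sub>p chart c)"
    "degree A1 = subdegree (restr_fps G1)" "degree A2 = subdegree (restr_fps G2)"
proof -
  define S where "S = strict_step (Fin c) P"
  have "restr_v S \<noteq> 0"
    using restr_v_strict_step[OF P] tcone_neq_0[OF P] pcompose_eq_0[of "tcone P" "[:c, 1:]"] by (auto simp: S_def)
  then have rS: "restr_fps (germ S) \<noteq> 0" by (simp add: restr_fps_germ)
  then have nz: "restr_fps G1 \<noteq> 0" "restr_fps G2 \<noteq> 0"
    using G by (auto simp: S_def rhom_mult[OF rhom_restr_fps])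
  obtain A1 U1 where A1: "degree A1 = subdegree (restr_fps G1)" "lead_coeff A1 = 1"
    "fps_of_poly A1 * U1 = G1" "restr_fps (fps_of_poly A1) = fps_X ^ degree A1"
    using weierstrass_preparation[OF nz(1)] by metis
  obtain A2 U2 where A2: "degree A2 = subdegree (restr_fps G2)" "lead_coeff A2 = 1"
    "fps_of_poly A2 * U2 = G2" "restr_fps (fps_of_poly A2) = fps_X ^ degree A2"
    using weierstrass_preparation[OF nz(2)] by metis
  define A where "A = A1 * A2"
  have lcA: "lead_coeff A = 1" using A1 A2 by (simp add: A_def lead_coeff_mult)
  then have A0: "A \<noteq> 0" by auto
  have dA: "degree A = degree A1 + degree A2"
    using A0 unfolding A_def by (intro degree_mult_eq) auto
  have gS: "germ S = fps_of_poly A * (U1 * U2)"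
    using G A1 A2 by (simp add: S_def A_def fps_of_poly_mult mult_ac flip: A1(3) A2(3))
  have rA: "restr_fps (fps_of_poly A) = fps_X ^ degree A"
    by (simp add: A_def dA[unfolded A_def] fps_of_poly_mult rhom_mult[OF rhom_restr_fps] A1 A2 power_add)
  \<comment> \<open>So far \<open>A\<close> divides \<open>S\<close> only as a power series in
    \<open>u\<close>. Uniqueness in Weierstrass division identifies the series quotient with the
    polynomial quotient \<open>B\<close>, so the division is exact.\<close>
  obtain B r where B: "fps_coeffs S = A * B + r" "r = 0 \<or> degree r < degree A"
    using monic_division[OF lcA] .
  have "U1 * U2 - fps_of_poly B = 0"
  proof (rule weierstrass_unique[of "fps_of_poly A"])
    show "restr_fps (fps_of_poly A) \<noteq> 0" using rA by simp
    fix n k assume "subdegree (restr_fps (fps_of_poly A)) \<le> k"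
    then have k: "degree A \<le> k" using rA by (simp add: fps_X_power_subdegree)
    have "(U1 * U2 - fps_of_poly B) * fps_of_poly A = fps_of_poly r"
      using gS B(1) by (simp add: germ_fps_coeffs fps_of_poly_mult fps_of_poly_add algebra_simps)
    then show "((U1 * U2 - fps_of_poly B) * fps_of_poly A) $ k $ n = 0"
      using k B(2) by (auto simp: coeff_eq_0)
  qed
  then have "fps_of_poly (fps_coeffs S) = fps_of_poly (A * B)"
    using gS by (simp add: germ_fps_coeffs fps_of_poly_mult mult_ac)
  then have SB: "fps_coeffs S = A * B" by (simp only: fps_of_poly_eq_iff)
  define D where "D = push_down c A1 * push_down c A2"
  have lcD: "lead_coeff D = 1" and dD: "degree D = degree A"
  proof -
    note m = push_down_monic[OF A1(2), of c] push_down_monic[OF A2(2), of c]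
    show "lead_coeff D = 1" using m by (simp add: D_def lead_coeff_mult)
    have "push_down c A1 \<noteq> 0" "push_down c A2 \<noteq> 0" using m(2,4) by auto
    then show "degree D = degree A" using m(1,3) by (simp add: D_def dA degree_mult_eq)
  qed
  have Dc: "D \<circ>\<^sub>p chart c = smult (fps_X ^ degree A) A"
    unfolding dA unfolding A_def D_def by (simp only: pcompose_mult push_down_chart power_add) (simp add: mult.commute)
  obtain Q R where Q: "fps_coeffs P = D * Q + R" "R = 0 \<or> degree R < degree D"
    using monic_division[OF lcD] .
  have "fps_coeffs (vvar ^ mult_origin P) = ([:fps_X ^ mult_origin P:] :: 'a fps poly)"
    by (simp add: rhom_power[OF rhom_fps_coeffs])
       (simp add: fps_coeffs_def inner_var_def map_poly_pCons poly_const_pow)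
  then have tot: "smult (fps_X ^ mult_origin P) (A * B) = smult (fps_X ^ degree A) (A * (Q \<circ>\<^sub>p chart c)) + R \<circ>\<^sub>p chart c"
    using arg_cong[OF total_step_Fin_factor[OF P, of c], of fps_coeffs]
    unfolding fps_coeffs_total_step S_def[symmetric] rhom_mult[OF rhom_fps_coeffs] SB Q(1) pcompose_add pcompose_mult Dc
    by simp
  \<comment> \<open>The pullback of \<open>R\<close> is divisible by \<open>A\<close>, although its
    degree in \<open>u\<close> is below that of \<open>A\<close>.\<close>
  have "R = 0"
  proof (rule ccontr)
    assume "R \<noteq> 0"
    then have R0: "R \<circ>\<^sub>p chart c \<noteq> 0" by (simp add: chart_inj)
    have "R \<circ>\<^sub>p chart c = A * (smult (fps_X ^ mult_origin P) B - smult (fps_X ^ degree A) (Q \<circ>\<^sub>p chart c))"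
      using tot by (simp add: algebra_simps)
    then have "A dvd R \<circ>\<^sub>p chart c" by (metis dvd_triv_left)
    then have "degree A \<le> degree (R \<circ>\<^sub>p chart c)" using R0 by (rule dvd_imp_degree_le)
    also have "\<dots> \<le> degree R" using degree_pcompose_le[of R "chart c"] by simp
    finally show False using Q(2) \<open>R \<noteq> 0\<close> dD by simp
  qed
  have "A * smult (fps_X ^ mult_origin P) B = A * smult (fps_X ^ degree A) (Q \<circ>\<^sub>p chart c)"
    using tot \<open>R = 0\<close> by simp
  then have "smult (fps_X ^ mult_origin P) B = smult (fps_X ^ degree A) (Q \<circ>\<^sub>p chart c)"
    using A0 by (metis mult_cancel_left)
  then show ?thesis
    using that[of A1 A2 B Q] SB Q(1) \<open>R = 0\<close> A1 A2 dA by (simp add: S_def A_def D_def)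
qed

text \<open>Both parts rest on \<open>factor_below\<close>. Nonunit factors above would push down to
  nonunit factors of \<open>P\<close>. For the tangent cone, the trivial factorization shows that
  \<open>P\<close> is a unit times the push-down of the Weierstrass polynomial of the strict
  transform, whose degree is the order of the cone at \<open>c\<close>. This order then equals
  \<open>mult_origin P\<close>, which also bounds the degree of the cone.\<close>

lemma irreducible_strict_step_Fin:
  fixes P :: "'a::field poly poly"
  assumes irr: "irreducible (germ P)" and org: "at_origin (strict_step (Fin c) P) = 0"
  shows "irreducible (germ (strict_step (Fin c) P))"
    and "\<exists>a. a \<noteq> 0 \<and> tcone P = smult a ([:- c, 1:] ^ mult_origin P)"
proof -
  define S where "S = strict_step (Fin c) P"
  have P: "P \<noteq> 0" using irr by (auto simp: rhom_0[OF rhom_germ])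
  have rSt: "restr_v S = tcone P \<circ>\<^sub>p [:c, 1:]" by (simp add: S_def restr_v_strict_step[OF P])
  have rS0: "restr_v S \<noteq> 0"
    using tcone_neq_0[OF P] pcompose_eq_0[of "tcone P" "[:c, 1:]"] by (auto simp: rSt)
  then have rS: "restr_fps (germ S) \<noteq> 0" by (simp add: restr_fps_germ)
  have pos: "degree A > 0" if "degree A = subdegree (restr_fps G)" "G $ 0 $ 0 = 0" "restr_fps G \<noteq> 0"
    for A :: "'a fps poly" and G
    using that by (metis restr_fps_nth nth_subdegree_nonzero neq0_conv)
  have nonunit: "\<not> fps_of_poly (push_down c A) dvd 1" if "degree A > 0" for A
    using push_down_origin[OF that, of c] by (simp add: fps2_unit_iff)
  show "irreducible (germ S)" unfolding S_def[symmetric]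
  proof (rule irreducibleI)
    show "germ S \<noteq> 0" using rS rhom_0[OF rhom_restr_fps] by metis
    show "\<not> germ S dvd 1" using org by (simp add: germ_unit_iff S_def)
    fix G1 G2 assume G: "germ S = G1 * G2"
    then have nz: "restr_fps G1 \<noteq> 0" "restr_fps G2 \<noteq> 0" using rS by (auto simp: rhom_mult[OF rhom_restr_fps])
    obtain A1 A2 B Q where
      AB: "fps_coeffs P = push_down c A1 * push_down c A2 * Q"
      "degree A1 = subdegree (restr_fps G1)" "degree A2 = subdegree (restr_fps G2)"
      using factor_below[OF P G[unfolded S_def]] by metis
    have "germ P = fps_of_poly (push_down c A1) * (fps_of_poly (push_down c A2) * fps_of_poly Q)"
      using AB(1) by (simp add: germ_fps_coeffs fps_of_poly_mult mult.assoc)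
    from irreducibleD[OF irr this]
    have "fps_of_poly (push_down c A1) dvd 1 \<or> fps_of_poly (push_down c A2) dvd 1"
      using dvd_mult_left by blast
    then show "G1 dvd 1 \<or> G2 dvd 1"
      using nonunit pos[OF AB(2) _ nz(1)] pos[OF AB(3) _ nz(2)] by (auto simp: fps2_unit_iff)
  qed
  have "germ (strict_step (Fin c) P) = germ S * 1" by (simp add: S_def)
  from factor_below[OF P this, folded S_def]
  obtain A1 A2 B :: "'a fps poly" and Q where
    AB: "fps_coeffs S = A1 * A2 * B" "fps_coeffs P = push_down c A1 * push_down c A2 * Q"
    "smult (fps_X ^ mult_origin P) B = smult (fps_X ^ (degree A1 + degree A2)) (Q \<circ>\<^sub>p chart c)"
    "degree A1 = subdegree (restr_fps (germ S))" "degree A2 = subdegree (restr_fps (1 :: 'a fps fps))"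
    by blast
  define x where "x = degree A1"
  have d2: "degree A2 = 0" using AB(5) by (simp add: rhom_1[OF rhom_restr_fps])
  have "degree A1 > 0" by (rule pos[OF AB(4) _ rS]) (use org in \<open>simp add: germ_nth S_def at_origin_def\<close>)
  have gP: "germ P = fps_of_poly (push_down c A1) * (fps_of_poly (push_down c A2) * fps_of_poly Q)"
    using AB(2) by (simp add: germ_fps_coeffs fps_of_poly_mult mult.assoc)
  from irreducibleD[OF irr this] nonunit[OF \<open>degree A1 > 0\<close>]
  have "fps_of_poly Q dvd 1" using dvd_mult_right by blast
  then have Q0: "coeff Q 0 $ 0 \<noteq> 0" by (simp add: fps2_unit_iff)
  have Q'0: "coeff (Q \<circ>\<^sub>p chart c) 0 $ 0 \<noteq> 0"
  proof -
    have "poly p (fps_const c * fps_X) $ 0 = coeff p 0 $ 0" for p :: "'a fps poly"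
      by (cases p) simp
    then show ?thesis using Q0 by simp
  qed
  \<comment> \<open>Neither cofactor is divisible by \<open>v\<close>: \<open>B\<close> because
    \<open>S\<close> does not vanish on \<open>v = 0\<close>, the pullback of \<open>Q\<close>
    because its constant term is a unit. So the two powers of \<open>v\<close> agree.\<close>
  have "mult_origin P = x"
  proof (rule linorder_cases)
    assume "mult_origin P < x"
    then obtain k where "x = mult_origin P + Suc k" using less_imp_Suc_add[of "mult_origin P" x] by auto
    then have "smult (fps_X ^ mult_origin P) B = smult (fps_X ^ mult_origin P) (smult (fps_X ^ Suc k) (Q \<circ>\<^sub>p chart c))"
      using AB(3) d2 by (simp add: x_def power_add mult_ac)
    then have "B = smult fps_X (smult (fps_X ^ k) (Q \<circ>\<^sub>p chart c))"
      by (metis (no_types, lifting) mult_eq_0_iff power_Suc smult_cancel smult_smult power_eq_0_iff fps_X_neq_zero)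
    then have "fps_coeffs S = smult fps_X (A1 * A2 * smult (fps_X ^ k) (Q \<circ>\<^sub>p chart c))" using AB(1) by simp
    then have "fps_of_poly (coeff S i) = fps_X * coeff (A1 * A2 * smult (fps_X ^ k) (Q \<circ>\<^sub>p chart c)) i" for i
      by (metis coeff_fps_coeffs coeff_smult)
    then have "fps_of_poly (coeff S i) $ 0 = 0" for i by simp
    then have "restr_v S = 0" by (intro poly_eqI) (simp add: coeff_restr_v)
    then show ?thesis using rS0 by simp
  next
    assume "x < mult_origin P"
    then obtain k where "mult_origin P = x + Suc k" using less_imp_Suc_add[of x "mult_origin P"] by auto
    then have "smult (fps_X ^ x) (smult (fps_X ^ Suc k) B) = smult (fps_X ^ x) (Q \<circ>\<^sub>p chart c)"
      using AB(3) d2 by (simp add: x_def power_add mult_ac)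
    then have "smult (fps_X ^ Suc k) B = Q \<circ>\<^sub>p chart c"
      by (metis smult_cancel power_eq_0_iff fps_X_neq_zero)
    then have "coeff (Q \<circ>\<^sub>p chart c) 0 = fps_X * (fps_X ^ k * coeff B 0)" by (metis coeff_smult mult.assoc power_Suc)
    then show ?thesis using Q'0 by simp
  qed
  then have e: "mult_origin P = subdegree (fps_of_poly (restr_v S))"
    using AB(4) by (simp add: x_def restr_fps_germ)
  have deg: "degree (restr_v S) \<le> mult_origin P"
    using degree_pcompose_le[of "tcone P" "[:c, 1:]"] degree_tcone[of P] by (simp add: rSt)
  have "coeff (restr_v S) i = 0" if "i \<noteq> mult_origin P" for i
  proof (cases "i < mult_origin P")
    case True
    then have "fps_of_poly (restr_v S) $ i = 0" unfolding e by (rule nth_less_subdegree_zero)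
    then show ?thesis by simp
  next
    case False
    with that deg show ?thesis by (intro coeff_eq_0) simp
  qed
  then have "restr_v S = monom (coeff (restr_v S) (mult_origin P)) (mult_origin P)"
    by (intro poly_eqI) simp
  moreover define a where "a = coeff (restr_v S) (mult_origin P)"
  ultimately have mon: "restr_v S = monom a (mult_origin P)" by simp
  have "tcone P = tcone P \<circ>\<^sub>p ([:c, 1:] \<circ>\<^sub>p [:- c, 1:])" by (simp add: pcompose_pCons)
  also have "\<dots> = monom a (mult_origin P) \<circ>\<^sub>p [:- c, 1:]" using rSt mon by (simp add: pcompose_assoc)
  also have "\<dots> = smult a ([:- c, 1:] ^ mult_origin P)"
    by (simp add: monom_altdef pcompose_smult rhom_power[OF rhom_pcompose] pcompose_pCons)
  finally show "\<exists>a. a \<noteq> 0 \<and> tcone P = smult a ([:- c, 1:] ^ mult_origin P)"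
    using tcone_neq_0[OF P] by (metis smult_0_left)
qed

lemma irreducible_strict_step_Inf:
  fixes P :: "'a::field poly poly"
  assumes irr: "irreducible (germ P)" and org: "at_origin (strict_step Inf P) = 0"
  shows "irreducible (germ (strict_step Inf P))"
    and "\<exists>a. a \<noteq> 0 \<and> tcone P = [:a:]"
proof -
  have P: "P \<noteq> 0" using irr by (auto simp: rhom_0[OF rhom_germ])
  have irr': "irreducible (germ (swap_vars P))" using irr by (simp add: irreducible_germ_swap)
  have org': "at_origin (strict_step (Fin 0) (swap_vars P)) = 0" using org by (simp add: strict_step_Inf[OF P])
  show "irreducible (germ (strict_step Inf P))"
    using irreducible_strict_step_Fin(1)[OF irr' org'] by (simp add: strict_step_Inf[OF P] irreducible_germ_swap)
  obtain a where a: "a \<noteq> 0" "tcone (swap_vars P) = smult a ([:0, 1:] ^ mult_origin P)"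
    using irreducible_strict_step_Fin(2)[OF irr' org'] by (auto simp: mult_origin_swap)
  then have t: "tcone (swap_vars P) = monom a (mult_origin P)" by (simp add: monom_altdef)
  have "coeff (tcone P) i = coeff [:a:] i" for i
  proof (cases "i \<le> mult_origin P")
    case True
    then have "coeff (tcone P) i = coeff (tcone (swap_vars P)) (mult_origin P - i)"
      by (simp add: coeff_tcone mult_origin_swap cf_swap)
    then show ?thesis using True by (auto simp: t coeff_pCons split: nat.split)
  next
    case False
    then show ?thesis by (auto simp: coeff_tcone coeff_pCons split: nat.split)
  qed
  then show "\<exists>a. a \<noteq> 0 \<and> tcone P = [:a:]" using a(1) poly_eqI by metis
qed


section \<open>Infinitely near points of a curve\<close>

lemma order_0_eqI:
  fixes p :: "'a::idom poly"
  assumes "coeff p n \<noteq> 0" "\<And>k. k < n \<Longrightarrow> coeff p k = 0"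
  shows "order 0 p = n"
proof -
  have m: "[:- 0, 1:] ^ k = monom (1::'a) k" for k by (simp add: monom_altdef)
  show ?thesis
  proof (rule order_unique_lemma)
    show "[:- 0, 1:] ^ n dvd p" unfolding m using assms by (simp add: monom_1_dvd_iff')
    show "\<not> [:- 0, 1:] ^ Suc n dvd p" unfolding m using assms by (auto simp: monom_1_dvd_iff' simp del: monom_Suc)
  qed
qed

lemma order_0_pos: "p \<noteq> 0 \<Longrightarrow> coeff p 0 = 0 \<Longrightarrow> 0 < order 0 p"
  by (metis gr0I order_root poly_0_coeff_0)

text \<open>The intersection numbers at the origin with the axis \<open>v = 0\<close> and, for
  \<open>ordu\<close>, with \<open>u = 0\<close>.\<close>

definition ordv :: "'a::field poly poly \<Rightarrow> nat" where "ordv P = order 0 (restr_v P)"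
definition ordu :: "'a::field poly poly \<Rightarrow> nat" where "ordu P = order 0 (coeff P 0)"

lemma restr_v_swap: "restr_v (swap_vars P) = coeff P 0"
  by (rule poly_eqI) (simp add: coeff_restr_v cf_swap)

lemma coeff_0_swap: "coeff (swap_vars P) 0 = restr_v P"
  using restr_v_swap[of "swap_vars P"] by simp

lemma ordv_swap [simp]: "ordv (swap_vars P) = ordu P" and ordu_swap [simp]: "ordu (swap_vars P) = ordv P"
  by (simp_all add: ordv_def ordu_def restr_v_swap coeff_0_swap)

text \<open>Noether's formula for the axes. The tangent cone is a power of \<open>u - c v\<close>,
  so the curve meets \<open>v = 0\<close> with the least possible number \<open>e\<close>, and the
  exceptional curve with the same number. Only an axis in the tangent direction,
  \<open>u = 0\<close> when \<open>c = 0\<close>, keeps some intersection above.\<close>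

lemma orders_step_Fin:
  fixes P :: "'a::field poly poly"
  assumes irr: "irreducible (germ P)" and org: "at_origin (strict_step (Fin c) P) = 0"
  defines "P' \<equiv> strict_step (Fin c) P" and "e \<equiv> mult_origin P"
  shows "restr_v P' \<noteq> 0" "ordv P' = e" "restr_v P \<noteq> 0" "ordv P = e"
    "c \<noteq> 0 \<Longrightarrow> ordu P = e" "c = 0 \<Longrightarrow> coeff P 0 \<noteq> 0 \<Longrightarrow> coeff P' 0 \<noteq> 0 \<and> ordu P = e + ordu P'"
proof -
  have P: "P \<noteq> 0" using irr by (auto simp: rhom_0[OF rhom_germ])
  obtain a where a: "a \<noteq> 0" "tcone P = smult a ([:- c, 1:] ^ e)"
    using irreducible_strict_step_Fin(2)[OF irr org] by (auto simp: e_def)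
  have "restr_v P' = smult a (monom 1 e)"
    by (simp add: P'_def restr_v_strict_step[OF P] a pcompose_smult rhom_power[OF rhom_pcompose] pcompose_pCons
        monom_altdef)
  then have r: "restr_v P' = monom a e" by (simp add: smult_monom)
  show "restr_v P' \<noteq> 0" "ordv P' = e" using a(1) by (auto simp: r ordv_def intro: order_0_eqI)
  have "coeff (tcone P) e = a" by (simp add: a lead_coeff_linear_power)
  then have 1: "coeff (restr_v P) e = a" by (simp add: coeff_restr_v coeff_tcone e_def)
  have "coeff (restr_v P) k = 0" if "k < e" for k
    using mult_origin_le[of P k 0] that by (auto simp: coeff_restr_v e_def)
  with 1 a(1) show "ordv P = e" "restr_v P \<noteq> 0" by (auto simp: ordv_def intro!: order_0_eqI)
  show "ordu P = e" if "c \<noteq> 0"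
  proof -
    have "coeff (tcone P) 0 = a * (- c) ^ e" by (simp add: a coeff_0_power)
    then have "cf P 0 e \<noteq> 0" using that a(1) by (simp add: coeff_tcone e_def)
    moreover have "cf P 0 k = 0" if "k < e" for k using mult_origin_le[of P 0 k] that by (auto simp: e_def)
    ultimately show ?thesis by (auto simp: ordu_def intro!: order_0_eqI)
  qed
  show "coeff P' 0 \<noteq> 0 \<and> ordu P = e + ordu P'" if c: "c = 0" and P0: "coeff P 0 \<noteq> 0"
  proof -
    have "coeff (total_step (Fin 0) P) 0 = coeff P 0"
      by (rule poly_eqI) (simp add: cf_total_step_0)
    moreover have "coeff (total_step (Fin 0) P) 0 = monom 1 e * coeff P' 0"
      by (rule poly_eqI)
         (simp add: total_step_0_factor[OF P] P'_def c e_def coeff_coeff_inner_power_mult coeff_monom_mult)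
    ultimately have *: "coeff P 0 = monom 1 e * coeff P' 0" by simp
    then have "coeff P' 0 \<noteq> 0" using P0 by auto
    moreover have "order 0 (monom (1::'a) e) = e" by (rule order_0_eqI) auto
    ultimately show ?thesis using P0 unfolding ordu_def * by (simp add: order_mult)
  qed
qed

lemma orders_step_Inf:
  fixes P :: "'a::field poly poly"
  assumes irr: "irreducible (germ P)" and org: "at_origin (strict_step Inf P) = 0"
  defines "P' \<equiv> strict_step Inf P" and "e \<equiv> mult_origin P"
  shows "coeff P' 0 \<noteq> 0" "ordu P' = e" "ordu P = e"
    "restr_v P \<noteq> 0 \<Longrightarrow> restr_v P' \<noteq> 0 \<and> ordv P = e + ordv P'"
proof -
  have P: "P \<noteq> 0" using irr by (auto simp: rhom_0[OF rhom_germ])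
  have irr': "irreducible (germ (swap_vars P))" using irr by (simp add: irreducible_germ_swap)
  have P': "strict_step (Fin 0) (swap_vars P) = swap_vars P'" by (simp add: P'_def strict_step_Inf[OF P])
  have "at_origin (strict_step (Fin 0) (swap_vars P)) = 0" using org by (simp add: P' P'_def)
  note * = orders_step_Fin[OF irr' this, unfolded P' mult_origin_swap]
  show "coeff P' 0 \<noteq> 0" "ordu P' = e" "ordu P = e"
    "restr_v P \<noteq> 0 \<Longrightarrow> restr_v P' \<noteq> 0 \<and> ordv P = e + ordv P'"
    using * by (simp_all add: e_def restr_v_swap coeff_0_swap)
qed

lemma irreducible_strict_step:
  fixes P :: "'a::field poly poly"
  assumes "irreducible (germ P)" "at_origin (strict_step s P) = 0"
  shows "irreducible (germ (strict_step s P))"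
  using assms irreducible_strict_step_Fin(1) irreducible_strict_step_Inf(1) by (cases s) auto

text \<open>The tangent cone is a constant times a power of a linear form over the ground field, so
  a field extension \<open>h\<close> brings no further roots. The extension to the algebraic closure
  serves \<open>points_above\<close>.\<close>

lemma other_direction_nonzero:
  fixes P :: "'a::field poly poly" and Q :: "'b::field poly poly" and h :: "'a \<Rightarrow> 'b"
  assumes irr: "irreducible (germ P)" and org: "at_origin (strict_step s P) = 0"
    and h: "rhom h" and Q: "Q = map_poly (map_poly h) P" and d: "d \<noteq> map_direction h s"
  shows "at_origin (strict_step d Q) \<noteq> 0"
proof -
  have P: "P \<noteq> 0" using irr by (auto simp: rhom_0[OF rhom_germ])
  have inj: "h x = 0 \<Longrightarrow> x = 0" for x
    using rhom_mult[OF h, of x "inverse x"] by (cases "x = 0") (auto simp: rhom_1[OF h])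
  have cfQ: "cf Q i j = h (cf P i j)" for i j
    by (simp add: Q coeff_map_poly rhom_0[OF h])
  have cfQ0: "cf Q i j \<noteq> 0 \<longleftrightarrow> cf P i j \<noteq> 0" for i j
    using inj by (auto simp: cfQ rhom_0[OF h])
  then have mQ: "mult_origin Q = mult_origin P" by (simp add: mult_origin_def)
  have tQ: "tcone Q = map_poly h (tcone P)"
    by (rule poly_eqI) (simp add: coeff_tcone mQ cfQ coeff_map_poly rhom_0[OF h])
  have Q0: "Q \<noteq> 0" using mult_origin_witness[OF P] cfQ0 by (metis coeff_0)
  show ?thesis
  proof (cases s)
    case (Fin c)
    with irreducible_strict_step_Fin(2)[OF irr] org obtain a where
      a: "a \<noteq> 0" "tcone P = smult a ([:- c, 1:] ^ mult_origin P)" by auto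
    then have t: "tcone Q = smult (h a) ([:- h c, 1:] ^ mult_origin P)"
    proof -
      have "map_poly h (smult a p) = smult (h a) (map_poly h p)" for p
        by (rule poly_eqI) (simp add: coeff_map_poly rhom_simps[OF h])
      moreover have "map_poly h [:- c, 1:] = [:- h c, 1:]" by (simp add: map_poly_pCons rhom_simps[OF h])
      ultimately show ?thesis using a(2) tQ by (simp add: rhom_power[OF rhom_map_poly[OF h]])
    qed
    show ?thesis
    proof (cases d)
      case (Fin c')
      then have "c' \<noteq> h c" using d \<open>s = Fin c\<close> by auto
      then show ?thesis using Fin a(1) inj by (auto simp: at_origin_strict_step_Fin[OF Q0] t)
    next
      case Inf
      then show ?thesis using a(1) inj
        by (auto simp: at_origin_strict_step_Inf[OF Q0] t mQ lead_coeff_linear_power)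
    qed
  next
    case Inf
    with irreducible_strict_step_Inf(2)[OF irr] org obtain a where
      a: "a \<noteq> 0" "tcone P = [:a:]" by auto
    then have t: "tcone Q = [:h a:]" by (simp add: tQ map_poly_pCons rhom_0[OF h])
    obtain c' where "d = Fin c'" using d Inf by (cases d) auto
    then show ?thesis using a(1) inj by (auto simp: at_origin_strict_step_Fin[OF Q0] t)
  qed
qed

lemma direction_unique:
  fixes P :: "'a::field poly poly"
  assumes "irreducible (germ P)" "at_origin (strict_step s P) = 0" "at_origin (strict_step d P) = 0"
  shows "d = s"
proof -
  have "map_poly (\<lambda>x. x) = (\<lambda>p. p :: 'a poly)" by (rule ext) simp
  then have "map_poly (map_poly (\<lambda>x. x)) P = P" by simp
  moreover have "map_direction (\<lambda>x. x) s = s" by (cases s) auto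
  ultimately show ?thesis using other_direction_nonzero[OF assms(1,2) rhom_id, of P d] assms(3) by auto
qed

section \<open>Transforms along sequences of points\<close>

lemma total_transform_snoc [simp]: "total_transform (ss @ [s]) P = total_step s (total_transform ss P)"
  and total_transform_append: "total_transform (ss @ ts) P = total_transform ts (total_transform ss P)"
  and total_transform_Nil [simp]: "total_transform [] P = P"
  by (simp_all add: total_transform_def)

lemma strict_transform_snoc [simp]: "strict_transform (ss @ [s]) P = strict_step s (strict_transform ss P)"
  and strict_transform_append: "strict_transform (ss @ ts) P = strict_transform ts (strict_transform ss P)"
  and strict_transform_Nil [simp]: "strict_transform [] P = P"
  by (simp_all add: strict_transform_def)

lemma rhom_total_transform: "rhom (total_transform ss)"
proof (induction ss rule: rev_induct)
  case Nil
  have "total_transform [] = (\<lambda>P. P :: 'a poly poly)" by (rule ext) simp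
  then show ?case by (metis rhom_id)
next
  case (snoc s ss)
  have "total_transform (ss @ [s]) = (\<lambda>P. total_step s (total_transform ss P))" by (rule ext) simp
  then show ?case using rhom_comp[OF rhom_total_step snoc] by metis
qed

lemma total_transform_eq_0_iff [simp]: "total_transform ss P = 0 \<longleftrightarrow> P = (0 :: 'a::field poly poly)"
  by (induction ss rule: rev_induct) simp_all

lemma at_origin_total_transform [simp]: "at_origin (total_transform ss P) = at_origin P"
  by (induction ss rule: rev_induct) simp_all

lemma total_transform_cst [simp]: "total_transform ss (cst a) = cst a"
  by (induction ss rule: rev_induct) (simp_all add: total_step_vars)

lemma strict_transform_neq_0: "P \<noteq> 0 \<Longrightarrow> strict_transform ss P \<noteq> 0"
  by (induction ss rule: rev_induct) (simp_all add: strict_step_neq_0)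

lemma strict_step_unit:
  fixes P :: "'a::field poly poly"
  assumes "at_origin P \<noteq> 0" shows "at_origin (strict_step s P) \<noteq> 0"
proof -
  have "P \<noteq> 0" using assms by (auto simp: rhom_0[OF rhom_at_origin])
  note f = total_step_factor[OF this, of s]
  have m: "mult_origin P = 0" using mult_origin_eq_0_iff[OF \<open>P \<noteq> 0\<close>] assms by blast
  have "total_step s P = strict_step s P" using f by (simp only: m power_0 mult_1)
  then show ?thesis using assms at_origin_total_step[of s P] by simp
qed

lemma strict_transform_unit:
  fixes P :: "'a::field poly poly"
  shows "at_origin P \<noteq> 0 \<Longrightarrow> at_origin (strict_transform ss P) \<noteq> 0"
  by (induction ss rule: rev_induct) (simp_all add: strict_step_unit)

lemma passes_through_prefix:
  fixes P :: "'a::field poly poly"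
  assumes "at_origin (strict_transform (ss @ ts) P) = 0"
  shows "at_origin (strict_transform ss P) = 0"
  using assms strict_transform_unit[of "strict_transform ss P" ts] by (auto simp: strict_transform_append)

lemma irreducible_strict_transform:
  fixes P :: "'a::field poly poly"
  assumes "irreducible (germ P)" "at_origin (strict_transform ss P) = 0"
  shows "irreducible (germ (strict_transform ss P))"
  using assms(2)
proof (induction ss rule: rev_induct)
  case (snoc s ss)
  from passes_through_prefix[OF snoc.prems] snoc show ?case by (simp add: irreducible_strict_step)
qed (use assms in simp)

text \<open>The direction is unique at each stage. This later identifies the centers of the
  valuation with the infinitely near points of the curve.\<close>

lemma same_points:
  fixes P :: "'a::field poly poly"
  assumes "irreducible (germ P)" "at_origin (strict_transform ss P) = 0" "at_origin (strict_transform ts P) = 0"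
    "length ss = length ts"
  shows "ss = ts"
  using assms(2-4)
proof (induction ss arbitrary: ts rule: rev_induct)
  case (snoc s ss)
  from snoc.prems(3) obtain t ts' where ts: "ts = ts' @ [t]" by (cases ts rule: rev_cases) auto
  have p: "at_origin (strict_transform ss P) = 0" "at_origin (strict_transform ts' P) = 0"
    using passes_through_prefix[OF snoc.prems(1)] passes_through_prefix[OF snoc.prems(2)[unfolded ts]] .
  have eq: "ss = ts'" by (rule snoc.IH[OF p]) (use snoc.prems(3) ts in simp)
  have "s = t"
    by (rule direction_unique[OF irreducible_strict_transform[OF assms(1) p(1)]])
       (use snoc.prems(1,2) in \<open>simp_all add: ts eq\<close>)
  then show ?case using ts eq by simp
qed simp

text \<open>Exponents of the two coordinate axes in a total transform, when a point of multiplicity \<open>e\<close> is blown up.\<close>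

fun expo_step :: "'a::zero direction \<Rightarrow> nat \<Rightarrow> nat \<times> nat \<Rightarrow> nat \<times> nat" where
  "expo_step (Fin c) e (a, b) = (if c = 0 then a else 0, a + b + e)"
| "expo_step Inf e (a, b) = (a + b + e, b)"

definition monomial_form :: "'a::field poly poly \<Rightarrow> nat \<times> nat \<Rightarrow> 'a poly poly \<Rightarrow> bool" where
  "monomial_form T ab S \<longleftrightarrow> (\<exists>U. at_origin U \<noteq> 0 \<and> T = U * uvar ^ fst ab * vvar ^ snd ab * S)"

lemma monomial_form_step:
  fixes S :: "'a::field poly poly"
  assumes "monomial_form T ab S" "S \<noteq> 0"
  shows "monomial_form (total_step s T) (expo_step s (mult_origin S) ab) (strict_step s S)"
proof -
  obtain a b where ab: "ab = (a, b)" by (cases ab)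
  obtain U where U: "at_origin U \<noteq> 0" "T = U * uvar ^ a * vvar ^ b * S"
    using assms(1) by (auto simp: monomial_form_def ab)
  have U': "at_origin (total_step s U) \<noteq> 0" using U by simp
  have T: "total_step s T = total_step s U * total_step s uvar ^ a * total_step s vvar ^ b *
      (exceptional s ^ mult_origin S * strict_step s S)"
    unfolding U(2) by (simp only: rhom_mult[OF rhom_total_step] rhom_power[OF rhom_total_step]
        total_step_factor[OF assms(2), of s])
  show ?thesis
  proof (cases s)
    case (Fin c)
    show ?thesis
    proof (cases "c = 0")
      case True
      have "total_step s T = total_step s U * uvar ^ a * vvar ^ (a + b + mult_origin S) * strict_step s S"
        unfolding T by (simp add: Fin True total_step_vars power_mult_distrib power_add mult_ac)
      then show ?thesis using U' unfolding monomial_form_def ab Fin True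
        by (intro exI[of _ "total_step (Fin 0) U"]) simp
    next
      case False
      \<comment> \<open>The old axis \<open>u = 0\<close> misses the new point, so the powers of
        \<open>u + c\<close> join the unit and the first exponent restarts at 0.\<close>
      have "total_step s T = (total_step s U * (uvar + cst c) ^ a) * uvar ^ 0 * vvar ^ (a + b + mult_origin S) * strict_step s S"
        unfolding T by (simp add: Fin total_step_vars power_mult_distrib power_add mult_ac)
      moreover have "at_origin (total_step s U * (uvar + cst c) ^ a) \<noteq> 0"
        using U' False by (simp add: rhom_simps[OF rhom_at_origin])
      ultimately show ?thesis using False unfolding monomial_form_def ab Fin
        by (intro exI[of _ "total_step (Fin c) U * (uvar + cst c) ^ a"]) simp
    qed
  next
    case Inf
    have "total_step s T = total_step s U * uvar ^ (a + b + mult_origin S) * vvar ^ b * strict_step s S"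
      unfolding T by (simp add: Inf total_step_vars power_mult_distrib power_add mult_ac)
    then show ?thesis using U' unfolding monomial_form_def ab Inf
      by (intro exI[of _ "total_step Inf U"]) simp
  qed
qed

lemma mult_origin_1 [simp]: "mult_origin (1 :: 'a::field poly poly) = 0"
  by (simp add: mult_origin_eq_0_iff rhom_1[OF rhom_at_origin])

lemma strict_step_1 [simp]: "strict_step s (1 :: 'a::field poly poly) = 1"
  using total_step_factor[of "1 :: 'a poly poly" s] by (simp add: rhom_1[OF rhom_total_step])

lemma monomial_form_step_1:
  fixes T :: "'a::field poly poly"
  assumes "monomial_form T ab 1"
  shows "monomial_form (total_step s T) (expo_step s 0 ab) 1"
  using monomial_form_step[OF assms, of s] by simp

lemma monomial_form_unit:
  assumes "monomial_form T ab S" "at_origin S \<noteq> 0" shows "monomial_form T ab 1"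
proof -
  obtain U where "at_origin U \<noteq> 0" "T = U * uvar ^ fst ab * vvar ^ snd ab * S"
    using assms(1) by (auto simp: monomial_form_def)
  then have "at_origin (U * S) \<noteq> 0 \<and> T = (U * S) * uvar ^ fst ab * vvar ^ snd ab * 1"
    using assms(2) by (simp add: rhom_mult[OF rhom_at_origin] mult_ac)
  then show ?thesis unfolding monomial_form_def by blast
qed

lemma mult_origin_monomial_form:
  fixes S :: "'a::field poly poly"
  assumes "monomial_form T ab S" "S \<noteq> 0"
  shows "mult_origin T = fst ab + snd ab + mult_origin S"
proof -
  obtain U where U: "at_origin U \<noteq> 0" "T = U * uvar ^ fst ab * vvar ^ snd ab * S"
    using assms(1) by (auto simp: monomial_form_def)
  then have "U \<noteq> 0" by (auto simp: rhom_0[OF rhom_at_origin])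
  then show ?thesis using U assms(2)
    by (simp add: mult_origin_mult mult_origin_power inner_var_neq_0 outer_var_neq_0 mult_origin_eq_0_iff)
qed

section \<open>Infinite sequences of centers and exponents of total transforms\<close>

definition points :: "(nat \<Rightarrow> 'a direction) \<Rightarrow> nat \<Rightarrow> 'a direction list" where
  "points c i = map c [0..<i]"

lemma points_0 [simp]: "points c 0 = []" and points_Suc [simp]: "points c (Suc i) = points c i @ [c i]"
  and length_points [simp]: "length (points c i) = i"
  by (simp_all add: points_def)

lemma points_add: "points c (i + k) = points c i @ points (\<lambda>j. c (i + j)) k"
  by (induction k) simp_all

lemma points_split: "i \<le> j \<Longrightarrow> \<exists>ts. points c j = points c i @ ts"
  using points_add[of c i "j - i"] by auto

text \<open>The direction \<open>Inf\<close> makes the new exceptional curve the axis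
  \<open>u = 0\<close>. It remains an axis while the following points lie on its strict transform,
  that is, for directions \<open>Fin 0\<close>; a further \<open>Inf\<close> replaces it by a newer
  exceptional curve.\<close>

primrec umark :: "(nat \<Rightarrow> 'a::zero direction) \<Rightarrow> nat \<Rightarrow> bool" where
  "umark c 0 \<longleftrightarrow> False"
| "umark c (Suc i) \<longleftrightarrow> c i = Inf \<or> (c i = Fin 0 \<and> umark c i)"

primrec expo :: "(nat \<Rightarrow> 'a::zero direction) \<Rightarrow> (nat \<Rightarrow> nat) \<Rightarrow> nat \<times> nat \<Rightarrow> nat \<Rightarrow> nat \<times> nat" where
  "expo c e ab 0 = ab"
| "expo c e ab (Suc i) = expo_step (c i) (e i) (expo c e ab i)"

lemma expo_unmarked: "fst ab = 0 \<Longrightarrow> \<not> umark c i \<Longrightarrow> fst (expo c e ab i) = 0"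
proof (induction i)
  case (Suc i)
  obtain a b where "expo c e ab i = (a, b)" by (cases "expo c e ab i")
  with Suc show ?case by (cases "c i") auto
qed simp

abbreviation strict_at :: "(nat \<Rightarrow> 'a::field direction) \<Rightarrow> 'a poly poly \<Rightarrow> nat \<Rightarrow> 'a poly poly" where
  "strict_at c P i \<equiv> strict_transform (points c i) P"
abbreviation total_at :: "(nat \<Rightarrow> 'a::field direction) \<Rightarrow> 'a poly poly \<Rightarrow> nat \<Rightarrow> 'a poly poly" where
  "total_at c P i \<equiv> total_transform (points c i) P"
abbreviation mult_at :: "(nat \<Rightarrow> 'a::field direction) \<Rightarrow> 'a poly poly \<Rightarrow> nat \<Rightarrow> nat" where
  "mult_at c P i \<equiv> mult_origin (strict_at c P i)"

lemma monomial_form_total: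
  fixes P :: "'a::field poly poly"
  assumes "P \<noteq> 0"
  shows "monomial_form (total_at c P i) (expo c (mult_at c P) (0, 0) i) (strict_at c P i)"
proof (induction i)
  case 0
  have "at_origin 1 \<noteq> (0::'a) \<and> P = 1 * uvar ^ 0 * vvar ^ 0 * P" by (simp add: rhom_1[OF rhom_at_origin])
  then show ?case unfolding monomial_form_def by (intro exI[of _ 1]) simp
qed (simp add: monomial_form_step strict_transform_neq_0 assms)

lemma monomial_form_vvar:
  "monomial_form (total_at c (vvar :: 'a::field poly poly) i) (expo c (\<lambda>_. 0) (0, 1) i) 1"
proof (induction i)
  case 0
  have "at_origin 1 \<noteq> (0::'a) \<and> vvar = 1 * uvar ^ 0 * vvar ^ 1 * (1 :: 'a poly poly)" by (simp add: rhom_1[OF rhom_at_origin])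
  then show ?case unfolding monomial_form_def by (intro exI[of _ 1]) simp
qed (simp add: monomial_form_step_1)


section \<open>Multiplicity sequences\<close>

text \<open>
  \<open>e\<close>: multiplicities of the strict transforms of a unibranch germ; \<open>xu\<close>, \<open>xv\<close>: their intersection
  numbers with the axes \<open>u = 0\<close> and \<open>v = 0\<close>. The axis \<open>v = 0\<close> is at every stage an exceptional curve or
  the line at infinity; \<open>umark\<close> tells whether the axis \<open>u = 0\<close> is exceptional.
\<close>

locale curve_path =
  fixes c :: "nat \<Rightarrow> 'a::zero direction" and n :: nat and e xu xv :: "nat \<Rightarrow> nat"
  assumes Inf_step: "i < n \<Longrightarrow> c i = Inf \<Longrightarrow> xu (Suc i) = e i \<and> xv i = e i + xv (Suc i) \<and> xu i = e i"
    and Fin_step: "i < n \<Longrightarrow> c i = Fin a \<Longrightarrow> xv i = e i \<and> xv (Suc i) = e i"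
    and Fin_0_step: "i < n \<Longrightarrow> c i = Fin 0 \<Longrightarrow> umark c i \<Longrightarrow> xu i = e i + xu (Suc i)"
    and Fin_other_step: "i < n \<Longrightarrow> c i = Fin a \<Longrightarrow> a \<noteq> 0 \<Longrightarrow> xu i = e i"
    and xv_pos: "i \<le> n \<Longrightarrow> 0 < xv i"
    and xu_pos: "i \<le> n \<Longrightarrow> umark c i \<Longrightarrow> 0 < xu i"
begin

lemma e_pos: assumes "i < n" shows "0 < e i"
proof (cases "c i")
  case (Fin a) then show ?thesis using Fin_step[OF assms Fin] xv_pos[of i] assms by simp
next
  case Inf then show ?thesis using Inf_step[OF assms Inf] xu_pos[of "Suc i"] assms by simp
qed

text \<open>\<open>a * xu i + b * xv i\<close> is the intersection number of the curve with the
  divisor of \<open>u^a v^b\<close>. Blowing up preserves the intersection with the pulled back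
  divisor, and the new exceptional curve, added \<open>k\<close> times, meets the strict transform
  in \<open>e i\<close>.\<close>

lemma pairing_step:
  assumes i: "i < n" and ab: "\<not> umark c i \<Longrightarrow> a = 0" and ab': "expo_step (c i) k (a, b) = (a', b')"
  shows "a' * xu (Suc i) + b' * xv (Suc i) = a * xu i + b * xv i + k * e i"
proof (cases "c i")
  case Inf
  then have *: "a' = a + b + k" "b' = b" using ab' by auto
  show ?thesis using Inf_step[OF i Inf] unfolding * by (simp add: algebra_simps)
next
  case (Fin z)
  have F: "xv i = e i" "xv (Suc i) = e i" using Fin_step[OF i Fin] by auto
  show ?thesis
  proof (cases "z = 0")
    case True
    then have *: "a' = a" "b' = a + b + k" using ab' Fin by auto
    show ?thesis
    proof (cases "umark c i")
      case True
      then show ?thesis using Fin_0_step[OF i _ True] Fin \<open>z = 0\<close> F unfolding * by (simp add: algebra_simps)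
    next
      case False
      then show ?thesis using ab F unfolding * by (simp add: algebra_simps)
    qed
  next
    case False
    then have *: "a' = 0" "b' = a + b + k" using ab' Fin by auto
    show ?thesis using F Fin_other_step[OF i Fin False] unfolding * by (simp add: algebra_simps)
  qed
qed

text \<open>Noether's formula. With \<open>k\<close> the multiplicities of a second germ, the sum is
  the part of the intersection number of the two germs accounted for so far.\<close>

lemma pairing:
  assumes "fst ab = 0" "i \<le> n"
  shows "fst (expo c k ab i) * xu i + snd (expo c k ab i) * xv i = snd ab * xv 0 + (\<Sum>j<i. k j * e j)"
  using assms(2)
proof (induction i)
  case (Suc i)
  obtain a b where ab: "expo c k ab i = (a, b)" by (cases "expo c k ab i")
  obtain a' b' where ab': "expo_step (c i) (k i) (a, b) = (a', b')" by (cases "expo_step (c i) (k i) (a, b)")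
  have "\<not> umark c i \<Longrightarrow> a = 0" using expo_unmarked[OF assms(1), of c i k] ab by simp
  from pairing_step[OF _ this ab'] show ?case using Suc ab ab' by simp
qed (use assms in simp)

section \<open>Sums of squares and Euclid's algorithm\<close>

definition sq :: "nat \<Rightarrow> nat" where "sq i = (\<Sum>j<i. e j * e j)"
text \<open>A rectangle with sides \<open>xu i\<close> and \<open>xv i\<close> is cut by Euclid's
  algorithm into the squares of the multiplicities in the rest of a marked chain; this area is
  counted in advance.\<close>

definition sq' :: "nat \<Rightarrow> nat" where "sq' i = sq i + (if umark c i then xu i * xv i else 0)"

lemma sq_0 [simp]: "sq 0 = 0" and sq_Suc: "sq (Suc i) = sq i + e i * e i"
  by (simp_all add: sq_def)

lemma sq'_marked: assumes i: "i < n" and m: "umark c i" shows "sq' (Suc i) = sq' i"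
proof (cases "c i")
  case Inf
  then show ?thesis using Inf_step[OF i Inf] m by (simp add: sq'_def sq_Suc algebra_simps)
next
  case (Fin z)
  have F: "xv i = e i" "xv (Suc i) = e i" using Fin_step[OF i Fin] by auto
  show ?thesis
  proof (cases "z = 0")
    case True
    then show ?thesis using Fin_0_step[OF i _ m] Fin F m by (simp add: sq'_def sq_Suc algebra_simps)
  next
    case False
    then show ?thesis using Fin_other_step[OF i Fin False] Fin F m by (simp add: sq'_def sq_Suc algebra_simps)
  qed
qed

lemma sq'_mono: "i \<le> j \<Longrightarrow> j \<le> n \<Longrightarrow> sq' i \<le> sq' j"
proof (induction j)
  case (Suc j)
  have "sq' j \<le> sq' (Suc j)"
    using sq'_marked[of j] Suc.prems by (cases "umark c j") (auto simp: sq'_def sq_Suc)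
  then show ?case using Suc by (cases "i = Suc j") auto
qed simp

abbreviation "Nu i \<equiv> fst (expo c e (0, 0) i)"
abbreviation "Nv i \<equiv> snd (expo c e (0, 0) i)"
abbreviation "Vu i \<equiv> fst (expo c (\<lambda>_. 0) (0, 1) i)"
abbreviation "Vv i \<equiv> snd (expo c (\<lambda>_. 0) (0, 1) i)"

lemma pairing_N: "i \<le> n \<Longrightarrow> Nu i * xu i + Nv i * xv i = sq i"
  using pairing[of "(0, 0)" i e] by (simp add: sq_def)

lemma pairing_V: "i \<le> n \<Longrightarrow> Vu i * xu i + Vv i * xv i = xv 0"
  using pairing[of "(0, 1)" i "\<lambda>_. 0"] by simp

text \<open>Bounds both signs of the determinant formed by the orders of the curve and of
  \<open>v\<close> along the two axes. Where a marked chain starts,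
  \<open>Nu i - Nv i = xu i\<close> and \<open>Vu i = Vv i\<close>, so the first bound is an
  equality; every step inside the chain preserves both.\<close>

lemma determinant_bounds:
  assumes "i \<le> n" "umark c i"
  shows "Nu i * Vv i \<le> Vu i * Nv i + Vu i * xu i \<and> Nv i * Vu i \<le> Vv i * Nu i + Vv i * xv i"
  using assms
proof (induction i)
  case (Suc i)
  then have i: "i < n" by simp
  obtain a b where N: "expo c e (0, 0) i = (a, b)" by (cases "expo c e (0, 0) i")
  obtain p q where V: "expo c (\<lambda>_. 0) (0, 1) i = (p, q)" by (cases "expo c (\<lambda>_. 0) (0, 1) i")
  note V' = V[unfolded One_nat_def]
  show ?case
  proof (cases "umark c i")
    case True
    then have IH: "a * q \<le> p * b + p * xu i" "b * p \<le> q * a + q * xv i"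
      using Suc.IH i N V by auto
    show ?thesis
    proof (cases "c i")
      case Inf
      with Inf_step[OF i Inf] IH show ?thesis by (simp add: N V' algebra_simps)
    next
      case (Fin z)
      then have z: "z = 0" using Suc.prems by auto
      with Fin_0_step[OF i _ True] Fin_step[OF i Fin] Fin IH show ?thesis by (simp add: N V' algebra_simps)
    qed
  next
    case False
    then have 0: "a = 0" "p = 0" using expo_unmarked[of "(0, 0)" c i e] expo_unmarked[of "(0, 1)" c i "\<lambda>_. 0"] N V by auto
    have "c i = Inf" using Suc.prems False by auto
    then show ?thesis using Inf_step[OF i] by (simp add: N V' 0 algebra_simps)
  qed
qed simp

lemma expo_bounds:
  assumes i: "i \<le> n" and t: "sq' i \<le> xv 0 * xv 0"
  shows "Nu i \<le> xv 0 * Vu i" "Nv i \<le> xv 0 * Vv i"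
proof -
  have d: "0 < xv 0" using xv_pos by simp
  have NX: "Nu i * xu i + Nv i * xv i = sq i" and VX: "Vu i * xu i + Vv i * xv i = xv 0"
    using pairing_N[OF i] pairing_V[OF i] .
  have "Nu i \<le> xv 0 * Vu i \<and> Nv i \<le> xv 0 * Vv i"
  proof (cases "umark c i")
    case False
    then have 0: "Nu i = 0" "Vu i = 0" using expo_unmarked[of "(0, 0)" c i e] expo_unmarked[of "(0, 1)" c i "\<lambda>_. 0"] by auto
    have "Nv i * xv i \<le> xv 0 * (Vv i * xv i)" using NX VX t 0 False by (simp add: sq'_def)
    then have "Nv i * xv i \<le> (xv 0 * Vv i) * xv i" by (simp add: mult.assoc)
    then have "Nv i \<le> xv 0 * Vv i" using xv_pos[OF i] by simp
    then show ?thesis using 0 by simp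
  next
    case True
    note D = determinant_bounds[OF i True]
    have t': "Nu i * xu i + Nv i * xv i + xu i * xv i \<le> xv 0 * xv 0" using t True NX by (simp add: sq'_def)
    \<comment> \<open>Multiplying by \<open>xv 0 = Vu i * xu i + Vv i * xv i\<close> lets the
      determinant bound turn the right side into a multiple of \<open>sq' i\<close>.\<close>
    have "Nu i * xv 0 = Nu i * Vu i * xu i + (Nu i * Vv i) * xv i" by (simp add: algebra_simps flip: VX)
    also have "\<dots> \<le> Nu i * Vu i * xu i + (Vu i * Nv i + Vu i * xu i) * xv i" using D by (intro add_left_mono mult_right_mono) auto
    also have "\<dots> = Vu i * (Nu i * xu i + Nv i * xv i + xu i * xv i)" by (simp add: algebra_simps)
    also have "\<dots> \<le> Vu i * (xv 0 * xv 0)" using t' by (rule mult_left_mono) simp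
    finally have 1: "Nu i * xv 0 \<le> (xv 0 * Vu i) * xv 0" by (simp add: mult_ac)
    have "Nv i * xv 0 = Nv i * Vv i * xv i + (Nv i * Vu i) * xu i" by (simp add: algebra_simps flip: VX)
    also have "\<dots> \<le> Nv i * Vv i * xv i + (Vv i * Nu i + Vv i * xv i) * xu i" using D by (intro add_left_mono mult_right_mono) auto
    also have "\<dots> = Vv i * (Nu i * xu i + Nv i * xv i + xu i * xv i)" by (simp add: algebra_simps)
    also have "\<dots> \<le> Vv i * (xv 0 * xv 0)" using t' by (rule mult_left_mono) simp
    finally have "Nv i * xv 0 \<le> (xv 0 * Vv i) * xv 0" by (simp add: mult_ac)
    with 1 d show ?thesis by simp
  qed
  then show "Nu i \<le> xv 0 * Vu i" "Nv i \<le> xv 0 * Vv i" by auto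
qed

section \<open>Behaviour at and after the last satellite point\<close>

lemma unmarked_step:
  assumes "i < n" "\<not> umark c (Suc i)" shows "xv i = e i" "xv (Suc i) = e i"
  using assms Fin_step[of i] by (cases "c i"; auto)+

text \<open>At a step to an unmarked point the multiplicity equals the intersection number with
  \<open>v = 0\<close> before and after it, so the value 1 at the end propagates backwards.\<close>

lemma smooth_tail:
  assumes "xv n = 1" "\<And>i. r < i \<Longrightarrow> i \<le> n \<Longrightarrow> \<not> umark c i" "r \<le> i" "i < n"
  shows "e i = 1"
  using assms(4,3)
proof (induction i rule: strict_inc_induct)
  case (base i)
  then show ?case using unmarked_step[of i] assms(1) assms(2)[of n] by auto
next
  case (step i)
  then show ?case using unmarked_step[of i] unmarked_step[of "Suc i"] assms(2)[of "Suc i"] assms(2)[of "Suc (Suc i)"] by auto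
qed

text \<open>After the last marked point the square sum grows by exactly one per step, so it attains
  every value in between.\<close>

lemma exists_square_sum:
  assumes "xv n = 1" "\<And>i. r < i \<Longrightarrow> i \<le> n \<Longrightarrow> \<not> umark c i" "r < n" "sq (Suc r) \<le> D" "D < sq n"
  obtains k where "r < k" "k < n" "sq k = D"
proof -
  have e1: "e i = 1" if "r \<le> i" "i < n" for i
    by (rule smooth_tail[of r]) (use assms that in auto)
  have *: "sq (Suc r + j) = sq (Suc r) + j" if "Suc r + j \<le> n" for j
    using that by (induction j) (simp_all add: sq_Suc e1)
  have "sq n = sq (Suc r) + (n - Suc r)" using *[of "n - Suc r"] \<open>r < n\<close> by simp
  then have "Suc r + (D - sq (Suc r)) < n" using assms(4,5) by linarith
  moreover have "sq (Suc r + (D - sq (Suc r))) = D" using *[of "D - sq (Suc r)"] calculation assms(4) by simp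
  ultimately show ?thesis using that[of "Suc r + (D - sq (Suc r))"] by simp
qed

text \<open>The chain cuts up the whole rectangle with sides \<open>e j\<close> and
  \<open>xv j\<close>, and no area remains once it has ended.\<close>

lemma chain_sum:
  assumes "j < r" "r < n" "\<not> umark c j" "\<And>i. j < i \<Longrightarrow> i \<le> r \<Longrightarrow> umark c i" "\<not> umark c (Suc r)"
  shows "sq (Suc r) = sq j + e j * xv j"
proof -
  have Inf: "c j = Inf" using assms(1,3) assms(4)[of "Suc j"] by auto
  have "j < n" using assms by simp
  have "sq' (Suc j) = sq j + e j * xv j"
    using Inf_step[OF \<open>j < n\<close> Inf] Inf by (simp add: sq'_def sq_Suc algebra_simps)
  moreover have "sq' (Suc j + k) = sq' (Suc j)" if "Suc j + k \<le> Suc r" for k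
    using that
  proof (induction k)
    case (Suc k)
    then show ?case using sq'_marked[of "Suc j + k"] assms(2) assms(4)[of "Suc j + k"] by simp
  qed simp
  from this[of "r - j"] have "sq' (Suc r) = sq' (Suc j)" using assms(1) by simp
  moreover have "sq' (Suc r) = sq (Suc r)" using assms(5) by (simp add: sq'_def del: umark.simps)
  ultimately show ?thesis by simp
qed

lemma smooth_persists:
  assumes "\<not> umark c i" "xv i = 1" "i \<le> k" "k \<le> n"
  shows "\<not> umark c k \<and> xv k = 1"
  using assms(3,4)
proof (induction k)
  case (Suc k)
  show ?case
  proof (cases "i = Suc k")
    case False
    then have k: "\<not> umark c k" "xv k = 1" "k < n" using Suc by auto
    then have "c k \<noteq> Inf" using Inf_step[of k] e_pos[of k] xv_pos[of "Suc k"] by auto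
    then obtain z where z: "c k = Fin z" by (cases "c k") auto
    then show ?thesis using Fin_step[OF k(3) z] k by auto
  qed (use assms in auto)
qed (use assms in auto)

text \<open>Euclid's algorithm preserves the gcd of the sides, so a coprime start ends with a curve
  that meets the last exceptional curve once. This settles the case \<open>g = 1\<close>.\<close>

lemma coprime_persists:
  assumes "c 0 = Inf" "coprime (e 0) (xv 0)" "0 < i" "i \<le> n"
  shows "if umark c i then coprime (xu i) (xv i) else xv i = 1"
  using assms(3,4)
proof (induction i)
  case (Suc i)
  then have i: "i < n" by simp
  show ?case
  proof (cases "i = 0")
    case True
    then show ?thesis using assms Inf_step[of 0] i by (simp add: coprime_iff_gcd_eq_1)
  next
    case False
    then have IH: "if umark c i then coprime (xu i) (xv i) else xv i = 1" using Suc by auto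
    show ?thesis
    proof (cases "umark c i")
      case False
      with IH smooth_persists[of i "Suc i"] i show ?thesis by auto
    next
      case True
      show ?thesis
      proof (cases "c i")
        case Inf
        then show ?thesis using Inf_step[OF i Inf] IH True by (simp add: coprime_iff_gcd_eq_1)
      next
        case (Fin z)
        show ?thesis
        proof (cases "z = 0")
          case z: True
          then show ?thesis using Fin_0_step[OF i _ True] Fin_step[OF i Fin] Fin IH True
            by (simp add: coprime_iff_gcd_eq_1 gcd.commute)
        next
          case z: False
          then show ?thesis using Fin_other_step[OF i Fin z] Fin_step[OF i Fin] Fin IH True by auto
        qed
      qed
    qed
  qed
qed simp

text \<open>The disjunction is the numerical form of normal crossings. While all directions are
  \<open>Inf\<close>, the axis \<open>v = 0\<close> is still the line at infinity and imposes no
  condition; afterwards it is exceptional and must be met once, with no second exceptional curve.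
  Persistence excludes satellite points after the resolution.\<close>

lemma resolved_persists:
  assumes r: "((\<forall>i<r. c i = Inf) \<and> e r = 1 \<and> (umark c r \<longrightarrow> xu r = 1)) \<or> (\<not> umark c r \<and> xv r = 1)"
    and "r \<le> k" "k \<le> n"
  shows "((\<forall>i<k. c i = Inf) \<and> (k < n \<longrightarrow> e k = 1) \<and> (umark c k \<longrightarrow> xu k = 1)) \<or> (\<not> umark c k \<and> xv k = 1)"
  using assms(2,3)
proof (induction k)
  case (Suc k)
  then have k: "k < n" by simp
  show ?case
  proof (cases "r = Suc k")
    case False
    then have "((\<forall>i<k. c i = Inf) \<and> e k = 1 \<and> (umark c k \<longrightarrow> xu k = 1)) \<or> (\<not> umark c k \<and> xv k = 1)"
      using Suc k by auto
    then show ?thesis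
    proof
      assume "\<not> umark c k \<and> xv k = 1"
      then show ?thesis using smooth_persists[of k "Suc k"] k by auto
    next
      assume A: "(\<forall>i<k. c i = Inf) \<and> e k = 1 \<and> (umark c k \<longrightarrow> xu k = 1)"
      show ?thesis
      proof (cases "c k")
        case Inf
        have "e (Suc k) = 1" if S: "Suc k < n"
        proof (cases "c (Suc k)")
          case Inf' : Inf
          then show ?thesis using Inf_step[OF k Inf] Inf_step[OF S Inf'] A by simp
        next
          case (Fin z)
          then show ?thesis
            using Inf_step[OF k Inf] Fin_0_step[OF S] Fin_other_step[OF S Fin] e_pos[OF S] xu_pos[of "Suc (Suc k)"] A S Inf
            by (cases "z = 0") auto
        qed
        then show ?thesis using A Inf Inf_step[OF k Inf] by (auto simp: less_Suc_eq)
      next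
        case (Fin z)
        then have "\<not> (z = 0 \<and> umark c k)"
          using Fin_0_step[OF k] e_pos[OF k] xu_pos[of "Suc k"] A k by auto
        then show ?thesis using Fin Fin_step[OF k Fin] A by auto
      qed
    qed
  qed (use r in auto)
qed (use r in auto)

end

lemma curve_path_of_germ:
  fixes P :: "'a::field poly poly"
  assumes irr: "irreducible (germ P)" and v: "restr_v P \<noteq> 0"
    and pass: "at_origin (strict_at c P n) = 0"
  shows "curve_path c n (mult_at c P) (\<lambda>i. ordu (strict_at c P i)) (\<lambda>i. ordv (strict_at c P i))"
proof -
  have o: "at_origin (strict_at c P i) = 0" if "i \<le> n" for i
    using points_split[OF that, of c] passes_through_prefix pass by metis
  have ir: "irreducible (germ (strict_at c P i))" if "i \<le> n" for i
    by (rule irreducible_strict_transform[OF irr o[OF that]])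
  have st: "at_origin (strict_step (c i) (strict_at c P i)) = 0" if "i < n" for i
    using o[of "Suc i"] that by simp
  have rv: "restr_v (strict_at c P i) \<noteq> 0 \<and> (umark c i \<longrightarrow> coeff (strict_at c P i) 0 \<noteq> 0)" if "i \<le> n" for i
    using that
  proof (induction i)
    case (Suc i)
    then have i: "i < n" "i \<le> n" by auto
    show ?case
    proof (cases "c i")
      case (Fin z)
      with orders_step_Fin[OF ir[OF i(2)], of z] st[OF i(1)] Suc i show ?thesis by auto
    next
      case Inf
      with orders_step_Inf[OF ir[OF i(2)]] st[OF i(1)] Suc i show ?thesis by auto
    qed
  qed (use v in auto)
  show ?thesis
  proof
    fix i assume i: "i < n" "c i = Inf"
    then show "ordu (strict_at c P (Suc i)) = mult_at c P i \<and>
        ordv (strict_at c P i) = mult_at c P i + ordv (strict_at c P (Suc i)) \<and>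
        ordu (strict_at c P i) = mult_at c P i"
      using orders_step_Inf[OF ir[of i]] st[of i] rv[of i] by simp
  next
    fix i a assume i: "i < n" "c i = Fin a"
    then show "ordv (strict_at c P i) = mult_at c P i \<and> ordv (strict_at c P (Suc i)) = mult_at c P i"
      using orders_step_Fin[OF ir[of i]] st[of i] by simp
  next
    fix i assume i: "i < n" "c i = Fin 0" "umark c i"
    then show "ordu (strict_at c P i) = mult_at c P i + ordu (strict_at c P (Suc i))"
      using orders_step_Fin[OF ir[of i]] st[of i] rv[of i] by simp
  next
    fix i a assume i: "i < n" "c i = Fin a" "a \<noteq> 0"
    then show "ordu (strict_at c P i) = mult_at c P i"
      using orders_step_Fin[OF ir[of i]] st[of i] by simp
  next
    fix i assume i: "i \<le> n"
    then show "0 < ordv (strict_at c P i)"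
      using rv[OF i] o[OF i] unfolding ordv_def
      by (intro order_0_pos) (auto simp: coeff_restr_v at_origin_def)
    assume "umark c i"
    then show "0 < ordu (strict_at c P i)"
      using rv[OF i] o[OF i] unfolding ordu_def
      by (intro order_0_pos) (auto simp: at_origin_def)
  qed
qed


section \<open>Valuations centered at infinitely near points\<close>

text \<open>The value \<infinity> may occur on nonzero polynomials: these are valuations of the ring
  of a curve germ, lifted to polynomials and positive on the maximal ideal of the current
  point.\<close>

locale centered_valuation =
  fixes W :: "'a::field poly poly \<Rightarrow> enat"
  assumes W_mult: "W (P * Q) = W P + W Q"
    and W_add: "min (W P) (W Q) \<le> W (P + Q)"
    and W_cst: "a \<noteq> 0 \<Longrightarrow> W (cst a) = 0"
    and W_0: "W 0 = \<infinity>"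
    and W_u: "0 < W uvar" and W_v: "0 < W vvar"
begin

lemma W_1: "W 1 = 0"
  using W_cst[of 1] by simp

lemma W_minus: "W (- P) = W P"
proof -
  have "- P = cst (-1) * P" by (simp add: rhom_minus[OF rhom_cst])
  moreover have "W (cst (-1)) = 0" by (rule W_cst) simp
  ultimately show ?thesis using W_mult[of "cst (-1)" P] by simp
qed

lemma W_power: "W P = enat k \<Longrightarrow> W (P ^ n) = enat (n * k)"
  by (induction n) (simp_all add: W_mult W_1 enat_0)

lemma W_add_strict: assumes "W P < W Q" shows "W (P + Q) = W P"
proof (rule antisym)
  have "min (W (P + Q)) (W (- Q)) \<le> W (P + Q + - Q)" by (rule W_add)
  then show "W (P + Q) \<le> W P" using assms by (simp add: W_minus min_def split: if_splits)
  show "W P \<le> W (P + Q)" using W_add[of P Q] assms by (simp add: min_def split: if_splits)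
qed

lemma W_order_ge:
  assumes "enat m \<le> W uvar" "enat m \<le> W vvar" "\<And>i j. i + j < k \<Longrightarrow> cf P i j = 0"
  shows "enat (k * m) \<le> W P"
  using assms(3)
proof (induction k arbitrary: P)
  case 0 then show ?case by (simp add: zero_enat_def[symmetric])
next
  case (Suc k)
  obtain p P' where P: "P = pCons p P'" by (cases P)
  obtain a p' where p: "p = pCons a p'" by (cases p)
  have "a = 0" using Suc.prems[of 0 0] by (simp add: P p)
  then have eq: "P = vvar * [:p':] + uvar * P'"
    by (simp add: P p inner_var_def outer_var_def)
  have "enat (k * m) \<le> W [:p':]"
  proof (rule Suc.IH)
    fix i j assume "i + j < k"
    then show "cf [:p':] i j = 0" using Suc.prems[of 0 "Suc j"] by (cases i) (auto simp: P p)
  qed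
  then have 1: "enat m + enat (k * m) \<le> W (vvar * [:p':])" unfolding W_mult by (rule add_mono[OF assms(2)])
  have "enat (k * m) \<le> W P'"
  proof (rule Suc.IH)
    fix i j assume "i + j < k"
    then show "cf P' i j = 0" using Suc.prems[of "Suc i" j] by (auto simp: P)
  qed
  then have "enat m + enat (k * m) \<le> W (uvar * P')" unfolding W_mult by (rule add_mono[OF assms(1)])
  with 1 have "enat m + enat (k * m) \<le> min (W (vvar * [:p':])) (W (uvar * P'))" by simp
  also have "\<dots> \<le> W P" unfolding eq by (rule W_add)
  finally show ?case by simp
qed

lemma W_unit: assumes "at_origin U \<noteq> 0" shows "W U = 0"
proof -
  let ?R = "U - cst (at_origin U)"
  have "cf ?R i j = 0" if "i + j < 1" for i j using that by (simp add: cf_cst at_origin_def)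
  moreover have "enat 1 \<le> W uvar" "enat 1 \<le> W vvar"
    using W_u W_v by (cases "W uvar"; cases "W vvar"; simp add: zero_enat_def)+
  ultimately have "enat (1 * 1) \<le> W ?R" by (intro W_order_ge) auto
  then have "0 < W ?R" by (metis enat_ord_simps(2) less_le_trans less_numeral_extra(1) mult_1 zero_enat_def)
  then have "W (cst (at_origin U) + ?R) = W (cst (at_origin U))"
    using W_cst[OF assms] by (intro W_add_strict) simp
  then show ?thesis using W_cst[OF assms] by simp
qed

end

lemma cf_linear_power:
  "cf ((uvar - cst c * vvar) ^ e) i j = (if i + j = e then coeff ([:- c, 1:] ^ e) i else (0 :: 'a::field))"
proof (induction e arbitrary: i j)
  case 0 show ?case using cf_cst[of "1::'a" i j] by (auto simp: coeff_1)
next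
  case (Suc e)
  have m: "cf (cst c * P) i j = c * cf P i j" for P i j by (simp add: cst_def)
  have "cf ((uvar - cst c * vvar) ^ Suc e) i j =
      (if i = 0 then 0 else cf ((uvar - cst c * vvar) ^ e) (i - 1) j) -
      c * (if j = 0 then 0 else cf ((uvar - cst c * vvar) ^ e) i (j - 1))"
    by (simp add: left_diff_distrib mult.assoc cf_outer_mult cf_inner_mult m)
  also have "\<dots> = (if i + j = Suc e then (if i = 0 then 0 else coeff ([:- c, 1:] ^ e) (i - 1)) -
      c * (if j = 0 then 0 else coeff ([:- c, 1:] ^ e) i) else 0)"
    by (cases i; cases j) (auto simp: Suc.IH)
  also have "\<dots> = (if i + j = Suc e then coeff ([:- c, 1:] ^ Suc e) i else 0)"
  proof -
    have "coeff ([:- c, 1:] ^ e) (Suc e) = 0" by (simp add: coeff_eq_0 degree_linear_power)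
    then show ?thesis by (cases i) auto
  qed
  finally show ?case .
qed

context centered_valuation
begin

text \<open>The initial form of a function of value \<open>\<infinity>\<close> has value larger than its degree forces.\<close>

lemma W_tangent:
  assumes F: "F \<noteq> 0" "W F = \<infinity>" and m: "enat m \<le> W uvar" "enat m \<le> W vvar" "0 < m"
    and H: "H = l ^ mult_origin F" "\<And>i j. i + j \<le> mult_origin F \<Longrightarrow> cf (cst a * H) i j = cf F i j" and a: "a \<noteq> 0"
  shows "enat m < W l"
proof (rule ccontr)
  assume "\<not> enat m < W l"
  then obtain k where k: "W l = enat k" "k \<le> m" by (metis enat_ord_simps(1) enat_iless not_le_imp_less linear order.strict_iff_order)
  let ?e = "mult_origin F"
  have "enat (Suc ?e * m) \<le> W (cst a * H - F)"
    by (rule W_order_ge[OF m(1,2)]) (simp add: H(2))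
  then have "enat (Suc ?e * m) \<le> min (W (cst a * H - F)) (W F)" using F(2) by simp
  also have "\<dots> \<le> W (cst a * H)" using W_add[of "cst a * H - F" F] by simp
  also have "\<dots> = enat (?e * k)" using W_power[OF k(1)] by (simp add: W_mult W_cst[OF a] H(1))
  finally have "Suc ?e * m \<le> ?e * k" by simp
  moreover have "?e * k \<le> ?e * m" using k(2) by simp
  ultimately show False using m(3) by simp
qed

text \<open>The initial form of \<open>F\<close> is a constant times a power of \<open>l\<close>,
  where \<open>l\<close> is \<open>u - c v\<close> or \<open>v\<close>. By \<open>W_tangent\<close>
  the value of \<open>l\<close> exceeds the smaller of the values of \<open>u\<close> and
  \<open>v\<close>, so \<open>W\<close> is centered at the same point of the exceptional curve as
  \<open>F\<close>.\<close>

lemma W_direction: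
  assumes irr: "irreducible (germ F)" and org: "at_origin (strict_step s F) = 0" and inf: "W F = \<infinity>"
    and fin: "W uvar \<noteq> \<infinity> \<or> W vvar \<noteq> \<infinity>"
  shows "s = Fin c \<Longrightarrow> W vvar \<noteq> \<infinity> \<and> W vvar < W (uvar - cst c * vvar)"
    and "s = Inf \<Longrightarrow> W uvar < W vvar"
proof -
  have F: "F \<noteq> 0" using irr by (auto simp: rhom_0[OF rhom_germ])
  obtain m where em: "enat m = min (W uvar) (W vvar)"
    using fin by (cases "W uvar"; cases "W vvar") auto
  then have m: "enat m \<le> W uvar" "enat m \<le> W vvar" by simp_all
  have "0 < enat m" using W_u W_v by (simp add: em)
  then have mp: "0 < m" by (simp add: zero_enat_def)
  let ?e = "mult_origin F"
  have low: "i + j < ?e \<Longrightarrow> cf F i j = 0" for i j using mult_origin_le[of F i j] by auto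
  have mc: "cf (cst a * P) i j = a * cf P i j" for a i j and P :: "'a poly poly" by (simp add: cst_def)
  show "W vvar \<noteq> \<infinity> \<and> W vvar < W (uvar - cst c * vvar)" if s: "s = Fin c"
  proof -
    obtain a where a: "a \<noteq> 0" "tcone F = smult a ([:- c, 1:] ^ ?e)"
      using irreducible_strict_step_Fin(2)[OF irr, of c] org s by auto
    have "cf (cst a * (uvar - cst c * vvar) ^ ?e) i j = cf F i j" if "i + j \<le> ?e" for i j
    proof (cases "i + j = ?e")
      case True
      then have "i \<le> ?e" "?e - i = j" by auto
      then have "cf F i j = coeff (tcone F) i" by (simp add: coeff_tcone)
      then show ?thesis using True by (simp add: a mc cf_linear_power)
    next
      case False then show ?thesis using that low[of i j] by (simp add: mc cf_linear_power)
    qed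
    from W_tangent[OF F inf m mp refl this a(1)] have gt: "enat m < W (uvar - cst c * vvar)" .
    have "W vvar = enat m"
    proof (rule ccontr)
      assume "W vvar \<noteq> enat m"
      then have v: "enat m < W vvar" and u: "W uvar = enat m" using em by (auto simp: min_def split: if_splits)
      have "W vvar \<le> W (cst c * vvar)" by (simp add: W_mult)
      then have "enat m < min (W (uvar - cst c * vvar)) (W (cst c * vvar))" using gt v by auto
      also have "\<dots> \<le> W uvar" using W_add[of "uvar - cst c * vvar" "cst c * vvar"] by simp
      finally show False using u by simp
    qed
    then show ?thesis using gt by simp
  qed
  show "W uvar < W vvar" if s: "s = Inf"
  proof -
    obtain a where a: "a \<noteq> 0" "tcone F = [:a:]"
      using irreducible_strict_step_Inf(2)[OF irr] org s by auto
    have p: "cf (vvar ^ k) i j = (if i = 0 \<and> j = k then 1 else (0::'a))" for k i j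
      using coeff_coeff_inner_power_mult[of k "1 :: 'a poly poly" i j] cf_cst[of "1::'a" i "j - k"]
      by auto
    have "cf (cst a * vvar ^ ?e) i j = cf F i j" if "i + j \<le> ?e" for i j
    proof (cases "i + j = ?e")
      case True
      then have "i \<le> ?e" "?e - i = j" by auto
      then have "cf F i j = coeff (tcone F) i" by (simp add: coeff_tcone)
      then show ?thesis using True by (auto simp: a mc p coeff_pCons split: nat.split)
    next
      case False then show ?thesis using that low[of i j] by (simp add: mc p)
    qed
    from W_tangent[OF F inf m mp refl this a(1)] have gt: "enat m < W vvar" .
    then show ?thesis using em by (auto simp: min_def split: if_splits)
  qed
qed

end

lemma total_step_exceptional: "total_step s (exceptional s) = exceptional s"
  by (cases s) (simp_all add: total_step_vars)

text \<open>A polynomial in the new coordinates is an old function \<open>R\<close> divided by a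
  power \<open>E^N\<close> of the exceptional equation, which prescribes its value. The choice of
  \<open>R\<close> and \<open>N\<close> does not matter, since \<open>total_step\<close> is
  injective.\<close>

lemma centered_valuation_step:
  assumes "centered_valuation W" and irr: "irreducible (germ F)" and org: "at_origin (strict_step s F) = 0"
    and inf: "W F = \<infinity>" and fin: "W uvar \<noteq> \<infinity> \<or> W vvar \<noteq> \<infinity>"
  obtains W' where "centered_valuation W'" "\<And>P. W' (total_step s P) = W P" "W' (strict_step s F) = \<infinity>"
    "W' uvar \<noteq> \<infinity> \<or> W' vvar \<noteq> \<infinity>"
proof -
  interpret centered_valuation W by fact
  note dir = W_direction[OF irr org inf fin]
  have F: "F \<noteq> 0" using irr by (auto simp: rhom_0[OF rhom_germ])
  define E :: "'a poly poly" where "E = exceptional s"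
  have E0: "E \<noteq> 0" by (cases s) (simp_all add: E_def inner_var_neq_0 outer_var_neq_0)
  have "W E \<noteq> \<infinity>"
  proof (cases s)
    case (Fin c) then show ?thesis using dir(1)[OF Fin] by (simp add: E_def)
  next
    case Inf then show ?thesis using dir(2)[OF Inf] by (cases "W uvar") (simp_all add: E_def)
  qed
  then obtain k where k: "W E = enat k" by auto
  have tE: "total_step s (E ^ N) = E ^ N" for N
    by (simp add: rhom_power[OF rhom_total_step] E_def total_step_exceptional)
  \<comment> \<open>The value of \<open>P\<close> is introduced as a relation, with
    \<open>W R\<close> written as a sum, to avoid subtraction in \<open>enat\<close>.\<close>
  define rep where "rep P w \<longleftrightarrow> (\<exists>N R. total_step s R = E ^ N * P \<and> W R = enat (N * k) + w)" for P w
  have repI: "rep P w" if "total_step s R = E ^ N * P" "W R = enat (N * k) + w" for P w N R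
    using that unfolding rep_def by blast
  have rep_total: "rep (total_step s P) (W P)" for P
    by (rule repI[of P 0]) (simp_all flip: zero_enat_def)
  have rep_unique: "w = w'" if "rep P w" "rep P w'" for P w w'
  proof -
    obtain N R where R: "total_step s R = E ^ N * P" "W R = enat (N * k) + w" using \<open>rep P w\<close> by (auto simp: rep_def)
    obtain N' R' where R': "total_step s R' = E ^ N' * P" "W R' = enat (N' * k) + w'" using \<open>rep P w'\<close> by (auto simp: rep_def)
    have "total_step s (E ^ N' * R - E ^ N * R') = 0"
      by (simp add: rhom_simps[OF rhom_total_step] tE[unfolded rhom_power[OF rhom_total_step]] R R' mult_ac)
    then have "W (E ^ N' * R) = W (E ^ N * R')" by simp
    then have "enat (N' * k) + (enat (N * k) + w) = enat (N * k) + (enat (N' * k) + w')"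
      by (simp add: W_mult W_power[OF k] R R')
    then have "enat (N' * k + N * k) + w = enat (N' * k + N * k) + w'"
      by (simp add: add_ac flip: plus_enat_simps(1))
    then show ?thesis by simp
  qed
  have rep_mult: "rep (P * Q) (w + w')" if "rep P w" "rep Q w'" for P Q w w'
  proof -
    obtain N R where R: "total_step s R = E ^ N * P" "W R = enat (N * k) + w" using \<open>rep P w\<close> by (auto simp: rep_def)
    obtain N' R' where R': "total_step s R' = E ^ N' * Q" "W R' = enat (N' * k) + w'" using \<open>rep Q w'\<close> by (auto simp: rep_def)
    show ?thesis
    proof (rule repI)
      show "total_step s (R * R') = E ^ (N + N') * (P * Q)"
        by (simp add: rhom_mult[OF rhom_total_step] R R' power_add mult_ac)
      show "W (R * R') = enat ((N + N') * k) + (w + w')"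
        by (simp add: W_mult R R' distrib_right add_ac flip: plus_enat_simps(1))
    qed
  qed
  have rep_add: "\<exists>w''. rep (P + Q) w'' \<and> min w w' \<le> w''" if "rep P w" "rep Q w'" for P Q w w'
  proof -
    obtain N R where R: "total_step s R = E ^ N * P" "W R = enat (N * k) + w" using \<open>rep P w\<close> by (auto simp: rep_def)
    obtain N' R' where R': "total_step s R' = E ^ N' * Q" "W R' = enat (N' * k) + w'" using \<open>rep Q w'\<close> by (auto simp: rep_def)
    let ?S = "E ^ N' * R + E ^ N * R'"
    have "min (W (E ^ N' * R)) (W (E ^ N * R')) \<le> W ?S" by (rule W_add)
    moreover have "W (E ^ N' * R) = enat ((N + N') * k) + w" "W (E ^ N * R') = enat ((N + N') * k) + w'"
      by (simp_all add: W_mult W_power[OF k] R R' distrib_right add_ac flip: plus_enat_simps(1))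
    ultimately have *: "enat ((N + N') * k) + min w w' \<le> W ?S" by (simp add: min_def split: if_splits)
    then have "enat ((N + N') * k) \<le> W ?S" by (metis le_iff_add order_trans)
    then obtain w'' where w'': "W ?S = enat ((N + N') * k) + w''" by (metis le_iff_add)
    have "total_step s ?S = E ^ (N + N') * (P + Q)"
      by (simp add: rhom_simps[OF rhom_total_step] tE[unfolded rhom_power[OF rhom_total_step]] R R' power_add algebra_simps)
    from repI[OF this w''] have "rep (P + Q) w''" .
    moreover have "min w w' \<le> w''" using * by (simp add: w'')
    ultimately show ?thesis by blast
  qed
  have rep_vars: "(\<exists>w. rep uvar w \<and> 0 < w) \<and> (\<exists>w. rep vvar w \<and> 0 < w)"
  proof (cases s)
    case (Fin c)
    then have E: "E = vvar" by (simp add: E_def)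
    have lt: "enat k < W (uvar - cst c * vvar)" using dir(1)[OF Fin] k E by simp
    then obtain w where w: "W (uvar - cst c * vvar) = enat k + w" by (metis le_iff_add less_imp_le)
    have "rep uvar w"
    proof (rule repI)
      show "total_step s (uvar - cst c * vvar) = E ^ 1 * uvar"
        by (simp add: rhom_simps[OF rhom_total_step] total_step_vars Fin E algebra_simps)
      show "W (uvar - cst c * vvar) = enat (1 * k) + w" by (simp add: w)
    qed
    moreover have "0 < w" using lt w by (cases "w = 0") auto
    moreover have "rep vvar (W vvar)" using rep_total[of vvar] by (simp add: Fin total_step_vars)
    ultimately show ?thesis using W_v by blast
  next
    case Inf
    then have E: "E = uvar" by (simp add: E_def)
    have lt: "enat k < W vvar" using dir(2)[OF Inf] k E by simp
    then obtain w where w: "W vvar = enat k + w" by (metis le_iff_add less_imp_le)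
    have "rep vvar w"
      by (rule repI[of vvar 1]) (simp_all add: total_step_vars Inf E w)
    moreover have "0 < w" using lt w by (cases "w = 0") auto
    moreover have "rep uvar (W uvar)" using rep_total[of uvar] by (simp add: Inf total_step_vars)
    ultimately show ?thesis using W_u by blast
  qed
  \<comment> \<open>Values exist for constants and, by the inequalities of
    \<open>W_direction\<close>, for the new coordinates; sums and products follow.\<close>
  have ex: "\<exists>w. rep P w" for P
  proof (induction P rule: poly_poly_induct)
    case (cst a) then show ?case using rep_total[of "cst a"] by (auto simp: total_step_vars)
  qed (use rep_vars rep_mult rep_add in blast)+
  define W' where "W' P = (THE w. rep P w)" for P
  have W'I: "W' P = w" if "rep P w" for P w
    unfolding W'_def using that rep_unique by blast
  have rW': "rep P (W' P)" for P using ex[of P] W'I by blast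
  show ?thesis
  proof
    show "centered_valuation W'"
    proof
      show "W' (P * Q) = W' P + W' Q" for P Q by (rule W'I[OF rep_mult[OF rW' rW']])
      show "min (W' P) (W' Q) \<le> W' (P + Q)" for P Q using rep_add[OF rW' rW', of P Q] W'I by blast
      show "W' (cst a) = 0" if "a \<noteq> 0" for a
        by (rule W'I) (use rep_total[of "cst a"] that in \<open>simp add: total_step_vars W_cst\<close>)
      show "W' 0 = \<infinity>" by (rule W'I) (use rep_total[of 0] in \<open>simp add: W_0 rhom_0[OF rhom_total_step]\<close>)
      show "0 < W' uvar" "0 < W' vvar" using rep_vars W'I by auto
    qed
    show "W' (total_step s P) = W P" for P by (rule W'I[OF rep_total])
    show "W' (strict_step s F) = \<infinity>"
    proof (rule W'I, rule repI)
      show "total_step s F = E ^ mult_origin F * strict_step s F"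
        unfolding E_def by (rule total_step_factor[OF F])
    qed (simp add: inf)
    have "W' E = enat k" by (rule W'I) (use rep_total[of E] k in \<open>simp add: E_def total_step_exceptional\<close>)
    then show "W' uvar \<noteq> \<infinity> \<or> W' vvar \<noteq> \<infinity>" by (cases s) (auto simp: E_def)
  qed
qed

lemma (in centered_valuation) W_monomial_form:
  assumes "monomial_form T (a, b) 1" shows "W T = of_nat a * W uvar + of_nat b * W vvar"
proof -
  obtain U where U: "at_origin U \<noteq> 0" "T = U * uvar ^ a * vvar ^ b"
    using assms by (auto simp: monomial_form_def)
  have "W (P ^ n) = of_nat n * W P" for P n
    by (induction n) (simp_all add: W_1 W_mult distrib_right)
  then show ?thesis using W_unit[OF U(1)] by (simp add: U(2) W_mult)
qed

text \<open>Modulo \<open>v\<close> the equation of the germ is a power of \<open>u\<close> times a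
  unit. Since the germ has value \<infinity> and \<open>v\<close> a positive value, \<open>u\<close>
  must have positive value too.\<close>

lemma germ_valuation_centered:
  assumes w: "germ_valuation (germ F) w" and F: "at_origin F = 0" "restr_v F \<noteq> 0"
    and v: "0 < w (germ vvar)"
  shows "centered_valuation (\<lambda>P. w (germ P))" "w (germ F) = \<infinity>" "w (germ vvar) \<noteq> \<infinity>"
proof -
  have inf: "\<And>a. w a = \<infinity> \<longleftrightarrow> germ F dvd a" and mult: "\<And>a b. w (a * b) = w a + w b"
    and add: "\<And>a b. min (w a) (w b) \<le> w (a + b)"
    using w by (auto simp: germ_valuation_def)
  show "w (germ F) = \<infinity>" by (simp add: inf)
  have nu: "\<not> germ F dvd 1" using F by (simp add: germ_unit_iff)
  have unit: "w a = 0" if "a dvd 1" for a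
  proof -
    have "w 1 + w 1 = w 1" using mult[of 1 1] by simp
    moreover have "w 1 \<noteq> \<infinity>" using nu inf by blast
    ultimately have w1: "w 1 = 0" by (cases "w 1") (auto simp: zero_enat_def)
    from \<open>a dvd 1\<close> obtain b where "1 = a * b" by (elim dvdE)
    then have "w a + w b = 0" using mult[of a b] w1 by simp
    then show ?thesis by simp
  qed
  have minus: "w (- a) = w a" for a
    using mult[of "-1" a] unit[of "-1"] by simp
  show vf: "w (germ vvar) \<noteq> \<infinity>"
  proof
    assume "w (germ vvar) = \<infinity>"
    then obtain G where G: "germ vvar = germ F * G" using inf by (auto elim: dvdE)
    \<comment> \<open>If the germ divided \<open>v\<close>, the cofactor would vanish on
      \<open>v = 0\<close>. Both factors would then vanish at the origin, and the product could not
      have the linear term \<open>v\<close>.\<close>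
    have "restr_fps (germ F) * restr_fps G = 0"
      using arg_cong[OF G, of restr_fps] by (simp add: restr_fps_germ rhom_mult[OF rhom_restr_fps])
    then have "restr_fps G = 0" using F(2) by (simp add: restr_fps_germ)
    then have "G $ 0 $ 0 = 0" "G $ i $ 0 = 0" for i by (metis restr_fps_nth fps_zero_nth)+
    then have "(germ F * G) $ 0 $ 1 = 0"
      using F(1) by (simp add: fps2_mult_nth germ_nth at_origin_def)
    moreover have "germ (vvar :: 'a poly poly) $ 0 $ 1 = 1" by (simp add: germ_nth inner_var_def)
    ultimately show False using G by simp
  qed
  define n where "n = ordv F"
  have n: "coeff (restr_v F) n \<noteq> 0" "\<And>k. k < n \<Longrightarrow> coeff (restr_v F) k = 0"
  proof -
    have "order 0 (restr_v F) = n" by (simp add: n_def ordv_def)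
    then have o: "[:- 0, 1:] ^ n dvd restr_v F \<and> \<not> [:- 0, 1:] ^ Suc n dvd restr_v F"
      using order[OF F(2), of 0] by simp
    have m: "[:- 0, 1:] ^ k = monom (1::'a) k" for k by (simp add: monom_altdef)
    show 1: "coeff (restr_v F) k = 0" if "k < n" for k
      using o that unfolding m monom_1_dvd_iff' by blast
    show "coeff (restr_v F) n \<noteq> 0"
      using o 1 unfolding m monom_1_dvd_iff' by (metis less_antisym)
  qed
  have u: "0 < w (germ uvar)"
  proof (rule ccontr)
    assume "\<not> 0 < w (germ uvar)"
    then have u0: "w (germ uvar) = 0" by simp
    obtain H where H: "restr_v F = monom 1 n * H"
      using n(2) by (metis dvdE monom_1_dvd_iff')
    have H0: "coeff H 0 \<noteq> 0" using n(1) unfolding H by (simp add: coeff_monom_mult)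
    define R :: "'a poly poly" where "R = map_poly (\<lambda>a. [:a:]) H"
    have rR: "restr_v R = H" by (rule poly_eqI) (simp add: R_def coeff_restr_v coeff_map_poly)
    have "restr_v (F - uvar ^ n * R) = 0"
      by (simp add: rhom_simps[OF rhom_restr_v] rR H monom_altdef)
    then obtain Q where Q: "F - uvar ^ n * R = vvar * Q" unfolding restr_v_eq_0_iff by (elim dvdE)
    have "w (germ (uvar ^ n)) = 0"
    proof -
      have "w (germ uvar ^ k) = 0" for k by (induction k) (simp_all add: unit mult u0)
      then show ?thesis by (simp add: rhom_power[OF rhom_germ])
    qed
    moreover have "w (germ R) = 0"
      by (rule unit) (simp add: germ_unit_iff at_origin_def R_def coeff_map_poly H0)
    ultimately have "w (germ (uvar ^ n * R)) = 0" by (simp add: rhom_mult[OF rhom_germ] mult)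
    moreover have "0 < min (w (germ F)) (w (- germ (vvar * Q)))"
      using v \<open>w (germ F) = \<infinity>\<close> by (simp add: minus rhom_mult[OF rhom_germ] mult)
    moreover have "germ (uvar ^ n * R) = germ F + - germ (vvar * Q)"
      using Q by (simp add: algebra_simps flip: rhom_diff[OF rhom_germ])
    ultimately show False using add[of "germ F" "- germ (vvar * Q)"] by (metis not_le)
  qed
  show "centered_valuation (\<lambda>P. w (germ P))"
  proof
    show "w (germ (P * Q)) = w (germ P) + w (germ Q)" for P Q by (simp add: rhom_mult[OF rhom_germ] mult)
    show "min (w (germ P)) (w (germ Q)) \<le> w (germ (P + Q))" for P Q by (simp add: rhom_add[OF rhom_germ] add)
    show "w (germ (cst a)) = 0" if "a \<noteq> 0" for a by (rule unit) (simp add: germ_unit_iff that)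
    show "w (germ 0) = \<infinity>" by (simp add: rhom_0[OF rhom_germ] inf)
  qed (use u v in auto)
qed

section \<open>Homogenization at the point at infinity\<close>

lemma finite_tdeg_set: "finite {a + b | a b. cf f b a \<noteq> 0}"
proof -
  have "{a + b | a b. cf f b a \<noteq> 0} \<subseteq> (\<Union>b\<le>degree f. (\<lambda>a. a + b) ` {..degree (coeff f b)})"
    by (force simp: le_degree intro: le_degree)
  then show ?thesis by (rule finite_subset) simp
qed

lemma tdeg_ge: "cf f b a \<noteq> 0 \<Longrightarrow> a + b \<le> tdeg f"
  unfolding tdeg_def by (rule Max_ge) (use finite_tdeg_set[of f] in auto)

lemma tdeg_witness: assumes "tdeg f \<noteq> 0" obtains a b where "cf f b a \<noteq> 0" "a + b = tdeg f"
proof -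
  have "tdeg f \<in> insert 0 {a + b | a b. cf f b a \<noteq> 0}"
    unfolding tdeg_def by (rule Max_in) (use finite_tdeg_set[of f] in auto)
  then show ?thesis using assms that by auto
qed

lemma tdegI: assumes "cf f b a \<noteq> 0" "\<And>a' b'. cf f b' a' \<noteq> 0 \<Longrightarrow> a' + b' \<le> a + b" shows "tdeg f = a + b"
proof (rule antisym)
  show "a + b \<le> tdeg f" by (rule tdeg_ge) fact
  show "tdeg f \<le> a + b" 
  proof (cases "tdeg f = 0")
    case False then show ?thesis using tdeg_witness[of f] assms(2) by metis
  qed simp
qed

lemma homog_eval_1:
  "homog_eval cst f 1 uvar vvar = (\<Sum>b\<le>degree f. \<Sum>a\<le>degree (coeff f b). cst (cf f b a) * (uvar ^ b * vvar ^ (tdeg f - a - b)))"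
  by (simp add: homog_eval_def mult.assoc)

lemma cf_monomial: "cf (cst z * (uvar ^ b * vvar ^ k)) i j = (if i = b \<and> j = k then z else (0::'a::comm_ring_1))"
proof -
  have "cf (uvar ^ b * P) i j = (if i < b then 0 else cf P (i - b) j)" for P :: "'a poly poly"
    by (induction b arbitrary: i) (auto simp: mult.assoc cf_outer_mult)
  moreover have "cf (vvar ^ k) i j = (if i = 0 \<and> j = k then 1 else (0::'a))" for i
    using coeff_coeff_inner_power_mult[of k "1 :: 'a poly poly" i j] cf_cst[of "1::'a" i "j - k"] by auto
  moreover have "cf (cst z * P) i j = z * cf P i j" for P by (simp add: cst_def)
  ultimately show ?thesis by auto
qed

lemma cf_bar:
  "cf (bar f) i j = (if i + j \<le> tdeg f then cf f i (tdeg f - i - j) else (0::'a::comm_ring_1))"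
proof -
  let ?t = "tdeg f"
  have "cf (bar f) i j = (\<Sum>b\<le>degree f. \<Sum>a\<le>degree (coeff f b). if i = b \<and> j = ?t - a - b then cf f b a else 0)"
    by (simp add: bar_def homog_eval_1 coeff_sum cf_monomial)
  also have "\<dots> = (\<Sum>b\<le>degree f. if i = b then (\<Sum>a\<le>degree (coeff f i). if j = ?t - a - i then cf f i a else 0) else 0)"
    by (intro sum.cong refl) (auto intro!: sum.neutral)
  also have "\<dots> = (if i \<le> degree f then \<Sum>a\<le>degree (coeff f i). if j = ?t - a - i then cf f i a else 0 else 0)"
    by (simp add: sum.delta')
  also have "\<dots> = (\<Sum>a\<le>degree (coeff f i). if j = ?t - a - i then cf f i a else 0)"
  proof (cases "i \<le> degree f")
    case False
    then have "coeff f i = 0" by (simp add: coeff_eq_0)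
    then show ?thesis using False by (simp cong: if_cong)
  qed simp
  also have "\<dots> = (\<Sum>a\<le>degree (coeff f i). if a = ?t - i - j \<and> i + j \<le> ?t then cf f i a else 0)"
    using tdeg_ge[of f i] by (intro sum.cong refl) (auto, force+)
  also have "\<dots> = (if i + j \<le> ?t \<and> ?t - i - j \<le> degree (coeff f i) then cf f i (?t - i - j) else 0)"
    by (cases "i + j \<le> ?t") (simp_all add: sum.delta')
  also have "\<dots> = (if i + j \<le> ?t then cf f i (?t - i - j) else 0)" by (auto simp: coeff_eq_0)
  finally show ?thesis .
qed

lemma bar_eq_0_iff [simp]: "bar f = 0 \<longleftrightarrow> f = 0"
proof
  assume 0: "bar f = 0"
  have "cf f b a = 0" for a b
  proof (rule ccontr)
    assume *: "cf f b a \<noteq> 0"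
    then have "a + b \<le> tdeg f" by (rule tdeg_ge)
    then have "cf (bar f) b (tdeg f - a - b) = cf f b a" by (simp add: cf_bar)
    then show False using * 0 by simp
  qed
  then show "f = 0" by (metis coeff_0 poly_eqI)
next
  assume "f = 0" then show "bar f = 0" by (simp add: bar_def homog_eval_def)
qed

lemma bar_xvar [simp]: "bar xvar = (1 :: 'a::comm_ring_1 poly poly)" and tdeg_xvar [simp]: "tdeg (xvar :: 'a poly poly) = 1"
  and bar_yvar [simp]: "bar yvar = (uvar :: 'a::comm_ring_1 poly poly)" and tdeg_yvar [simp]: "tdeg (yvar :: 'a poly poly) = 1"
proof -
  have x: "cf (xvar :: 'a poly poly) i j = (if i = 0 \<and> j = 1 then 1 else 0)" for i j
    using cf_monomial[of "1::'a" 0 1 i j] by simp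
  have y: "cf (yvar :: 'a poly poly) i j = (if i = 1 \<and> j = 0 then 1 else 0)" for i j
    using cf_monomial[of "1::'a" 1 0 i j] by simp
  show tx: "tdeg (xvar :: 'a poly poly) = 1" by (subst tdegI[of _ 0 1]) (auto simp: x split: if_splits)
  show ty: "tdeg (yvar :: 'a poly poly) = 1" by (subst tdegI[of _ 1 0]) (auto simp: y split: if_splits)
  show "bar xvar = (1 :: 'a poly poly)"
    by (intro poly_eqI) (use cf_cst[of "1::'a"] in \<open>auto simp: cf_bar tx x\<close>)
  show "bar yvar = (uvar :: 'a poly poly)"
    by (intro poly_eqI) (auto simp: cf_bar ty y)
qed

lemma bar_diff_cst:
  assumes "0 < tdeg f"
  shows "tdeg (f - cst l) = tdeg f" "bar (f - cst l) = bar f - cst l * vvar ^ tdeg f"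
proof -
  have c: "cf (f - cst l) b a = cf f b a - (if b = 0 \<and> a = 0 then l else 0)" for a b
    by (simp add: cf_cst)
  obtain a b where ab: "cf f b a \<noteq> 0" "a + b = tdeg f" using assms tdeg_witness by blast
  show t: "tdeg (f - cst l) = tdeg f"
    unfolding ab(2)[symmetric]
  proof (rule tdegI)
    show "cf (f - cst l) b a \<noteq> 0" using ab assms unfolding c by auto
    show "a' + b' \<le> a + b" if "cf (f - cst l) b' a' \<noteq> 0" for a' b'
      using that tdeg_ge[of f b' a'] ab(2) unfolding c by (auto split: if_splits)
  qed
  have m: "cf (cst l * vvar ^ tdeg f) i j = (if i = 0 \<and> j = tdeg f then l else 0)" for i j
    using cf_monomial[of l 0 "tdeg f" i j] by simp
  show "bar (f - cst l) = bar f - cst l * vvar ^ tdeg f"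
    by (intro poly_eqI) (auto simp: cf_bar t c m cf_cst)
qed

section \<open>Functions on the affine plane and divisorial valuations\<close>

lemma rhom_Fract: "rhom (\<lambda>a. Fract a (1 :: 'a::idom))"
  by (rule rhomI) (simp_all add: One_fract_def)

lemma rhom_affine_function: "rhom (affine_function :: 'a::field poly poly \<Rightarrow> _)"
  unfolding affine_function_def[abs_def]
  by (rule rhom_eval2) (rule rhom_comp[OF rhom_Fract rhom_cst])

lemma affine_function_bar: "affine_function f = Fract (bar f) (vvar ^ tdeg (f :: 'a::field poly poly))"
proof -
  define \<phi> where "\<phi> = (\<lambda>P :: 'a poly poly. Fract P 1)"
  have \<phi>: "rhom \<phi>" unfolding \<phi>_def by (rule rhom_Fract)
  have v0: "\<phi> vvar \<noteq> 0" by (simp add: \<phi>_def Zero_fract_def eq_fract inner_var_neq_0)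
  have x: "affine_function xvar = 1 / \<phi> vvar" and y: "affine_function yvar = \<phi> uvar / \<phi> vvar"
    and c: "affine_function (cst a) = \<phi> (cst a)" for a
    unfolding affine_function_def eval2_inner[OF rhom_comp[OF rhom_Fract rhom_cst]]
      eval2_outer[OF rhom_comp[OF rhom_Fract rhom_cst]] eval2_cst[OF rhom_comp[OF rhom_Fract rhom_cst]]
    by (simp_all add: \<phi>_def One_fract_def)
  have "f = (\<Sum>b\<le>degree f. \<Sum>a\<le>degree (coeff f b). cst (cf f b a) * (yvar ^ b * xvar ^ a))" (is "_ = ?S")
  proof (intro poly_eqI)
    fix i j
    have "cf ?S i j = (\<Sum>b\<le>degree f. \<Sum>a\<le>degree (coeff f b). if i = b \<and> j = a then cf f b a else 0)"
      by (simp add: coeff_sum cf_monomial)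
    also have "\<dots> = (\<Sum>b\<le>degree f. if i = b then (\<Sum>a\<le>degree (coeff f i). if j = a then cf f i a else 0) else 0)"
      by (intro sum.cong refl) (auto intro!: sum.neutral)
    also have "\<dots> = cf f i j" by (auto simp: sum.delta' coeff_eq_0)
    finally show "cf f i j = cf ?S i j" by simp
  qed
  then have "affine_function f * \<phi> vvar ^ tdeg f =
      affine_function ?S * \<phi> vvar ^ tdeg f" by simp
  also have "\<dots> = (\<Sum>b\<le>degree f. \<Sum>a\<le>degree (coeff f b).
      \<phi> (cst (cf f b a)) * ((\<phi> uvar / \<phi> vvar) ^ b * (1 / \<phi> vvar) ^ a) * \<phi> vvar ^ tdeg f)"
    unfolding rhom_sum[OF rhom_affine_function] rhom_mult[OF rhom_affine_function] rhom_power[OF rhom_affine_function] x y c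
    by (simp add: sum_distrib_right)
  also have "\<dots> = (\<Sum>b\<le>degree f. \<Sum>a\<le>degree (coeff f b).
      \<phi> (cst (cf f b a)) * (\<phi> uvar ^ b * \<phi> vvar ^ (tdeg f - a - b)))"
  proof (intro sum.cong refl)
    fix a b
    show "\<phi> (cst (cf f b a)) * ((\<phi> uvar / \<phi> vvar) ^ b * (1 / \<phi> vvar) ^ a) * \<phi> vvar ^ tdeg f =
        \<phi> (cst (cf f b a)) * (\<phi> uvar ^ b * \<phi> vvar ^ (tdeg f - a - b))"
    proof (cases "cf f b a = 0")
      case False
      then have "\<phi> vvar ^ tdeg f = \<phi> vvar ^ (tdeg f - a - b) * (\<phi> vvar ^ a * \<phi> vvar ^ b)"
        using tdeg_ge[of f b a] by (simp flip: power_add)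
      then show ?thesis using v0 by (simp add: field_simps)
    qed (simp add: rhom_0[OF \<phi>])
  qed
  also have "\<dots> = \<phi> (bar f)"
    by (simp add: bar_def homog_eval_1 rhom_sum[OF \<phi>] rhom_mult[OF \<phi>] rhom_power[OF \<phi>])
  finally have "affine_function f = \<phi> (bar f) / \<phi> (vvar ^ tdeg f)"
    using v0 by (simp add: rhom_power[OF \<phi>] field_simps)
  then show ?thesis by (simp add: \<phi>_def)
qed

text \<open>Multiplicativity of \<open>affine_function\<close> with denominators cleared. The powers
  of \<open>vvar\<close> are kept so that the degree of the product need not be computed; for the
  sum in \<open>bar_add\<close> the degree may really drop.\<close>

lemma bar_mult:
  fixes f g :: "'a::field poly poly"
  shows "bar (f * g) * vvar ^ (tdeg f + tdeg g) = bar f * bar g * vvar ^ tdeg (f * g)"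
  using rhom_mult[OF rhom_affine_function, of f g]
  by (simp add: affine_function_bar eq_fract inner_var_neq_0 power_add)

lemma bar_add:
  fixes f g :: "'a::field poly poly"
  shows "bar (f + g) * vvar ^ (tdeg f + tdeg g) = (bar f * vvar ^ tdeg g + bar g * vvar ^ tdeg f) * vvar ^ tdeg (f + g)"
  using rhom_add[OF rhom_affine_function, of f g]
  by (simp add: affine_function_bar eq_fract inner_var_neq_0 power_add)

lemma divisorial_valuation_Fract:
  fixes a b :: "'a::field poly poly"
  assumes "a \<noteq> 0" "b \<noteq> 0"
  shows "divisorial_valuation ss (Fract a b) =
    int (mult_origin (total_transform ss a)) - int (mult_origin (total_transform ss b))"
  unfolding divisorial_valuation_def
proof (rule the_equality)
  fix n
  assume "\<exists>a' b'. a' \<noteq> 0 \<and> b' \<noteq> 0 \<and> Fract a b = Fract a' b' \<and>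
    n = int (mult_origin (total_transform ss a')) - int (mult_origin (total_transform ss b'))"
  then obtain a' b' where n: "a' \<noteq> 0" "b' \<noteq> 0" "Fract a b = Fract a' b'"
    "n = int (mult_origin (total_transform ss a')) - int (mult_origin (total_transform ss b'))" by blast
  then have "total_transform ss (a * b') = total_transform ss (a' * b)"
    using assms by (simp add: eq_fract)
  then have "mult_origin (total_transform ss a) + mult_origin (total_transform ss b') =
      mult_origin (total_transform ss a') + mult_origin (total_transform ss b)"
    using assms n by (simp add: rhom_mult[OF rhom_total_transform] flip: mult_origin_mult)
  then show "n = int (mult_origin (total_transform ss a)) - int (mult_origin (total_transform ss b))"
    using n(4) by linarith
qed (use assms in blast)

lemma divisorial_valuation_affine:
  fixes h :: "'a::field poly poly"
  assumes "h \<noteq> 0"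
  shows "divisorial_valuation ss (affine_function h) =
    int (mult_origin (total_transform ss (bar h))) - int (tdeg h) * int (mult_origin (total_transform ss vvar))"
  using assms by (simp add: affine_function_bar divisorial_valuation_Fract inner_var_neq_0
      rhom_power[OF rhom_total_transform] mult_origin_power)

lemma divisorial_valuation_mult:
  fixes f h :: "'a::field poly poly"
  assumes "f \<noteq> 0" "h \<noteq> 0"
  shows "divisorial_valuation ss (affine_function (f * h)) =
    divisorial_valuation ss (affine_function f) + divisorial_valuation ss (affine_function h)"
proof -
  have "affine_function (f * h) = Fract (bar f * bar h) (vvar ^ (tdeg f + tdeg h))"
    by (simp add: rhom_mult[OF rhom_affine_function]) (simp add: affine_function_bar power_add)
  then have "divisorial_valuation ss (affine_function (f * h)) =
    int (mult_origin (total_transform ss (bar f * bar h))) - int (mult_origin (total_transform ss (vvar ^ (tdeg f + tdeg h))))"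
    using assms by (simp add: divisorial_valuation_Fract inner_var_neq_0)
  also have "\<dots> = divisorial_valuation ss (affine_function f) + divisorial_valuation ss (affine_function h)"
    using assms by (simp add: divisorial_valuation_affine rhom_simps[OF rhom_total_transform] mult_origin_mult
      mult_origin_power inner_var_neq_0 algebra_simps)
  finally show ?thesis .
qed

lemma only_root_0:
  fixes p :: "'a::alg_closed_field poly"
  assumes p: "p \<noteq> 0" "\<And>x. poly p x = 0 \<Longrightarrow> x = 0"
  shows "p = monom (lead_coeff p) (degree p)"
proof -
  obtain r where r: "p = [:- 0, 1:] ^ order 0 p * r" "\<not> [:- 0, 1:] dvd r"
    using order_decomp[OF p(1), of 0] by auto
  have "poly r 0 \<noteq> 0" using r(2) by (simp add: poly_eq_0_iff_dvd)
  have "degree r = 0"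
  proof (rule ccontr)
    assume "degree r \<noteq> 0"
    then obtain x where x: "poly r x = 0" using alg_closed_imp_poly_has_root by blast
    then have "poly p x = 0" by (subst r(1)) simp
    then have "x = 0" by (rule p(2))
    then show False using x \<open>poly r 0 \<noteq> 0\<close> by simp
  qed
  then obtain a where a: "r = [:a:]" by (metis degree_0_id)
  have "p = monom a (order 0 p)" by (subst r(1)) (simp add: a monom_altdef)
  then show ?thesis
    using p(1) by (metis degree_monom_eq lead_coeff_monom monom_eq_0_iff)
qed

text \<open>On the line at infinity the equation becomes a monic polynomial of degree
  \<open>tdeg f\<close> whose only root over the algebraic closure is 0.\<close>

lemma restr_v_bar_one_place:
  fixes f :: "'a::field poly poly"
  assumes op: "one_place_at_infinity f" and m: "lead_coeff f = 1" "degree f = tdeg f"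
  shows "restr_v (bar f) = monom 1 (tdeg f)"
proof -
  let ?d = "tdeg f"
  have cR: "coeff (restr_v (bar f)) i = (if i \<le> ?d then cf f i (?d - i) else 0)" for i
    by (simp add: coeff_restr_v cf_bar)
  define p where "p = map_poly to_ac (restr_v (bar f))"
  have cp: "coeff p i = (if i \<le> ?d then to_ac (cf f i (?d - i)) else 0)" for i
    by (simp add: p_def coeff_map_poly cR)
  have top: "coeff p ?d = 1" using m by (simp add: cp)
  then have p0: "p \<noteq> 0" by auto
  have dp: "degree p = ?d"
  proof (rule antisym)
    show "degree p \<le> ?d" by (rule degree_le) (simp add: cp)
    show "?d \<le> degree p" using top by (intro le_degree) simp
  qed
  have ev: "homog_eval to_ac f 1 \<eta> 0 = poly p \<eta>" for \<eta>
  proof -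
    have "homog_eval to_ac f 1 \<eta> 0 = (\<Sum>b\<le>degree f. \<Sum>a\<le>degree (coeff f b). if ?d - b = a then to_ac (cf f b a) * \<eta> ^ b else 0)"
      unfolding homog_eval_def
    proof (intro sum.cong refl)
      fix a b assume b: "b \<in> {..degree f}"
      show "to_ac (cf f b a) * 1 ^ a * \<eta> ^ b * 0 ^ (tdeg f - a - b) =
          (if tdeg f - b = a then to_ac (cf f b a) * \<eta> ^ b else 0)"
        using b m(2) tdeg_ge[of f b a] by (cases "cf f b a = 0") (auto simp: power_0_left)
    qed
    also have "\<dots> = (\<Sum>b\<le>degree f. coeff p b * \<eta> ^ b)"
      using m(2) by (intro sum.cong refl) (auto simp: sum.delta cp coeff_eq_0)
    also have "\<dots> = poly p \<eta>" unfolding poly_altdef dp m(2) by simp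
    finally show ?thesis .
  qed
  have "\<eta> = 0" if "poly p \<eta> = 0" for \<eta>
    using op that ev[of \<eta>] unfolding one_place_at_infinity_def by (metis prod.inject zero_neq_one)
  then have "p = monom 1 ?d" using only_root_0[OF p0] dp top by metis
  then have "to_ac (coeff (restr_v (bar f)) i) = to_ac (coeff (monom 1 ?d) i)" for i
    by (metis coeff_map_poly coeff_monom p_def to_ac_0 to_ac_1)
  then show ?thesis by (intro poly_eqI) (simp only: to_ac_eq_iff)
qed

section \<open>Satellite points and curvettes\<close>

lemma strict_step_exceptionals:
  "strict_step Inf (vvar :: 'a::field poly poly) = vvar" "strict_step (Fin z) (vvar :: 'a poly poly) = 1"
  "strict_step Inf (uvar :: 'a poly poly) = 1" "strict_step (Fin z) (uvar :: 'a poly poly) = uvar + cst z"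
proof -
  have v0: "vvar \<noteq> (0 :: 'a poly poly)" and u0: "uvar \<noteq> (0 :: 'a poly poly)"
    by (rule inner_var_neq_0, rule outer_var_neq_0)
  note f = total_step_factor[OF v0] total_step_factor[OF u0]
  show "strict_step Inf (vvar :: 'a poly poly) = vvar"
    using f(1)[of Inf] u0 by (simp add: total_step_vars)
  show "strict_step (Fin z) (vvar :: 'a poly poly) = 1"
    using f(1)[of "Fin z"] v0 by (simp add: total_step_vars)
  show "strict_step Inf (uvar :: 'a poly poly) = 1"
    using f(2)[of Inf] u0 by (simp add: total_step_vars)
  show "strict_step (Fin z) (uvar :: 'a poly poly) = uvar + cst z"
    using f(2)[of "Fin z"] v0 by (simp add: total_step_vars)
qed

lemma exceptional_at_snoc:
  "j < length ss \<Longrightarrow> exceptional_at (ss @ [s]) j = strict_step s (exceptional_at ss j)"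
  "exceptional_at (ss @ [s]) (length ss) = exceptional s"
  by (simp_all add: exceptional_at_def nth_append)

lemma exceptional_at_Suc:
  "j < N \<Longrightarrow> exceptional_at (points c (Suc N)) j = strict_step (c N) (exceptional_at (points c N) j)"
  "exceptional_at (points c (Suc N)) N = exceptional (c N)"
  using exceptional_at_snoc(1)[of j "points c N"] exceptional_at_snoc(2)[of "points c N"] by simp_all

lemma at_origin_outer_plus: "at_origin (uvar + cst z) = z"
  by (simp add: rhom_add[OF rhom_at_origin])

lemma uvar_neq_vvar: "uvar \<noteq> (vvar :: 'a::comm_ring_1 poly poly)" "vvar \<noteq> (uvar :: 'a poly poly)"
proof -
  show "uvar \<noteq> (vvar :: 'a poly poly)" by (simp add: outer_var_def inner_var_def)
  then show "vvar \<noteq> (uvar :: 'a poly poly)" by simp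
qed

lemma one_neq_vars: "1 \<noteq> (uvar :: 'a::comm_ring_1 poly poly)" "1 \<noteq> (vvar :: 'a::comm_ring_1 poly poly)"
  by (metis at_origin_simps(2) rhom_1 rhom_at_origin zero_neq_one)
     (metis at_origin_simps(3) rhom_1 rhom_at_origin zero_neq_one)

text \<open>Each new exceptional curve is an axis, and the charts turn an older axis into an axis or
  into a curve that misses the new origin. Until the first direction other than \<open>Inf\<close>
  the axis \<open>v = 0\<close> is the line at infinity, whence the condition on the
  directions.\<close>

lemma exceptional_curves:
  fixes c :: "nat \<Rightarrow> 'a::field direction"
  shows "(\<forall>j<N. at_origin (exceptional_at (points c N) j) = 0 \<longrightarrow>
      (exceptional_at (points c N) j = uvar \<and> umark c N) \<or> (exceptional_at (points c N) j = vvar \<and> (\<exists>i<N. c i \<noteq> Inf))) \<and>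
    (umark c N \<longrightarrow> (\<exists>!j. j < N \<and> exceptional_at (points c N) j = uvar)) \<and>
    ((\<exists>i<N. c i \<noteq> Inf) \<longrightarrow> (\<exists>!j. j < N \<and> exceptional_at (points c N) j = vvar))"
proof (induction N)
  case (Suc N)
  let ?X = "exceptional_at (points c N)" and ?Y = "exceptional_at (points c (Suc N))"
  have Y: "?Y j = strict_step (c N) (?X j)" if "j < N" for j using exceptional_at_Suc(1)[OF that] .
  have YN: "?Y N = exceptional (c N)" by (rule exceptional_at_Suc)
  have X0: "at_origin (?X j) = 0 \<Longrightarrow> j < N \<Longrightarrow> (?X j = uvar \<and> umark c N) \<or> (?X j = vvar \<and> (\<exists>i<N. c i \<noteq> Inf))" for j
    using Suc by blast
  have unit: "at_origin (?Y j) \<noteq> 0" if "j < N" "at_origin (?X j) \<noteq> 0" for j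
    unfolding Y[OF that(1)] by (rule strict_step_unit[OF that(2)])
  show ?case
  proof (cases "c N")
    case Inf
    have YX: "?Y j = (if ?X j = vvar then vvar else 1)" if "j < N" "at_origin (?Y j) = 0 \<or> ?Y j = vvar \<or> ?Y j = uvar" for j
    proof -
      have "at_origin (?Y j) = 0" using that(2) by auto
      then have "at_origin (?X j) = 0" using unit that(1) by blast
      from X0[OF this that(1)] show ?thesis
        using Y[OF that(1)] uvar_neq_vvar Inf by (auto simp: strict_step_exceptionals)
    qed
    have Yv: "?Y j = vvar \<longleftrightarrow> ?X j = vvar" if "j < N" for j
      using YX[OF that] Y[OF that] Inf one_neq_vars by (auto simp: strict_step_exceptionals split: if_splits)
    have Yu: "?Y j \<noteq> uvar" if "j < N" for j
      using YX[OF that] one_neq_vars uvar_neq_vvar by (metis)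
    have Y0: "?Y j = vvar \<and> (\<exists>i<N. c i \<noteq> Inf)" if "j < N" "at_origin (?Y j) = 0" for j
    proof -
      have "?Y j = vvar" using YX[OF that(1)] that(2) by (auto simp: rhom_1[OF rhom_at_origin] split: if_splits)
      then have "?X j = vvar" using Yv that(1) by blast
      then show ?thesis using X0[of j] that(1) uvar_neq_vvar[where 'a = 'a] \<open>?Y j = vvar\<close> by (metis at_origin_simps(3))
    qed
    have ex: "(\<exists>i<Suc N. c i \<noteq> Inf) \<longleftrightarrow> (\<exists>i<N. c i \<noteq> Inf)" using Inf by (auto simp: less_Suc_eq)
    have vv: "(j < Suc N \<and> ?Y j = vvar) \<longleftrightarrow> (j < N \<and> ?X j = vvar)" for j
      using Yv YN Inf uvar_neq_vvar by (auto simp: less_Suc_eq)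
    have uu: "(j < Suc N \<and> ?Y j = uvar) \<longleftrightarrow> j = N" for j
      using Yu YN Inf by (auto simp: less_Suc_eq)
    show ?thesis unfolding ex vv uu
      using Y0 YN Inf Suc.IH by (auto simp: less_Suc_eq)
  next
    case (Fin z)
    have YX: "z = 0 \<and> umark c N \<and> ?X j = uvar \<and> ?Y j = uvar" if "j < N" "at_origin (?Y j) = 0" for j
    proof -
      have "at_origin (?X j) = 0" using unit that by blast
      from X0[OF this that(1)] show ?thesis
        using Y[OF that(1)] Fin that(2) by (auto simp: strict_step_exceptionals at_origin_outer_plus rhom_1[OF rhom_at_origin])
    qed
    have Yv: "?Y j \<noteq> vvar" if "j < N" for j
      using YX[OF that] uvar_neq_vvar by fastforce
    have Yu: "?Y j = uvar \<longleftrightarrow> z = 0 \<and> umark c N \<and> ?X j = uvar" if "j < N" for j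
    proof
      assume "?Y j = uvar"
      then show "z = 0 \<and> umark c N \<and> ?X j = uvar" using YX[OF that] by simp
    next
      assume "z = 0 \<and> umark c N \<and> ?X j = uvar"
      then show "?Y j = uvar" using Y[OF that] Fin by (simp add: strict_step_exceptionals)
    qed
    have vv: "(j < Suc N \<and> ?Y j = vvar) \<longleftrightarrow> j = N" for j
      using Yv YN Fin by (auto simp: less_Suc_eq)
    have uu: "(j < Suc N \<and> ?Y j = uvar) \<longleftrightarrow> z = 0 \<and> umark c N \<and> j < N \<and> ?X j = uvar" for j
      using Yu YN Fin uvar_neq_vvar by (auto simp: less_Suc_eq)
    have ex: "(\<exists>i<Suc N. c i \<noteq> Inf) \<longleftrightarrow> True" using Fin by auto
    have m: "umark c (Suc N) \<longleftrightarrow> z = 0 \<and> umark c N" using Fin by auto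
    show ?thesis unfolding vv uu ex m
      using YX YN Fin Suc.IH by (auto simp: less_Suc_eq)
  qed
qed simp

lemma satellite_iff:
  fixes c :: "nat \<Rightarrow> 'a::field direction"
  shows "satellite (points c N) \<longleftrightarrow> umark c N \<and> (\<exists>i<N. c i \<noteq> Inf)"
proof
  let ?X = "exceptional_at (points c N)"
  note X = exceptional_curves[of N c]
  show "umark c N \<and> (\<exists>i<N. c i \<noteq> Inf)" if "satellite (points c N)"
  proof -
    from that obtain i j where ij: "i < j" "j < N" "at_origin (?X i) = 0" "at_origin (?X j) = 0"
      unfolding satellite_def by auto
    have i: "?X i = uvar \<and> umark c N \<or> ?X i = vvar \<and> (\<exists>i<N. c i \<noteq> Inf)"
      and j: "?X j = uvar \<and> umark c N \<or> ?X j = vvar \<and> (\<exists>i<N. c i \<noteq> Inf)" using X ij by auto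
    have "\<not> (?X i = uvar \<and> ?X j = uvar \<and> umark c N)" "\<not> (?X i = vvar \<and> ?X j = vvar \<and> (\<exists>i<N. c i \<noteq> Inf))"
      using X ij(1,2) by (metis less_irrefl less_trans)+
    then show ?thesis using i j by blast
  qed
  show "satellite (points c N)" if "umark c N \<and> (\<exists>i<N. c i \<noteq> Inf)"
  proof -
    have "\<exists>i<N. ?X i = uvar" "\<exists>j<N. ?X j = vvar" using X that by auto
    then obtain i j where ij: "i < N" "?X i = uvar" "j < N" "?X j = vvar" by blast
    have "i \<noteq> j" using ij(2,4) uvar_neq_vvar[where 'a = 'a] by metis
    moreover have "at_origin (?X i) = 0" "at_origin (?X j) = 0" unfolding ij by simp_all
    ultimately show ?thesis unfolding satellite_def length_points
      using ij(1,3) by (metis linorder_neqE_nat)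
  qed
qed

section \<open>Transversality and embedded resolution\<close>

lemma transversal_vvar: "transversal P vvar \<longleftrightarrow> at_origin P = 0 \<and> cf P 1 0 \<noteq> 0"
  and transversal_uvar: "transversal P uvar \<longleftrightarrow> at_origin P = 0 \<and> cf P 0 1 \<noteq> 0"
  by (auto simp: transversal_def) (auto simp: inner_var_def outer_var_def)

lemma order_0_eq_1: "coeff p 0 = 0 \<Longrightarrow> coeff p 1 \<noteq> 0 \<Longrightarrow> order 0 p = (1 :: nat)"
  by (rule order_0_eqI) auto

lemma transversal_orders:
  fixes P :: "'a::field poly poly"
  shows "transversal P vvar \<Longrightarrow> ordv P = 1" "transversal P uvar \<Longrightarrow> ordu P = 1"
  by (auto simp: transversal_vvar transversal_uvar ordv_def ordu_def coeff_restr_v at_origin_def intro!: order_0_eq_1[unfolded One_nat_def])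

lemma transversal_mult: "transversal P vvar \<Longrightarrow> mult_origin (P :: 'a::field poly poly) = 1"
  using mult_originI[of P 1 0] by (auto simp: transversal_vvar at_origin_def)

lemma resolved_afterI:
  fixes P :: "'a::field poly poly"
  assumes "\<not> umark c N" "transversal (strict_at c P N) vvar"
  shows "resolved_after P c N"
proof -
  have "exceptional_at (points c N) j = vvar" if "j < N" "at_origin (exceptional_at (points c N) j) = 0" for j
    using exceptional_curves[of N c] assms(1) that by blast
  then have "\<forall>j<N. at_origin (exceptional_at (points c N) j) = 0 \<longrightarrow>
      transversal (strict_at c P N) (exceptional_at (points c N) j)"
    using assms(2) by metis
  then show ?thesis
    using assms transversal_mult[OF assms(2)] satellite_iff[of c N]
    by (auto simp: resolved_after_def Let_def simp flip: points_def)
qed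

text \<open>Provides the alternatives of \<open>resolved_persists\<close>: at a point that is no
  satellite at most one axis is exceptional, and the curve meets it transversally.\<close>

lemma resolved_afterD:
  fixes P :: "'a::field poly poly"
  assumes "resolved_after P c r"
  shows "((\<forall>i<r. c i = Inf) \<and> mult_at c P r = 1 \<and> (umark c r \<longrightarrow> ordu (strict_at c P r) = 1)) \<or>
    (\<not> umark c r \<and> ordv (strict_at c P r) = 1)" and "\<not> satellite (points c r)"
proof -
  let ?X = "exceptional_at (points c r)"
  have R: "mult_at c P r = 1" "\<not> satellite (points c r)"
    "\<forall>j<r. at_origin (?X j) = 0 \<longrightarrow> transversal (strict_at c P r) (?X j)"
    using assms by (simp_all add: resolved_after_def Let_def flip: points_def)
  show "\<not> satellite (points c r)" by fact
  have tu: "ordu (strict_at c P r) = 1" if u: "umark c r"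
  proof -
    obtain j where "j < r" "?X j = uvar" using exceptional_curves[of r c] u by blast
    then have "transversal (strict_at c P r) uvar" using R(3) by force
    then show ?thesis by (rule transversal_orders)
  qed
  have tv: "ordv (strict_at c P r) = 1" if u: "\<exists>i<r. c i \<noteq> Inf"
  proof -
    obtain j where "j < r" "?X j = vvar" using exceptional_curves[of r c] u by blast
    then have "transversal (strict_at c P r) vvar" using R(3) by force
    then show ?thesis by (rule transversal_orders)
  qed
  show "((\<forall>i<r. c i = Inf) \<and> mult_at c P r = 1 \<and> (umark c r \<longrightarrow> ordu (strict_at c P r) = 1)) \<or>
    (\<not> umark c r \<and> ordv (strict_at c P r) = 1)"
    using tu tv R(1,2) satellite_iff[of c r] by blast
qed

lemma strict_at_restrictions:
  fixes P :: "'a::field poly poly"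
  assumes irr: "irreducible (germ P)" and v: "restr_v P \<noteq> 0" and pass: "\<And>i. at_origin (strict_at c P i) = 0"
  shows "restr_v (strict_at c P i) \<noteq> 0 \<and> (umark c i \<longrightarrow> coeff (strict_at c P i) 0 \<noteq> 0)"
proof (induction i)
  case (Suc i)
  have ir: "irreducible (germ (strict_at c P i))" by (rule irreducible_strict_transform[OF irr pass])
  have st: "at_origin (strict_step (c i) (strict_at c P i)) = 0" using pass[of "Suc i"] by simp
  show ?case
  proof (cases "c i")
    case (Fin z)
    with orders_step_Fin[OF ir, of z] st Suc show ?thesis by auto
  next
    case Inf
    with orders_step_Inf[OF ir] st Suc show ?thesis by auto
  qed
qed (use v in simp)

section \<open>The valuation of the curve at its infinitely near points\<close>

lemma valuation_sequence:
  fixes F :: "'a::field poly poly"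
  assumes W: "centered_valuation W" and irr: "irreducible (germ F)" and pass: "\<And>i. at_origin (strict_at c F i) = 0"
    and inf: "W F = \<infinity>" and fin: "W uvar \<noteq> \<infinity> \<or> W vvar \<noteq> \<infinity>"
  obtains Ws where "\<And>i. centered_valuation (Ws i)" "Ws 0 = W" "\<And>i P. Ws (Suc i) (total_step (c i) P) = Ws i P"
    "\<And>i P. Ws i (total_at c P i) = W P" "\<And>i. Ws i uvar \<noteq> \<infinity> \<or> Ws i vvar \<noteq> \<infinity>"
proof -
  define good where "good i V \<longleftrightarrow> centered_valuation V \<and> V (strict_at c F i) = \<infinity> \<and> (V uvar \<noteq> \<infinity> \<or> V vvar \<noteq> \<infinity>) \<and>
    (i = 0 \<longrightarrow> V = W)" for i V
  have "\<exists>Ws. \<forall>i. good i (Ws i) \<and> (\<forall>P. Ws (Suc i) (total_step (c i) P) = Ws i P)"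
  proof (rule dependent_nat_choice)
    show "\<exists>V. good 0 V" using assms by (auto simp: good_def)
    fix V i assume "good i V"
    then have V: "centered_valuation V" "V (strict_at c F i) = \<infinity>" "V uvar \<noteq> \<infinity> \<or> V vvar \<noteq> \<infinity>"
      by (auto simp: good_def)
    have "at_origin (strict_step (c i) (strict_at c F i)) = 0" using pass[of "Suc i"] by simp
    from centered_valuation_step[OF V(1) irreducible_strict_transform[OF irr pass] this V(2,3)]
    obtain V' where "centered_valuation V'" "\<And>P. V' (total_step (c i) P) = V P"
      "V' (strict_step (c i) (strict_at c F i)) = \<infinity>" "V' uvar \<noteq> \<infinity> \<or> V' vvar \<noteq> \<infinity>" by blast
    then show "\<exists>V'. good (Suc i) V' \<and> (\<forall>P. V' (total_step (c i) P) = V P)" by (auto simp: good_def)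
  qed
  then obtain Ws where Ws: "\<And>i. good i (Ws i)" "\<And>i P. Ws (Suc i) (total_step (c i) P) = Ws i P" by blast
  have "Ws i (total_at c P i) = W P" for i P
    by (induction i) (use Ws in \<open>auto simp: good_def\<close>)
  then show ?thesis using that[of Ws] Ws by (auto simp: good_def)
qed

text \<open>Downward induction from stage \<open>N\<close>, where the intersection number with
  \<open>v = 0\<close> is 1. The values of the coordinates obey the same rules as the intersection
  numbers with the axes, so they agree up to the factor \<open>k\<close>.\<close>

lemma values_of_axes:
  fixes Ws :: "nat \<Rightarrow> 'a::field poly poly \<Rightarrow> enat"
  assumes path: "curve_path c N e xu xv" and W: "\<And>i. centered_valuation (Ws i)"
    and step: "\<And>i P. Ws (Suc i) (total_step (c i) P) = Ws i P"
    and N: "\<not> umark c N" "xv N = 1" "Ws N vvar = enat k" and "i \<le> N"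
  shows "Ws i vvar = enat (k * xv i) \<and> (umark c i \<longrightarrow> Ws i uvar = enat (k * xu i)) \<and>
    (i < N \<longrightarrow> c i = Inf \<longrightarrow> Ws i uvar = enat (k * e i))"
  using \<open>i \<le> N\<close>
proof (induction i rule: inc_induct)
  case base then show ?case using N by simp
next
  case (step i)
  interpret curve_path c N e xu xv by (rule path)
  interpret W: centered_valuation "Ws (Suc i)" by (rule W)
  note i = \<open>i < N\<close>
  have v: "Ws i vvar = Ws (Suc i) (total_step (c i) vvar)" and u: "Ws i uvar = Ws (Suc i) (total_step (c i) uvar)"
    by (rule assms(3)[symmetric])+
  show ?case
  proof (cases "c i")
    case Inf
    then show ?thesis using step.IH Inf_step[OF i Inf] u v
      by (simp add: total_step_vars W.W_mult algebra_simps)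
  next
    case (Fin z)
    have V: "Ws i vvar = enat (k * xv i)"
      using step.IH Fin_step[OF i Fin] v by (simp add: Fin total_step_vars)
    have "Ws i uvar = enat (k * xu i)" if "umark c i"
    proof (cases "z = 0")
      case True
      then show ?thesis using step.IH Fin_0_step[OF i _ that] Fin_step[OF i Fin] u Fin that
        by (simp add: total_step_vars W.W_mult algebra_simps)
    next
      case False
      then have "Ws (Suc i) (uvar + cst z) = 0" by (intro W.W_unit) (simp add: at_origin_outer_plus)
      then show ?thesis using step.IH Fin_other_step[OF i Fin False] Fin_step[OF i Fin] u Fin
        by (simp add: total_step_vars W.W_mult)
    qed
    then show ?thesis using V Fin by simp
  qed
qed

section \<open>Values of polynomials at the place at infinity\<close>

locale place_at_infinity = centered_valuation W for W :: "'a::field poly poly \<Rightarrow> enat" +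
  fixes L :: nat
  assumes W_vvar: "W vvar = enat L"
begin

definition regular :: "'a poly poly \<Rightarrow> bool" where "regular h \<longleftrightarrow> W (bar h) \<noteq> \<infinity>"
definition val :: "'a poly poly \<Rightarrow> int" where "val h = int (the_enat (W (bar h))) - int (tdeg h) * int L"

lemma val_eqI: "W (bar h) = enat k \<Longrightarrow> regular h \<and> val h = int k - int (tdeg h) * int L"
  by (simp add: regular_def val_def)

lemma regularE: assumes "regular h" obtains k where "W (bar h) = enat k" "val h = int k - int (tdeg h) * int L"
  using assms by (auto simp: regular_def val_def)

lemma val_mult:
  assumes "regular h" "regular k" shows "regular (h * k)" "val (h * k) = val h + val k"
proof -
  obtain a b where a: "W (bar h) = enat a" "val h = int a - int (tdeg h) * int L"
    and b: "W (bar k) = enat b" "val k = int b - int (tdeg k) * int L" using assms by (metis regularE)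
  have "W (bar (h * k) * vvar ^ (tdeg h + tdeg k)) = W (bar h * bar k * vvar ^ tdeg (h * k))"
    by (simp only: bar_mult)
  then have eq: "W (bar (h * k)) + enat ((tdeg h + tdeg k) * L) = enat (a + b + tdeg (h * k) * L)"
    by (simp only: W_mult W_power[OF W_vvar] a b plus_enat_simps)
  then obtain m where m: "W (bar (h * k)) = enat m" by (cases "W (bar (h * k))") auto
  have "m + (tdeg h + tdeg k) * L = a + b + tdeg (h * k) * L" using eq by (simp add: m)
  then have "int (m + (tdeg h + tdeg k) * L) = int (a + b + tdeg (h * k) * L)" by simp
  then show "regular (h * k)" "val (h * k) = val h + val k"
    using val_eqI[OF m] a b by (simp_all add: algebra_simps)
qed

lemma val_add:
  assumes "regular h" "regular k" "val h < val k" shows "regular (h + k)" "val (h + k) = val h"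
proof -
  obtain a b where a: "W (bar h) = enat a" "val h = int a - int (tdeg h) * int L"
    and b: "W (bar k) = enat b" "val k = int b - int (tdeg k) * int L" using assms by (metis regularE)
  have "int (a + tdeg k * L) < int (b + tdeg h * L)" using assms(3) a b by simp
  then have lt: "a + tdeg k * L < b + tdeg h * L" by (simp only: of_nat_less_iff)
  have "W (bar h * vvar ^ tdeg k) = enat (a + tdeg k * L)" "W (bar k * vvar ^ tdeg h) = enat (b + tdeg h * L)"
    by (simp_all only: W_mult W_power[OF W_vvar] a b plus_enat_simps)
  then have S: "W (bar h * vvar ^ tdeg k + bar k * vvar ^ tdeg h) = enat (a + tdeg k * L)"
    using W_add_strict[of "bar h * vvar ^ tdeg k" "bar k * vvar ^ tdeg h"] lt by simp
  have "W (bar (h + k) * vvar ^ (tdeg h + tdeg k)) =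
      W ((bar h * vvar ^ tdeg k + bar k * vvar ^ tdeg h) * vvar ^ tdeg (h + k))"
    by (simp only: bar_add)
  then have eq: "W (bar (h + k)) + enat ((tdeg h + tdeg k) * L) = enat (a + tdeg k * L + tdeg (h + k) * L)"
    by (simp only: W_mult W_power[OF W_vvar] S plus_enat_simps)
  then obtain m where m: "W (bar (h + k)) = enat m" by (cases "W (bar (h + k))") auto
  have "m + (tdeg h + tdeg k) * L = a + tdeg k * L + tdeg (h + k) * L" using eq by (simp add: m)
  then have "int (m + (tdeg h + tdeg k) * L) = int (a + tdeg k * L + tdeg (h + k) * L)" by simp
  then show "regular (h + k)" "val (h + k) = val h"
    using val_eqI[OF m] a b by (simp_all add: algebra_simps)
qed

lemma val_add_distinct:
  assumes "regular h" "regular k" "val h \<noteq> val k"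
  shows "regular (h + k)" "val (h + k) = val h \<or> val (h + k) = val k"
  using assms val_add[of h k] val_add[of k h] by (metis add.commute linorder_neqE)+

text \<open>The homogenization of a polynomial in \<open>x\<close> alone does not vanish at the
  point at infinity, so only the power of \<open>v\<close> contributes.\<close>

lemma val_const_in_y:
  assumes "r \<noteq> 0" shows "regular [:r:]" "val [:r:] \<le> 0" "int L dvd val [:r:]"
proof -
  have c: "cf [:r:] i j = (if i = 0 then coeff r j else 0)" for i j by (cases i) auto
  have t: "tdeg [:r:] = degree r"
    using assms by (subst tdegI[of _ 0 "degree r"]) (auto simp: c le_degree split: if_splits)
  have "at_origin (bar [:r:]) \<noteq> 0" using assms by (simp add: at_origin_def cf_bar t)
  then have "W (bar [:r:]) = enat 0" by (simp add: W_unit zero_enat_def)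
  from val_eqI[OF this] show "regular [:r:]" "val [:r:] \<le> 0" "int L dvd val [:r:]" by auto
qed

end

section \<open>Expansions in powers of the approximates\<close>

lemma dseq_Suc: "dseq \<delta> (Suc i) = gcd (dseq \<delta> i) (\<delta> i)"
  by (simp add: dseq_def lessThan_Suc gcd.commute)

lemma dseq_1: "dseq \<delta> 1 = \<bar>\<delta> 0\<bar>"
  by (simp add: dseq_def lessThan_Suc)

locale approximates = place_at_infinity W L for W :: "'a::field poly poly \<Rightarrow> enat" and L +
  fixes g :: nat and \<delta> :: "nat \<Rightarrow> int" and q :: "nat \<Rightarrow> 'a poly poly"
  assumes seq: "delta_sequence g \<delta>"
    and L: "\<delta> 0 = int L"
    and q_regular: "i \<le> g \<Longrightarrow> regular (q i)"
    and q_val: "i \<le> g \<Longrightarrow> \<delta> i = - val (q i)"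
    and q_monic: "0 < i \<Longrightarrow> i \<le> g \<Longrightarrow> lead_coeff (q i) = 1"
    and q_degree: "0 < i \<Longrightarrow> i \<le> g \<Longrightarrow> int (degree (q i)) = \<delta> 0 div dseq \<delta> i"
begin

lemma dseq_pos: "0 < i \<Longrightarrow> 0 < dseq \<delta> i"
proof -
  assume "0 < i"
  have "\<delta> 0 > 0" using seq by (simp add: delta_sequence_def)
  moreover have "dseq \<delta> i dvd \<delta> 0" unfolding dseq_def using \<open>0 < i\<close> by (intro Gcd_dvd) auto
  ultimately have "dseq \<delta> i \<noteq> 0" by auto
  moreover have "0 \<le> dseq \<delta> i" unfolding dseq_def by simp
  ultimately show ?thesis by simp
qed

lemma dseq_dvd: "j < i \<Longrightarrow> dseq \<delta> i dvd \<delta> j"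
  unfolding dseq_def by (intro Gcd_dvd) auto

lemma nseq_mult: "0 < i \<Longrightarrow> dseq \<delta> i = nseq \<delta> i * dseq \<delta> (Suc i)"
  by (simp add: nseq_def dseq_Suc)

text \<open>As \<open>dseq \<delta> (Suc i)\<close> is the gcd of \<open>dseq \<delta> i\<close> and
  \<open>\<delta> i\<close>, the order of \<open>\<delta> i\<close> modulo
  \<open>dseq \<delta> i\<close> is exactly \<open>nseq \<delta> i\<close>.\<close>

lemma not_dvd_multiple:
  assumes "0 < i" "0 < m" "m < nseq \<delta> i" shows "\<not> dseq \<delta> i dvd m * \<delta> i"
proof
  assume dvd: "dseq \<delta> i dvd m * \<delta> i"
  define e where "e = dseq \<delta> (Suc i)"
  have e: "e > 0" unfolding e_def by (rule dseq_pos) simp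
  have d: "dseq \<delta> i = nseq \<delta> i * e" unfolding e_def by (rule nseq_mult) fact
  obtain \<delta>' where \<delta>': "\<delta> i = e * \<delta>'" using dseq_dvd[of i "Suc i"] by (auto simp: e_def elim: dvdE)
  have "gcd (nseq \<delta> i * e) (\<delta>' * e) = e" using dseq_Suc[of \<delta> i] d \<delta>' by (simp add: e_def mult.commute)
  then have "gcd (nseq \<delta> i) \<delta>' * e = e" using e by (simp add: gcd_mult_right gcd.commute)
  then have cop: "coprime (nseq \<delta> i) \<delta>'" using e by (simp add: coprime_iff_gcd_eq_1 gcd.commute)
  have "nseq \<delta> i * e dvd (m * \<delta>') * e" using dvd by (simp add: d \<delta>' mult_ac)
  then have "nseq \<delta> i dvd m * \<delta>'" using e by simp
  then have "nseq \<delta> i dvd m" using cop by (simp add: coprime_dvd_mult_left_iff)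
  then show False using assms zdvd_not_zless by blast
qed

text \<open>
  Division with remainder by \<open>q i\<close>: the values of the terms of the resulting expansion are distinct modulo \<open>dseq \<delta> i\<close>.
\<close>

lemma expansion_value:
  assumes i: "0 < i" "i \<le> g"
    and low: "\<And>h. h \<noteq> 0 \<Longrightarrow> degree h < degree (q i) \<Longrightarrow> regular h \<and> val h \<le> 0 \<and> dseq \<delta> i dvd val h"
    and t: "int t \<le> nseq \<delta> i" and h: "h \<noteq> 0" "degree h < t * degree (q i)"
  shows "\<exists>s<t. regular h \<and> val h \<le> 0 \<and> dseq \<delta> i dvd val h + int s * \<delta> i"
  using t h
proof (induction t arbitrary: h)
  case (Suc t)
  have q0: "q i \<noteq> 0" using q_monic[OF i] by auto
  have \<delta>i: "0 < \<delta> i" using seq i by (simp add: delta_sequence_def)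
  obtain h' r where hr: "h = q i * h' + r" "r = 0 \<or> degree r < degree (q i)"
    using monic_division[OF q_monic[OF i]] .
  show ?case
  proof (cases "h' = 0")
    case True
    then have "h = r" "degree r < degree (q i)" using hr Suc.prems by auto
    then have "regular h \<and> val h \<le> 0 \<and> dseq \<delta> i dvd val h" using low Suc.prems by simp
    then show ?thesis by (intro exI[of _ 0]) simp
  next
    case False
    have dm: "degree (q i * h') = degree (q i) + degree h'" using q0 False by (rule degree_mult_eq)
    then have "degree h = degree (q i) + degree h'"
      using hr by (cases "r = 0") (auto simp: degree_add_eq_left)
    then have "degree h' < t * degree (q i)" using Suc.prems by simp
    then obtain s where s: "s < t" "regular h'" "val h' \<le> 0" "dseq \<delta> i dvd val h' + int s * \<delta> i"
      using Suc.IH[OF _ False] Suc.prems(1) by auto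
    have m: "regular (q i * h')" "val (q i * h') = val h' - \<delta> i"
      using val_mult[OF q_regular s(2)] q_val i by auto
    have m': "dseq \<delta> i dvd val (q i * h') + int (Suc s) * \<delta> i" unfolding m(2) using s(4) by (simp add: algebra_simps)
    show ?thesis
    proof (cases "r = 0")
      case True
      then show ?thesis using hr m m' s(1,3) \<delta>i by (intro exI[of _ "Suc s"]) auto
    next
      case False
      then have r: "regular r" "val r \<le> 0" "dseq \<delta> i dvd val r" using low hr(2) by auto
      \<comment> \<open>Modulo \<open>dseq \<delta> i\<close> the two values differ by
        \<open>Suc s\<close> times \<open>\<delta> i\<close> up to sign, and \<open>Suc s\<close>
        lies strictly between 0 and \<open>nseq \<delta> i\<close>.\<close>
      have "val (q i * h') \<noteq> val r"
      proof
        assume eq: "val (q i * h') = val r"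
        have "dseq \<delta> i dvd (val (q i * h') + int (Suc s) * \<delta> i) - val r" using m' r(3) by (rule dvd_diff)
        then have "dseq \<delta> i dvd int (Suc s) * \<delta> i" by (simp only: eq) (simp only: add_diff_cancel_left')
        moreover have "int (Suc s) < nseq \<delta> i" using s(1) Suc.prems(1) by simp
        ultimately show False using not_dvd_multiple[OF i(1), of "int (Suc s)"] by simp
      qed
      from val_add_distinct[OF m(1) r(1) this]
      have R: "regular h" and "val h = val (q i * h') \<or> val h = val r" by (simp_all add: hr(1))
      then show ?thesis
      proof (elim disjE)
        assume "val h = val (q i * h')"
        then show ?thesis using R m m' s(1,3) \<delta>i by (intro exI[of _ "Suc s"]) auto
      next
        assume "val h = val r"
        then show ?thesis using R r by (intro exI[of _ 0]) auto
      qed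
    qed
  qed
qed simp

text \<open>The degree bound is \<open>nseq\<close> times the degree of the current approximate, so
  the expansion in it uses only exponents below \<open>nseq\<close>, with coefficients covered by
  the previous step. The base case consists of the polynomials in \<open>x\<close>, since
  \<open>dseq \<delta> 1 = \<delta> 0\<close>.\<close>

lemma low_degree_value:
  assumes "i \<le> g" "h \<noteq> 0" "int (degree h) < \<delta> 0 div dseq \<delta> (Suc i)"
  shows "regular h \<and> val h \<le> 0 \<and> dseq \<delta> (Suc i) dvd val h"
  using assms
proof (induction i arbitrary: h)
  case 0
  have \<delta>0: "0 < \<delta> 0" using seq by (simp add: delta_sequence_def)
  then have d1: "dseq \<delta> (Suc 0) = int L" using dseq_1[of \<delta>] by (simp add: L)
  then have "degree h = 0" using 0 \<delta>0 by (simp add: L)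
  then obtain r where "h = [:r:]" by (metis degree_0_id)
  then show ?case using val_const_in_y[of r] 0 d1 by auto
next
  case (Suc i)
  let ?i = "Suc i"
  have i: "0 < ?i" "?i \<le> g" using Suc.prems by auto
  have n: "nseq \<delta> ?i > 1" using seq i by (auto simp: delta_sequence_def)
  have mult: "dseq \<delta> ?i = nseq \<delta> ?i * dseq \<delta> (Suc ?i)" by (rule nseq_mult) simp
  have dpos: "0 < dseq \<delta> ?i" "0 < dseq \<delta> (Suc ?i)" by (rule dseq_pos, simp)+
  obtain k where k: "\<delta> 0 = dseq \<delta> ?i * k" using dseq_dvd[of 0 ?i] by (auto elim: dvdE)
  have "\<delta> 0 = (nseq \<delta> ?i * k) * dseq \<delta> (Suc ?i)" using k mult by (simp only: mult_ac)
  then have D: "\<delta> 0 div dseq \<delta> (Suc ?i) = nseq \<delta> ?i * k" using dpos by simp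
  have k': "int (degree (q ?i)) = k" using q_degree[OF i] k dpos by simp
  have "int (degree h) < int (nat (nseq \<delta> ?i) * degree (q ?i))" using Suc.prems(3) n by (simp only: D of_nat_mult k') simp
  then have "degree h < nat (nseq \<delta> ?i) * degree (q ?i)" by (simp only: of_nat_less_iff)
  moreover have "regular h \<and> val h \<le> 0 \<and> dseq \<delta> ?i dvd val h" if "h \<noteq> 0" "degree h < degree (q ?i)" for h
    by (rule Suc.IH) (use that i q_degree[OF i] in auto)
  ultimately obtain s where s: "regular h" "val h \<le> 0" "dseq \<delta> ?i dvd val h + int s * \<delta> ?i"
    using expansion_value[OF i, of "nat (nseq \<delta> ?i)" h] Suc.prems(2) n by auto
  have "dseq \<delta> (Suc ?i) dvd val h + int s * \<delta> ?i" using s(3) mult by (metis dvd_mult_right)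
  moreover have "dseq \<delta> (Suc ?i) dvd int s * \<delta> ?i" using dseq_dvd[of ?i "Suc ?i"] by simp
  ultimately have "dseq \<delta> (Suc ?i) dvd val h" by (metis dvd_add_left_iff)
  then show ?case using s by simp
qed

lemma value_nonpos:
  assumes "h \<noteq> 0" "degree h < L" shows "regular h" "val h \<le> 0"
proof -
  have "dseq \<delta> (Suc g) = 1" using seq by (simp add: delta_sequence_def)
  then show "regular h" "val h \<le> 0" using low_degree_value[of g h] assms by (auto simp: L)
qed

end

section \<open>Elimination of base points\<close>

lemma rhom_to_ac: "rhom to_ac"
  by (simp add: rhom_def)

context
  fixes h :: "'a::field \<Rightarrow> 'b::field"
  assumes h: "rhom h"
begin

abbreviation (input) base_change :: "'a poly poly \<Rightarrow> 'b poly poly" where "base_change \<equiv> map_poly (map_poly h)"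

lemma rhom_base_change: "rhom base_change"
  by (rule rhom_map_poly[OF rhom_map_poly[OF h]])

lemma h_eq_0_iff: "h x = 0 \<longleftrightarrow> x = 0"
proof
  assume "h x = 0"
  then have "h (x * inverse x) = 0" by (simp add: rhom_mult[OF h])
  then show "x = 0" by (metis right_inverse rhom_1[OF h] zero_neq_one)
qed (simp add: rhom_0[OF h])

lemma cf_base_change: "cf (base_change P) i j = h (cf P i j)"
  by (simp add: coeff_map_poly rhom_0[OF h])

lemma at_origin_base_change: "at_origin (base_change P) = h (at_origin P)"
  by (simp add: at_origin_def cf_base_change)

lemma mult_origin_base_change: "mult_origin (base_change P) = mult_origin P"
  unfolding mult_origin_def cf_base_change by (simp add: h_eq_0_iff)

lemma base_change_vars: "base_change (cst a) = cst (h a)" "base_change uvar = uvar" "base_change vvar = vvar"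
  by (simp_all add: cst_def outer_var_def inner_var_def map_poly_pCons rhom_simps[OF h] rhom_simps[OF rhom_map_poly[OF h]])

lemma total_step_base_change: "total_step (map_direction h s) (base_change P) = base_change (total_step s P)"
proof (rule rhom_eqI[of "\<lambda>P. total_step (map_direction h s) (base_change P)" "\<lambda>P. base_change (total_step s P)"])
  show "rhom (\<lambda>P. total_step (map_direction h s) (base_change P))" by (rule rhom_comp[OF rhom_total_step rhom_base_change])
  show "rhom (\<lambda>P. base_change (total_step s P))" by (rule rhom_comp[OF rhom_base_change rhom_total_step])
  show "total_step (map_direction h s) (base_change (cst a)) = base_change (total_step s (cst a))" for a
    by (simp add: base_change_vars total_step_vars)
  show "total_step (map_direction h s) (base_change uvar) = base_change (total_step s uvar)"
    by (cases s) (simp_all add: base_change_vars total_step_vars rhom_mult[OF rhom_base_change] rhom_add[OF rhom_base_change])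
  show "total_step (map_direction h s) (base_change vvar) = base_change (total_step s vvar)"
    by (cases s) (simp_all add: base_change_vars total_step_vars rhom_mult[OF rhom_base_change])
qed

lemma total_transform_base_change:
  "total_transform (map (map_direction h) ss) (base_change P) = base_change (total_transform ss P)"
  by (induction ss rule: rev_induct) (simp_all add: total_step_base_change)

lemma restr_v_base_change: "restr_v (base_change P) = map_poly h (restr_v P)"
  by (rule poly_eqI) (simp add: coeff_restr_v coeff_map_poly rhom_0[OF h])

lemma monomial_form_base_change:
  assumes "monomial_form T ab S" shows "monomial_form (base_change T) ab (base_change S)"
proof -
  obtain U where "at_origin U \<noteq> 0" "T = U * uvar ^ fst ab * vvar ^ snd ab * S"
    using assms by (auto simp: monomial_form_def)
  then have "at_origin (base_change U) \<noteq> 0 \<and> base_change T = base_change U * uvar ^ fst ab * vvar ^ snd ab * base_change S"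
    by (simp add: at_origin_base_change h_eq_0_iff rhom_mult[OF rhom_base_change] rhom_power[OF rhom_base_change] base_change_vars)
  then show ?thesis unfolding monomial_form_def by blast
qed

lemma map_poly_h_eq_0_iff: "map_poly h p = 0 \<longleftrightarrow> p = 0"
  using map_poly_eq_0_iff[of h p] by (simp add: h_eq_0_iff rhom_0[OF h])

end

lemma coprime_inner_power:
  fixes S Z Y :: "'a::field poly poly"
  assumes "S * Z = vvar ^ q * Y" "restr_v S \<noteq> 0"
  obtains Z' where "Z = vvar ^ q * Z'" "S * Z' = Y"
proof -
  have "\<exists>Z'. Z = vvar ^ q * Z' \<and> S * Z' = Y"
    using assms(1)
  proof (induction q arbitrary: Z)
    case (Suc q)
    have "restr_v (S * Z) = 0" unfolding Suc.prems by (simp add: rhom_mult[OF rhom_restr_v])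
    then have "restr_v S * restr_v Z = 0" by (simp add: rhom_mult[OF rhom_restr_v])
    then have "vvar dvd Z" using assms(2) restr_v_eq_0_iff by auto
    then obtain X1 where X1: "Z = vvar * X1" by (elim dvdE)
    then have "vvar * (S * X1) = vvar * (vvar ^ q * Y)" using Suc.prems by (simp add: mult_ac)
    then have "S * X1 = vvar ^ q * Y" by (simp add: inner_var_neq_0)
    from Suc.IH[OF this] obtain Z' where "X1 = vvar ^ q * Z'" "S * Z' = Y" by blast
    then show ?case by (intro exI[of _ Z']) (simp add: X1 mult.assoc)
  qed simp
  then show ?thesis using that by blast
qed

lemma coprime_outer_power:
  fixes S Z Y :: "'a::field poly poly"
  assumes "S * Z = uvar ^ q * Y" "coeff S 0 \<noteq> 0"
  obtains Z' where "Z = uvar ^ q * Z'" "S * Z' = Y"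
proof -
  have "swap_vars S * swap_vars Z = vvar ^ q * swap_vars Y"
    using arg_cong[OF assms(1), of swap_vars] by (simp add: rhom_simps[OF rhom_swap_vars])
  moreover have "restr_v (swap_vars S) \<noteq> 0" using assms(2) by (simp add: restr_v_swap)
  ultimately obtain Z' where Z': "swap_vars Z = vvar ^ q * Z'" "swap_vars S * Z' = swap_vars Y"
    by (rule coprime_inner_power)
  have "Z = uvar ^ q * swap_vars Z'" "S * swap_vars Z' = Y"
    using arg_cong[OF Z'(1), of swap_vars] arg_cong[OF Z'(2), of swap_vars]
    by (simp_all add: rhom_simps[OF rhom_swap_vars])
  then show ?thesis by (rule that)
qed

lemma points_above_path:
  "ss \<in> points_above c M \<longleftrightarrow> (\<exists>j d. ss = map (map_direction to_ac) (points c j) @ [d] \<and> j \<le> M \<and>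
    (j < M \<longrightarrow> d \<noteq> map_direction to_ac (c j)))"
  by (auto simp: points_above_def points_def)

lemma pencil_member_eq:
  assumes "0 < tdeg f"
  shows "pencil_member f l = map_poly (map_poly to_ac) (bar f) - cst (to_ac l) * vvar ^ tdeg f"
  unfolding pencil_member_def bar_diff_cst(2)[OF assms]
  by (simp add: rhom_simps[OF rhom_base_change[OF rhom_to_ac]] base_change_vars[OF rhom_to_ac])

lemma total_pencil_member:
  assumes "0 < tdeg f"
  shows "total_transform ss (pencil_member f l) = total_transform ss (map_poly (map_poly to_ac) (bar f)) -
    cst (to_ac l) * total_transform ss vvar ^ tdeg f"
  by (simp add: pencil_member_eq[OF assms] rhom_simps[OF rhom_total_transform])

text \<open>At the point where the curve meets the last exceptional curve of the elimination, remove
  the common factor \<open>H\<close>. What remains of \<open>bar f\<close> vanishes there, so what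
  remains of \<open>v^d\<close> does not, and the quotient of the two lies in the maximal ideal at
  every later point of the curve.\<close>

lemma eliminates_base_points_positive:
  fixes f :: "'a::field poly poly"
  assumes el: "eliminates_base_points f c m" and d: "0 < tdeg f"
    and irr: "irreducible (germ (bar f))" and v: "restr_v (bar f) \<noteq> 0"
    and pass: "\<And>i. at_origin (strict_at c (bar f) i) = 0" and n: "m < n"
  shows "tdeg f * mult_origin (total_at c vvar n) < mult_origin (total_at c (bar f) n)"
proof -
  let ?h = "to_ac :: 'a \<Rightarrow> 'a alg_closure"
  let ?e = "map_poly (map_poly ?h)" and ?ps = "\<lambda>i. map (map_direction ?h) (points c i)"
  define F where "F = ?e (bar f)"
  have "germ (bar f) \<noteq> 0" using irr unfolding irreducible_def by blast
  then have F0: "bar f \<noteq> 0" by simp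
  have TF: "total_transform (?ps i) F = ?e (total_at c (bar f) i)" for i
    unfolding F_def by (rule total_transform_base_change[OF rhom_to_ac])
  have TV: "total_transform (?ps i) vvar = ?e (total_at c vvar i)" for i
    using total_transform_base_change[OF rhom_to_ac, of "points c i" vvar] by (simp add: base_change_vars[OF rhom_to_ac])
  have "?ps (Suc m) \<in> points_above c m" unfolding points_above_path by (intro exI[of _ m]) simp
  then obtain H A where HA: "\<forall>l. total_transform (?ps (Suc m)) (pencil_member f l) = H * A l" "\<exists>l. at_origin (A l) \<noteq> 0"
    using el unfolding eliminates_base_points_def by blast
  define T where "T = total_transform (?ps (Suc m)) F"
  define V where "V = total_transform (?ps (Suc m)) vvar ^ tdeg f"
  have HA': "T - cst (?h l) * V = H * A l" for l
    using HA(1) unfolding total_pencil_member[OF d] T_def V_def F_def by simp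
  \<comment> \<open>The members with \<lambda> equal to 0 and 1 span the pencil:
    \<open>H * A 0\<close> is the transform of \<open>bar f\<close> and \<open>H * B\<close> that of
    \<open>v^d\<close>.\<close>
  define B where "B = A 0 - A 1"
  have T: "T = H * A 0" using HA'[of 0] by simp
  have V: "V = H * B" using HA'[of 0] HA'[of 1] by (simp add: B_def algebra_simps)
  have V0: "V \<noteq> 0" by (simp add: V_def inner_var_neq_0)
  then have H0: "H \<noteq> 0" using V by auto
  have eq: "T * B = V * A 0" unfolding T V by (simp add: mult_ac)
  have T0: "T \<noteq> 0"
    using F0 unfolding T_def F_def
    by (simp add: map_poly_eq_0_iff)
  have AB: "at_origin (A l) = at_origin (A 0) - ?h l * at_origin B" for l
  proof -
    have "H * A l = H * (A 0 - cst (?h l) * B)" using HA'[of l] T V by (simp add: algebra_simps)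
    then show ?thesis using H0 by (simp add: rhom_simps[OF rhom_at_origin])
  qed
  \<comment> \<open>The transform of \<open>v^d\<close> is a unit times powers of axes that have no
    common factor with the strict transform \<open>S\<close>. So \<open>S\<close>, which vanishes at
    the point, divides a unit times \<open>A 0\<close>.\<close>
  have A0: "at_origin (A 0) = 0"
  proof (rule ccontr)
    assume nz: "at_origin (A 0) \<noteq> 0"
    define S where "S = ?e (strict_at c (bar f) (Suc m))"
    obtain a b where ab: "expo c (mult_at c (bar f)) (0, 0) (Suc m) = (a, b)" by (rule prod.exhaust)
    have "monomial_form T (a, b) S"
      using monomial_form_base_change[OF rhom_to_ac monomial_form_total[OF F0, of c "Suc m"]]
      by (simp only: ab T_def TF S_def)
    then obtain U1 where U1: "T = U1 * uvar ^ a * vvar ^ b * S" by (auto simp: monomial_form_def)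
    obtain p q where pq: "expo c (\<lambda>_. 0) (0, 1) (Suc m) = (p, q)" by (rule prod.exhaust)
    have "monomial_form (total_transform (?ps (Suc m)) vvar) (p, q) 1"
      using monomial_form_base_change[OF rhom_to_ac monomial_form_vvar[of c "Suc m"]]
      by (simp only: pq TV rhom_1[OF rhom_base_change[OF rhom_to_ac]])
    then obtain U2 where U2: "at_origin U2 \<noteq> 0" "total_transform (?ps (Suc m)) vvar = U2 * uvar ^ p * vvar ^ q"
      by (auto simp: monomial_form_def)
    have V': "V = U2 ^ tdeg f * uvar ^ (p * tdeg f) * vvar ^ (q * tdeg f)"
      unfolding V_def U2(2) by (simp add: power_mult_distrib power_mult)
    have rS: "restr_v S \<noteq> 0"
      using strict_at_restrictions[OF irr v pass, of "Suc m"] by (simp add: S_def restr_v_base_change[OF rhom_to_ac] map_poly_h_eq_0_iff[OF rhom_to_ac])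
    have "S * (U1 * uvar ^ a * vvar ^ b * B) = vvar ^ (q * tdeg f) * (U2 ^ tdeg f * uvar ^ (p * tdeg f) * A 0)"
      using eq unfolding U1 V' by (simp only: mult_ac)
    then obtain Z where Z: "S * Z = U2 ^ tdeg f * uvar ^ (p * tdeg f) * A 0"
      by (rule coprime_inner_power[OF _ rS])
    have "\<exists>Z'. S * Z' = U2 ^ tdeg f * A 0"
    proof (cases "umark c (Suc m)")
      case True
      then have "coeff S 0 \<noteq> 0"
        using strict_at_restrictions[OF irr v pass, of "Suc m"] True
        by (simp add: S_def coeff_map_poly map_poly_h_eq_0_iff[OF rhom_to_ac])
      moreover have "S * Z = uvar ^ (p * tdeg f) * (U2 ^ tdeg f * A 0)" using Z by (simp only: mult_ac)
      ultimately obtain Z' where "S * Z' = U2 ^ tdeg f * A 0" using coprime_outer_power by blast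
      then show ?thesis by blast
    next
      case False
      then have "p = 0" using expo_unmarked[of "(0, 1)" c "Suc m" "\<lambda>_. 0"] pq by simp
      then show ?thesis using Z by auto
    qed
    then obtain Z' where Z': "S * Z' = U2 ^ tdeg f * A 0" by blast
    have "at_origin S * at_origin Z' = at_origin U2 ^ tdeg f * at_origin (A 0)"
      using arg_cong[OF Z', of at_origin] by (simp add: rhom_mult[OF rhom_at_origin] rhom_power[OF rhom_at_origin])
    moreover have "at_origin S = 0"
      using pass[of "Suc m"] by (simp only: S_def at_origin_base_change[OF rhom_to_ac] to_ac_0)
    ultimately show False using nz U2(1) by simp
  qed
  obtain l where "at_origin (A l) \<noteq> 0" using HA(2) by blast
  then have B1: "at_origin B \<noteq> 0" using AB[of l] A0 by auto
  have B0: "B \<noteq> 0" and A00: "A 0 \<noteq> 0" using V V0 T T0 by (metis mult_zero_right)+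
  \<comment> \<open>The identity \<open>T * B = V * A 0\<close> is transported to stage
    \<open>n\<close>, where \<open>B\<close> has multiplicity 0 and \<open>A 0\<close> a positive
    one.\<close>
  obtain ts where ts: "points c n = points c (Suc m) @ ts" using points_split[OF Suc_leI[OF n]] by blast
  define R where "R = (\<lambda>P. total_transform (map (map_direction ?h) ts) P)"
  have R: "rhom R" unfolding R_def by (rule rhom_total_transform)
  have R0: "R P \<noteq> 0" if "P \<noteq> 0" for P using that by (simp add: R_def)
  have "mult_origin (R T) + mult_origin (R B) = mult_origin (R V) + mult_origin (R (A 0))"
    using arg_cong[OF eq, of "\<lambda>P. mult_origin (R P)"]
    unfolding rhom_mult[OF R] mult_origin_mult[OF R0[OF T0] R0[OF B0]] mult_origin_mult[OF R0[OF V0] R0[OF A00]] .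
  moreover have "mult_origin (R B) = 0" using B1 R0[OF B0] by (simp add: mult_origin_eq_0_iff R_def)
  moreover have "mult_origin (R (A 0)) \<noteq> 0" using A0 R0[OF A00] by (simp add: mult_origin_eq_0_iff R_def)
  moreover have "R T = ?e (total_at c (bar f) n)"
    unfolding R_def T_def TF unfolding ts by (simp only: total_transform_base_change[OF rhom_to_ac] total_transform_append)
  moreover have "R V = ?e (total_at c vvar n) ^ tdeg f"
    unfolding V_def rhom_power[OF R] unfolding R_def TV unfolding ts
    by (simp only: total_transform_base_change[OF rhom_to_ac] total_transform_append)
  ultimately show ?thesis
    by (simp add: mult_origin_base_change[OF rhom_to_ac] mult_origin_power map_poly_eq_0_iff inner_var_neq_0)
qed


lemma expo_step_bound:
  assumes "a \<le> d * p" "b \<le> d * q" "a + b + e \<le> d * (p + q)"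
  shows "fst (expo_step s e (a, b)) \<le> d * fst (expo_step s 0 (p, q)) \<and>
    snd (expo_step s e (a, b)) \<le> d * snd (expo_step s 0 (p, q))"
  using assms by (cases s) auto

text \<open>At the point of the curve the transforms of \<open>bar f\<close> and \<open>v^d\<close>
  contain the same power of \<open>v\<close>; after its removal the first vanishes there and the
  second does not. At all other points the strict transform is absent and the orders of
  \<open>bar f\<close> do not exceed those of \<open>v^d\<close>, so the monomial of
  \<open>bar f\<close> is the fixed part.\<close>

lemma eliminates_at_square:
  fixes f :: "'a::field poly poly"
  assumes irr: "irreducible (germ (bar f))" and top: "restr_v (bar f) = monom 1 (tdeg f)"
    and pass: "\<And>i. at_origin (strict_at c (bar f) i) = 0"
    and um: "\<not> umark c (Suc m)" and xv: "ordv (strict_at c (bar f) (Suc m)) = 1"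
    and sq: "(\<Sum>i<Suc m. mult_at c (bar f) i * mult_at c (bar f) i) = tdeg f * tdeg f"
    and d: "0 < tdeg f"
  shows "eliminates_base_points f c m"
  unfolding eliminates_base_points_def
proof
  let ?h = "to_ac :: 'a \<Rightarrow> 'a alg_closure" and ?d = "tdeg f"
  let ?e = "map_poly (map_poly ?h)" and ?ps = "\<lambda>i. map (map_direction ?h) (points c i)"
  let ?E = "mult_at c (bar f)"
  have "germ (bar f) \<noteq> 0" using irr unfolding irreducible_def by blast
  then have F0: "bar f \<noteq> 0" by simp
  have v: "restr_v (bar f) \<noteq> 0" by (simp add: top)
  interpret curve_path c "Suc m" ?E "\<lambda>i. ordu (strict_at c (bar f) i)" "\<lambda>i. ordv (strict_at c (bar f) i)"
    by (rule curve_path_of_germ[OF irr v pass])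
  have x0: "ordv (strict_at c (bar f) 0) = ?d"
    by (auto simp: ordv_def top intro!: order_0_eqI)
  have sqd: "sq (Suc m) = ?d * ?d" using sq by (simp add: sq_def)
  have bounds: "Nu i \<le> ?d * Vu i" "Nv i \<le> ?d * Vv i" if "i \<le> Suc m" for i
  proof -
    \<comment> \<open>Stage \<open>Suc m\<close> is unmarked, so nothing is added to the square sum
      there, and by monotonicity \<open>d * d\<close> bounds \<open>sq'\<close> at all earlier
      stages.\<close>
    have "sq' i \<le> sq' (Suc m)" by (rule sq'_mono) (use that in auto)
    also have "\<dots> = ?d * ?d" using um sqd by (simp add: sq'_def del: umark.simps)
    finally show "Nu i \<le> ?d * Vu i" "Nv i \<le> ?d * Vv i" using expo_bounds[OF that] unfolding x0 by blast+
  qed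
  define F where "F = ?e (bar f)"
  have TF: "total_transform (?ps i) F = ?e (total_at c (bar f) i)" for i
    unfolding F_def by (rule total_transform_base_change[OF rhom_to_ac])
  have TV: "total_transform (?ps i) vvar = ?e (total_at c vvar i)" for i
    using total_transform_base_change[OF rhom_to_ac, of "points c i" vvar] by (simp add: base_change_vars[OF rhom_to_ac])
  define S where "S i = ?e (strict_at c (bar f) i)" for i
  have mF: "monomial_form (total_transform (?ps i) F) (Nu i, Nv i) (S i)" for i
    using monomial_form_base_change[OF rhom_to_ac monomial_form_total[OF F0, of c i]]
    by (simp only: TF S_def prod.collapse)
  have mV: "monomial_form (total_transform (?ps i) vvar) (Vu i, Vv i) 1" for i
    using monomial_form_base_change[OF rhom_to_ac monomial_form_vvar[of c i]]
    by (simp only: TV prod.collapse rhom_1[OF rhom_base_change[OF rhom_to_ac]])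
  have S0: "S i \<noteq> 0" for i
    using strict_transform_neq_0[OF F0] by (simp add: S_def map_poly_eq_0_iff)
  fix ss assume "ss \<in> points_above c m"
  then obtain j d where ss: "ss = ?ps j @ [d]" "j \<le> m" "j < m \<longrightarrow> d \<noteq> map_direction ?h (c j)"
    unfolding points_above_path by blast
  have member: "total_transform ss (pencil_member f l) = total_transform ss F - cst (?h l) * total_transform ss vvar ^ ?d" for l
    unfolding total_pencil_member[OF \<open>0 < ?d\<close>] F_def ..
  show "\<exists>H A. (\<forall>l. total_transform ss (pencil_member f l) = H * A l) \<and> (\<exists>l. at_origin (A l) \<noteq> 0)"
  proof (cases "d = map_direction ?h (c j)")
    case True
    then have "j = m" using ss by auto
    then have ss': "ss = ?ps (Suc m)" using ss True by simp
    have N: "Nu (Suc m) = 0" "Vu (Suc m) = 0"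
      using expo_unmarked[of "(0, 0)" c "Suc m"] expo_unmarked[of "(0, 1)" c "Suc m"] um by (simp_all del: expo.simps)
    have "Nv (Suc m) = ?d * ?d" using pairing_N[of "Suc m"] by (simp only: N xv sqd) simp
    then obtain U1 where U1: "total_transform ss F = U1 * vvar ^ (?d * ?d) * S (Suc m)"
      using mF[of "Suc m"] unfolding ss' N(1) monomial_form_def by auto
    have "Vv (Suc m) = ?d" using pairing_V[of "Suc m"] by (simp only: N xv x0) simp
    then obtain U2 where U2: "at_origin U2 \<noteq> 0" "total_transform ss vvar = U2 * vvar ^ ?d"
      using mV[of "Suc m"] unfolding ss' N(2) monomial_form_def by auto
    have "total_transform ss (pencil_member f l) = vvar ^ (?d * ?d) * (U1 * S (Suc m) - cst (?h l) * U2 ^ ?d)" for l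
      unfolding member U1 U2(2) by (simp add: algebra_simps power_mult_distrib flip: power_mult)
    moreover have "at_origin (S (Suc m)) = 0"
      using pass[of "Suc m"] by (simp only: S_def at_origin_base_change[OF rhom_to_ac] to_ac_0)
    then have "at_origin (U1 * S (Suc m) - cst (?h 1) * U2 ^ ?d) \<noteq> 0"
      using U2(1) by (simp add: rhom_simps[OF rhom_at_origin])
    ultimately show ?thesis
      by (intro exI[of _ "vvar ^ (?d * ?d)"] exI[of _ "\<lambda>l. U1 * S (Suc m) - cst (?h l) * U2 ^ ?d"]) blast
  next
    case False
    have st: "at_origin (strict_step (c j) (strict_at c (bar f) j)) = 0" using pass[of "Suc j"] by simp
    have u: "at_origin (strict_step d (S j)) \<noteq> 0"
      by (rule other_direction_nonzero[OF irreducible_strict_transform[OF irr pass] st rhom_to_ac S_def False])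
    define ab where "ab = expo_step d (?E j) (Nu j, Nv j)"
    define pq where "pq = expo_step d 0 (Vu j, Vv j)"
    have mS: "mult_origin (S j) = ?E j" by (simp add: S_def mult_origin_base_change[OF rhom_to_ac])
    have "monomial_form (total_transform ss F) ab (strict_step d (S j))"
      using monomial_form_step[OF mF[of j] S0[of j], of d] by (simp add: ss(1) ab_def mS)
    from monomial_form_unit[OF this u] obtain U1 where
      U1: "at_origin U1 \<noteq> 0" "total_transform ss F = U1 * (uvar ^ fst ab * vvar ^ snd ab)"
      by (auto simp: monomial_form_def mult.assoc)
    have "monomial_form (total_transform ss vvar) pq 1"
      using monomial_form_step_1[OF mV[of j], of d] by (simp add: ss(1) pq_def)
    then obtain U2 where U2: "total_transform ss vvar = U2 * uvar ^ fst pq * vvar ^ snd pq"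
      by (auto simp: monomial_form_def)
    \<comment> \<open>These are orders along the exceptional curve created at stage
      \<open>j\<close>, which are the same at all its points. The bound known at the point of
      direction \<open>c j\<close> therefore holds at the point of direction
      \<open>d\<close>.\<close>
    have "Nu j + Nv j + ?E j \<le> ?d * (Vu j + Vv j)"
    proof -
      obtain a b where N: "expo c ?E (0, 0) j = (a, b)" by (rule prod.exhaust)
      obtain p q where V: "expo c (\<lambda>_. 0) (0, 1) j = (p, q)" by (rule prod.exhaust)
      have "fst (expo_step (c j) (?E j) (a, b)) \<le> ?d * fst (expo_step (c j) 0 (p, q))"
        "snd (expo_step (c j) (?E j) (a, b)) \<le> ?d * snd (expo_step (c j) 0 (p, q))"
        using bounds[of "Suc j"] ss(2) N V by simp_all
      then show ?thesis unfolding N V by (cases "c j") auto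
    qed
    then have le: "fst ab \<le> ?d * fst pq" "snd ab \<le> ?d * snd pq"
      using expo_step_bound[OF bounds[of j]] ss(2) unfolding ab_def pq_def by auto
    define R where "R = U2 ^ ?d * uvar ^ (?d * fst pq - fst ab) * vvar ^ (?d * snd pq - snd ab)"
    have "total_transform ss vvar ^ ?d = U2 ^ ?d * uvar ^ (?d * fst pq) * vvar ^ (?d * snd pq)"
      unfolding U2 by (simp add: power_mult_distrib mult.commute[of ?d] flip: power_mult)
    also have "\<dots> = (uvar ^ fst ab * vvar ^ snd ab) * R"
    proof -
      have "uvar ^ (?d * fst pq) = (uvar ^ fst ab * uvar ^ (?d * fst pq - fst ab) :: 'a alg_closure poly poly)"
        "vvar ^ (?d * snd pq) = (vvar ^ snd ab * vvar ^ (?d * snd pq - snd ab) :: 'a alg_closure poly poly)"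
        using le by (simp_all flip: power_add)
      then show ?thesis unfolding R_def by (simp only: mult_ac)
    qed
    finally have V: "total_transform ss vvar ^ ?d = (uvar ^ fst ab * vvar ^ snd ab) * R" .
    have "total_transform ss (pencil_member f l) = (uvar ^ fst ab * vvar ^ snd ab) * (U1 - cst (?h l) * R)" for l
      unfolding member U1(2) V by (simp add: algebra_simps)
    moreover have "at_origin (U1 - cst (?h 0) * R) \<noteq> 0" using U1(1) by simp
    ultimately show ?thesis
      by (intro exI[of _ "uvar ^ fst ab * vvar ^ snd ab"] exI[of _ "\<lambda>l. U1 - cst (?h l) * R"]) blast
  qed
qed

section \<open>Comparison of the divisorial valuation with the valuation of the curve\<close>

context place_at_infinity
begin

lemma irregular_mult: "\<not> regular h \<Longrightarrow> \<not> regular (h * k)"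
proof
  assume h: "\<not> regular h" and hk: "regular (h * k)"
  have "W (bar (h * k) * vvar ^ (tdeg h + tdeg k)) = W (bar h * bar k * vvar ^ tdeg (h * k))"
    by (simp only: bar_mult)
  then have "W (bar (h * k)) + enat ((tdeg h + tdeg k) * L) = \<infinity>"
    using h by (simp add: W_mult W_power[OF W_vvar] regular_def)
  then show False using hk by (auto simp: regular_def)
qed

lemma val_add_irregular:
  assumes "\<not> regular h" "regular k" shows "regular (h + k)" "val (h + k) = val k"
proof -
  obtain b where b: "W (bar k) = enat b" "val k = int b - int (tdeg k) * int L" using assms by (metis regularE)
  have "W (bar h * vvar ^ tdeg k) = \<infinity>" "W (bar k * vvar ^ tdeg h) = enat (b + tdeg h * L)"
    using assms(1) by (simp_all add: W_mult W_power[OF W_vvar] b regular_def)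
  then have S: "W (bar h * vvar ^ tdeg k + bar k * vvar ^ tdeg h) = enat (b + tdeg h * L)"
    using W_add_strict[of "bar k * vvar ^ tdeg h" "bar h * vvar ^ tdeg k"] by (simp add: add.commute)
  have "W (bar (h + k) * vvar ^ (tdeg h + tdeg k)) =
      W ((bar h * vvar ^ tdeg k + bar k * vvar ^ tdeg h) * vvar ^ tdeg (h + k))"
    by (simp only: bar_add)
  then have eq: "W (bar (h + k)) + enat ((tdeg h + tdeg k) * L) = enat (b + tdeg h * L + tdeg (h + k) * L)"
    by (simp only: W_mult W_power[OF W_vvar] S plus_enat_simps)
  then obtain m where m: "W (bar (h + k)) = enat m" by (cases "W (bar (h + k))") auto
  have "m + (tdeg h + tdeg k) * L = b + tdeg h * L + tdeg (h + k) * L" using eq by (simp add: m)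
  then have "int (m + (tdeg h + tdeg k) * L) = int (b + tdeg h * L + tdeg (h + k) * L)" by simp
  then show "regular (h + k)" "val (h + k) = val k"
    using val_eqI[OF m] b by (simp_all add: algebra_simps)
qed

end

text \<open>Both coordinates have value at least 1, so each power of the maximal ideal has value at
  least its exponent.\<close>

lemma (in centered_valuation) mult_origin_le_W:
  assumes "T \<noteq> 0" shows "enat (mult_origin T) \<le> W T"
proof -
  have "enat 1 \<le> W uvar" "enat 1 \<le> W vvar"
    using W_u W_v by (cases "W uvar"; cases "W vvar"; simp add: zero_enat_def)+
  moreover have "cf T i j = 0" if "i + j < mult_origin T" for i j
    using mult_origin_le[of T i j] that by auto
  ultimately have "enat (mult_origin T * 1) \<le> W T" by (rule W_order_ge)
  then show ?thesis by simp
qed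

lemma cf_total_step_Inf: "cf (total_step Inf P) i j = (if j \<le> i then cf P (i - j) j else 0)"
  by (simp add: total_step_Inf cf_swap cf_total_step_0)

lemma cf_total_Inf:
  "(\<And>i. i < n \<Longrightarrow> c i = Inf) \<Longrightarrow> cf (total_at c P n) i j = (if n * j \<le> i then cf P (i - n * j) j else 0)"
proof (induction n arbitrary: i)
  case (Suc n)
  then have "c n = Inf" by simp
  then have "cf (total_at c P (Suc n)) i j = (if j \<le> i then cf (total_at c P n) (i - j) j else 0)"
    by (simp add: cf_total_step_Inf)
  also have "\<dots> = (if Suc n * j \<le> i then cf P (i - Suc n * j) j else 0)"
  proof (cases "j \<le> i")
    case True
    then have "n * j \<le> i - j \<longleftrightarrow> Suc n * j \<le> i" "i - j - n * j = i - Suc n * j" by auto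
    then show ?thesis using True Suc by (simp only: if_True less_SucI)
  qed simp
  finally show ?case .
qed simp

text \<open>With all directions equal to \<open>Inf\<close> the valuation is monomial, with weights
  1 for \<open>u\<close> and \<open>n + 1\<close> for \<open>v\<close>, so \<open>x\<close> and
  \<open>y\<close> have the values \<open>-(n + 1)\<close> and \<open>-n\<close>. This disposes of
  the case in which a point that is no satellite may still be marked.\<close>

lemma monomial_valuation_nonpos:
  fixes h :: "'a::field poly poly"
  assumes c: "\<And>i. i < n \<Longrightarrow> c i = Inf" and h: "h \<noteq> 0"
  shows "divisorial_valuation (points c n) (affine_function h) \<le> 0"
proof -
  obtain b a where ab: "cf h b a \<noteq> 0" using h by (metis coeff_0 poly_eqI)
  then have t: "a + b \<le> tdeg h" by (rule tdeg_ge)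
  define k where "k = tdeg h - a - b"
  have "cf (bar h) b k \<noteq> 0" using ab t by (simp add: cf_bar k_def)
  then have "cf (total_at c (bar h) n) (b + n * k) k \<noteq> 0" using cf_total_Inf[OF c, of n] by simp
  then have m: "mult_origin (total_at c (bar h) n) \<le> b + n * k + k" by (rule mult_origin_le)
  have v: "cf vvar i j = (if i = 0 \<and> j = 1 then 1 else (0::'a))" for i j
    using cf_monomial[of "1::'a" 0 1 i j] by simp
  have "mult_origin (total_at c (vvar :: 'a poly poly) n) = n + 1"
    by (rule mult_originI) (auto simp: cf_total_Inf[OF c] v split: if_splits)
  moreover have "b + n * k + k \<le> tdeg h * (n + 1)"
  proof -
    have "b + n * k + k = b + k * (n + 1)" by simp
    also have "\<dots> \<le> (b + k) * (n + 1)" by simp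
    also have "\<dots> \<le> tdeg h * (n + 1)" using t by (intro mult_right_mono) (auto simp: k_def)
    finally show ?thesis .
  qed
  ultimately have "int (mult_origin (total_at c (bar h) n)) \<le> int (tdeg h * mult_origin (total_at c (vvar :: 'a poly poly) n))"
    using m by (simp only: of_nat_le_iff)
  then show ?thesis using h by (simp add: divisorial_valuation_affine)
qed

section \<open>The curve together with its approximates\<close>

lemma points_cong: "(\<And>i. i < j \<Longrightarrow> c' i = c i) \<Longrightarrow> points c' j = points c j"
  by (induction j) simp_all

lemma expo_cong: "(\<And>i. i < j \<Longrightarrow> c' i = c i \<and> k' i = k i) \<Longrightarrow> expo c' k' ab j = expo c k ab j"
  by (induction j) simp_all

text \<open>Stage \<open>n\<close> is the last center of the valuation; stage \<open>Suc n\<close>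
  is the point where the curve crosses the last exceptional curve, away from all others.\<close>

locale approximated_curve = approximates W L g \<delta> q
  for W :: "'a::field poly poly \<Rightarrow> enat" and L g \<delta> q +
  fixes f :: "'a poly poly" and c :: "nat \<Rightarrow> 'a direction" and n :: nat
  assumes irr: "irreducible (germ (bar f))"
    and top: "restr_v (bar f) = monom 1 (tdeg f)"
    and pass: "at_origin (strict_at c (bar f) i) = 0"
    and f_monic: "lead_coeff f = 1" and f_degree: "degree f = tdeg f"
    and W_f: "W (bar f) = \<infinity>"
    and unmarked: "\<not> umark c (Suc n)"
    and transv: "transversal (strict_at c (bar f) (Suc n)) vvar"
    and g_pos: "0 < g"
    and q_0: "q 0 = xvar" and q_1: "q 1 = yvar"
    and q_tdeg: "1 < i \<Longrightarrow> i \<le> g \<Longrightarrow> degree (q i) = tdeg (q i)"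
    and q_curvette: "1 < i \<Longrightarrow> i \<le> g \<Longrightarrow>
      curvette (bar f) c (if (\<delta> 0 - \<delta> 1) dvd \<delta> 0 then i - 1 else i) (bar (q i))"
    and g_num: "g = num_characteristic_pairs (bar f) c + (if (\<delta> 0 - \<delta> 1) dvd \<delta> 0 then 1 else 0)"
begin

abbreviation "d \<equiv> tdeg f"
abbreviation "e \<equiv> mult_at c (bar f)"
abbreviation "xu \<equiv> \<lambda>i. ordu (strict_at c (bar f) i)"
abbreviation "xv \<equiv> \<lambda>i. ordv (strict_at c (bar f) i)"

lemma path: "curve_path c N e xu xv"
  by (rule curve_path_of_germ[OF irr _ pass]) (simp add: top)

sublocale curve_path c "Suc n" e xu xv by (rule path)

lemma xv_0: "xv 0 = d"
  by (auto simp: ordv_def top intro!: order_0_eqI)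

lemma d_pos: "0 < d"
  using xv_pos[of 0] xv_0 by simp

lemma xv_N: "xv (Suc n) = 1"
  using transversal_orders(1)[OF transv] by simp

lemma c_n: "c n \<noteq> Inf"
  using unmarked by auto

lemma V_N: "Vu (Suc n) = 0" "Vv (Suc n) = d" and N_N: "Nu (Suc n) = 0" "Nv (Suc n) = sq (Suc n)"
proof -
  show V: "Vu (Suc n) = 0" and N: "Nu (Suc n) = 0"
    using expo_unmarked[of "(0, 1)" c "Suc n"] expo_unmarked[of "(0, 0)" c "Suc n"] unmarked by (simp_all del: expo.simps)
  show "Vv (Suc n) = d" using pairing_V[of "Suc n"] by (simp only: V xv_N xv_0) simp
  show "Nv (Suc n) = sq (Suc n)" using pairing_N[of "Suc n"] by (simp only: N xv_N) simp
qed

lemma bar_f_neq_0: "bar f \<noteq> 0"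
proof -
  have "germ (bar f) \<noteq> 0" using irr unfolding irreducible_def by blast
  then show ?thesis by simp
qed

text \<open>The multiplicity of a total transform at the last center is its order along the
  exceptional curve created there, which is the axis \<open>v = 0\<close> at stage
  \<open>Suc n\<close>.\<close>

lemma mult_total:
  "mult_origin (total_at c vvar n) = d" "mult_origin (total_at c (bar f) n) = sq (Suc n)"
proof -
  obtain z where z: "c n = Fin z" using c_n by (cases "c n") auto
  have "mult_origin (total_at c vvar n) = Vu n + Vv n"
    using mult_origin_monomial_form[OF monomial_form_vvar[of c n]] by simp
  also have "\<dots> = Vv (Suc n)" using z by (cases "expo c (\<lambda>_. 0) (0, 1) n") simp
  finally show "mult_origin (total_at c vvar n) = d" by (simp only: V_N)
  have "mult_origin (total_at c (bar f) n) = Nu n + Nv n + e n"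
    by (rule mult_origin_monomial_form[OF monomial_form_total strict_transform_neq_0]) (rule bar_f_neq_0)+
  also have "\<dots> = Nv (Suc n)" using z by (cases "expo c e (0, 0) n") simp
  finally show "mult_origin (total_at c (bar f) n) = sq (Suc n)" by (simp only: N_N)
qed

text \<open>Values along the path are \<open>k\<close> times intersection numbers, and in particular
  \<open>L = k * d\<close>. Since \<open>f\<close> has infinite value and degree \<open>d\<close> in
  \<open>y\<close>, \<open>value_nonpos\<close> excludes \<open>d < L\<close>, so
  \<open>k = 1\<close>.\<close>

lemma L_eq: "L = d" and valuations:
  "\<exists>Ws. (\<forall>i. centered_valuation (Ws i)) \<and> (\<forall>i P. Ws i (total_at c P i) = W P) \<and> (\<forall>i P. Ws (Suc i) (total_step (c i) P) = Ws i P) \<and>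
    Ws 0 = W \<and> (\<forall>i\<le>Suc n. Ws i vvar = enat (xv i) \<and> (i < Suc n \<longrightarrow> c i = Inf \<longrightarrow> Ws i uvar = enat (e i)))"
proof -
  obtain Ws where Ws: "\<And>i. centered_valuation (Ws i)" "Ws 0 = W" "\<And>i P. Ws (Suc i) (total_step (c i) P) = Ws i P"
    "\<And>i P. Ws i (total_at c P i) = W P" "\<And>i. Ws i uvar \<noteq> \<infinity> \<or> Ws i vvar \<noteq> \<infinity>"
    by (rule valuation_sequence[OF centered_valuation_axioms irr pass W_f]) (auto simp: W_vvar)
  interpret WN: centered_valuation "Ws (Suc n)" by (rule Ws)
  have "monomial_form (total_at c vvar (Suc n)) (Vu (Suc n), Vv (Suc n)) 1"
    using monomial_form_vvar[of c "Suc n"] by (simp only: prod.collapse)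
  from WN.W_monomial_form[OF this] have L1: "enat L = of_nat d * Ws (Suc n) vvar"
    unfolding Ws(4) W_vvar V_N by simp
  obtain k where k: "Ws (Suc n) vvar = enat k"
  proof (cases "Ws (Suc n) vvar")
    case infinity then show ?thesis using L1 d_pos by (simp add: of_nat_eq_enat)
  qed
  have kpos: "0 < k" using WN.W_v k by (simp add: zero_enat_def)
  have ax: "Ws i vvar = enat (k * xv i) \<and> (umark c i \<longrightarrow> Ws i uvar = enat (k * xu i)) \<and>
    (i < Suc n \<longrightarrow> c i = Inf \<longrightarrow> Ws i uvar = enat (k * e i))" if "i \<le> Suc n" for i
    by (rule values_of_axes[OF path Ws(1) Ws(3) unmarked xv_N k that])
  have Lk: "L = k * d" using ax[of 0] W_vvar by (simp only: Ws(2) xv_0) auto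
  have "\<not> regular f" by (simp add: regular_def W_f)
  moreover have "f \<noteq> 0" using f_monic by auto
  ultimately have "\<not> d < L" using value_nonpos(1)[of f] f_degree by auto
  then have "k = 1" using Lk kpos d_pos by (cases k) auto
  then show "L = d" using Lk by simp
  show "\<exists>Ws. (\<forall>i. centered_valuation (Ws i)) \<and> (\<forall>i P. Ws i (total_at c P i) = W P) \<and> (\<forall>i P. Ws (Suc i) (total_step (c i) P) = Ws i P) \<and>
    Ws 0 = W \<and> (\<forall>i\<le>Suc n. Ws i vvar = enat (xv i) \<and> (i < Suc n \<longrightarrow> c i = Inf \<longrightarrow> Ws i uvar = enat (e i)))"
    using Ws ax \<open>k = 1\<close> by (intro exI[of _ Ws]) simp
qed

abbreviation "\<nu> h \<equiv> divisorial_valuation (points c n) (affine_function h)"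

lemma \<nu>_f: "\<nu> f = int (sq (Suc n)) - int (d * d)"
  using bar_f_neq_0 by (simp add: divisorial_valuation_affine mult_total)

lemma \<nu>_le_val:
  assumes "regular h" "h \<noteq> 0" shows "\<nu> h \<le> val h"
proof -
  obtain Ws where Ws: "\<And>i. centered_valuation (Ws i)" "\<And>i P. Ws i (total_at c P i) = W P"
    using valuations by blast
  interpret Wn: centered_valuation "Ws n" by (rule Ws)
  obtain k where k: "W (bar h) = enat k" "val h = int k - int (tdeg h) * int L" using assms(1) by (rule regularE)
  have "enat (mult_origin (total_at c (bar h) n)) \<le> Ws n (total_at c (bar h) n)"
    by (rule Wn.mult_origin_le_W) (simp add: assms(2))
  then have "mult_origin (total_at c (bar h) n) \<le> k" by (simp add: Ws k)
  moreover have "\<nu> h = int (mult_origin (total_at c (bar h) n)) - int (tdeg h) * int L"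
    by (simp only: divisorial_valuation_affine[OF assms(2)] mult_total L_eq)
  ultimately show ?thesis unfolding k(2) by simp
qed

text \<open>A nonzero remainder modulo \<open>f\<close> has the same value on the curve as
  \<open>h\<close>, because multiples of \<open>f\<close> have infinite value there; an exact
  multiple of \<open>f\<close> is handled by induction on the degree.\<close>

lemma \<nu>_nonpos:
  assumes "sq (Suc n) \<le> d * d" "h \<noteq> 0" shows "\<nu> h \<le> 0"
  using assms(2)
proof (induction "degree h" arbitrary: h rule: less_induct)
  case less
  have f0: "f \<noteq> 0" using f_monic by auto
  have "int (sq (Suc n)) \<le> int (d * d)" using assms(1) by (simp only: of_nat_le_iff)
  then have f: "\<nu> f \<le> 0" by (simp add: \<nu>_f)
  obtain b r where br: "h = f * b + r" "r = 0 \<or> degree r < degree f"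
    using monic_division[OF f_monic] .
  show ?case
  proof (cases "r = 0")
    case True
    then have h: "h = f * b" and b: "b \<noteq> 0" using br less.prems by auto
    have "degree b < degree h" using h f0 b d_pos f_degree by (simp add: degree_mult_eq)
    then have "\<nu> b \<le> 0" using less.hyps b by blast
    then show ?thesis using f divisorial_valuation_mult[OF f0 b, of "points c n"] by (simp add: h)
  next
    case False
    then have r: "regular r" "val r \<le> 0" using value_nonpos[of r] br(2) f_degree L_eq by auto
    have "\<not> regular f" by (simp add: regular_def W_f)
    from irregular_mult[OF this] have "\<not> regular (f * b)" .
    from val_add_irregular[OF this r(1)] have "regular h" "val h = val r" by (simp_all add: br(1))
    then show ?thesis using \<nu>_le_val[of h] less.prems r(2) by simp
  qed
qed

text \<open>Once \<open>Q\<close> has separated from the curve, its total transform at an unmarked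
  point is a unit times a power of \<open>v\<close>, and \<open>v\<close> has value
  \<open>xv j\<close> there.\<close>

lemma value_multiple:
  assumes "i \<le> j" "j \<le> Suc n" "\<not> umark c j" "at_origin (strict_at c Q i) \<noteq> 0"
  shows "\<exists>b. W Q = enat (b * xv j)"
proof -
  obtain Ws where Ws: "\<And>i. centered_valuation (Ws i)" "\<And>i P. Ws i (total_at c P i) = W P"
    "\<forall>i\<le>Suc n. Ws i vvar = enat (xv i)" using valuations by blast
  interpret Wj: centered_valuation "Ws j" by (rule Ws)
  have Q: "Q \<noteq> 0"
  proof
    assume "Q = 0"
    have "strict_at c (0 :: 'a poly poly) i = 0" for i
      by (induction i) (simp_all add: strict_step_def rhom_0[OF rhom_total_step])
    then show False using assms(4) by (simp add: \<open>Q = 0\<close> rhom_0[OF rhom_at_origin])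
  qed
  obtain ts where "points c j = points c i @ ts" using points_split[OF assms(1)] by blast
  then have "at_origin (strict_at c Q j) \<noteq> 0"
    using strict_transform_unit[OF assms(4)] by (simp add: strict_transform_append)
  from monomial_form_unit[OF monomial_form_total[OF Q] this]
  have "monomial_form (total_at c Q j) (fst (expo c (mult_at c Q) (0, 0) j), snd (expo c (mult_at c Q) (0, 0) j)) 1"
    by (simp only: prod.collapse)
  moreover have "fst (expo c (mult_at c Q) (0, 0) j) = 0" by (rule expo_unmarked) (simp_all add: assms)
  ultimately have "monomial_form (total_at c Q j) (0, snd (expo c (mult_at c Q) (0, 0) j)) 1" by metis
  from Wj.W_monomial_form[OF this] have "W Q = enat (snd (expo c (mult_at c Q) (0, 0) j) * xv j)"
    using Ws(3) assms(2) by (simp add: Ws(2) of_nat_eq_enat flip: zero_enat_def)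
  then show ?thesis by blast
qed

lemma \<delta>_eq: "i \<le> g \<Longrightarrow> W (bar (q i)) = enat k \<Longrightarrow> \<delta> i = int (tdeg (q i)) * int d - int k"
  using q_val[of i] val_eqI[of "q i" k] by (simp add: L_eq)

text \<open>Positivity of \<open>\<delta> 1\<close> says that \<open>u\<close> has a smaller value
  than \<open>v\<close>, so the curve is tangent to the line at infinity.\<close>

lemma first_step: "c 0 = Inf" "\<delta> 1 = int d - int (e 0)"
proof -
  obtain Ws where Ws: "\<And>i. centered_valuation (Ws i)" "Ws 0 = W" "\<And>i P. Ws (Suc i) (total_step (c i) P) = Ws i P"
    "\<forall>i\<le>Suc n. Ws i vvar = enat (xv i) \<and> (i < Suc n \<longrightarrow> c i = Inf \<longrightarrow> Ws i uvar = enat (e i))"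
    using valuations by blast
  interpret W1: centered_valuation "Ws 1" by (rule Ws)
  have "regular (q 1)" using q_regular g_pos by simp
  then obtain k where k: "W uvar = enat k" unfolding regular_def q_1 bar_yvar by auto
  then have \<delta>1: "\<delta> 1 = int d - int k" using \<delta>_eq[of 1 k] g_pos by (simp add: q_1 del: One_nat_def)
  moreover have "0 < \<delta> 1" using seq g_pos by (simp add: delta_sequence_def)
  ultimately have kd: "k < d" by simp
  show "c 0 = Inf"
  proof (cases "c 0")
    case (Fin z)
    have "W uvar = Ws 1 vvar + Ws 1 (uvar + cst z)"
      using Ws(3)[of 0 uvar] W1.W_mult[of vvar "uvar + cst z"] by (simp add: Fin total_step_vars Ws(2))
    moreover have "W vvar = Ws 1 vvar" using Ws(3)[of 0 vvar] by (simp add: Fin total_step_vars Ws(2))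
    ultimately have "enat d \<le> enat k" using W_vvar k by (simp add: L_eq le_iff_add)
    then show ?thesis using kd by simp
  qed
  then show "\<delta> 1 = int d - int (e 0)" using Ws(2,4) k \<delta>1 by auto
qed

text \<open>The curvette continues through a point that is no satellite, the curve through a
  satellite point, so they separate at this stage.\<close>

lemma curvette_leaves:
  assumes "curvette_of (points c l) Q" "satellite (points c (Suc l))"
  obtains s where "irreducible (germ Q)" "transversal (strict_step s (strict_at c Q l)) (exceptional s)"
    "\<not> satellite (points c l @ [s])" "s \<noteq> c l" "at_origin (strict_at c Q (Suc l)) \<noteq> 0"
proof -
  obtain s where s: "irreducible (germ Q)" "transversal (strict_step s (strict_at c Q l)) (exceptional s)"
    "\<not> satellite (points c l @ [s])"
    using assms(1) by (auto simp: curvette_of_def analytically_irreducible_def)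
  have o: "at_origin (strict_step s (strict_at c Q l)) = 0" using s(2) by (simp add: transversal_def)
  then have o': "at_origin (strict_at c Q l) = 0" using strict_step_unit by blast
  have "s \<noteq> c l" using s(3) assms(2) by auto
  moreover have "at_origin (strict_step (c l) (strict_at c Q l)) \<noteq> 0"
    using direction_unique[OF irreducible_strict_transform[OF s(1) o'] o, of "c l"] calculation by auto
  ultimately show ?thesis using that s by simp
qed

section \<open>The last chain of satellite points and its contribution to the square sum\<close>

context
  fixes j
  assumes j: "0 < j" "j < Suc n" "\<not> umark c j" "c j = Inf"
    and last: "\<And>l. j < l \<Longrightarrow> Suc l \<le> Suc n \<Longrightarrow> umark c (Suc l) \<Longrightarrow> umark c l"
begin

lemma finite_step: "c (j - 1) \<noteq> Inf"
  using j by (cases j) auto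

lemma satellite_Suc_j: "satellite (points c (Suc j))"
  using satellite_iff[of c "Suc j"] finite_step j by auto

text \<open>By the assumption \<open>last\<close> no marked chain starts after the one at
  \<open>j\<close>. That \<open>j\<close> is counted at all requires the resolution to end later
  than stage \<open>Suc j\<close>; otherwise \<open>resolved_persists\<close> would exclude the
  satellite point there.\<close>

lemma last_free: "j \<in> last_free_points (bar f) c" "l \<in> last_free_points (bar f) c \<Longrightarrow> l \<le> j"
  and finite_last_free: "finite (last_free_points (bar f) c)"
proof -
  define R where "R = resolution_length (bar f) c"
  have res: "resolved_after (bar f) c (Suc n)" by (rule resolved_afterI[OF unmarked transv])
  then have RN: "R \<le> Suc n" unfolding R_def resolution_length_def by (rule Least_le)
  have resR: "resolved_after (bar f) c R" unfolding R_def resolution_length_def using res by (rule LeastI)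
  have lfp: "l \<in> last_free_points (bar f) c \<longleftrightarrow> Suc l < R \<and> \<not> satellite (points c l) \<and> satellite (points c (Suc l))" for l
    unfolding last_free_points_def R_def points_def[symmetric] by simp
  have jR: "Suc j < R"
  proof (rule ccontr)
    assume "\<not> Suc j < R"
    from resolved_persists[OF resolved_afterD(1)[OF resR], of "Suc j"] this j
    have "(\<forall>i<Suc j. c i = Inf) \<or> \<not> umark c (Suc j)" by auto
    then show False using finite_step j by auto
  qed
  then show "j \<in> last_free_points (bar f) c"
    unfolding lfp using satellite_iff[of c j] satellite_Suc_j j by auto
  show "finite (last_free_points (bar f) c)" by (rule finite_subset[of _ "{..<R}"]) (auto simp: lfp)
  show "l \<le> j" if "l \<in> last_free_points (bar f) c"
  proof (rule ccontr)
    assume "\<not> l \<le> j"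
    then have l: "j < l" by simp
    have L: "Suc l < R" "\<not> satellite (points c l)" "satellite (points c (Suc l))" using that lfp by auto
    have "umark c (Suc l)" using L(3) satellite_iff[of c "Suc l"] by blast
    then have "umark c l" using last[OF l] L(1) RN by simp
    moreover have "\<exists>i<l. c i \<noteq> Inf" using finite_step l by (intro exI[of _ "j - 1"]) auto
    ultimately show False using L(2) satellite_iff[of c l] by blast
  qed
qed

lemma curvette_index:
  assumes "curvette (bar f) c i Q"
  obtains l where "curvette_of (points c l) Q" "satellite (points c (Suc l))" "l \<le> j"
    "l = j \<longleftrightarrow> i = num_characteristic_pairs (bar f) c"
proof -
  let ?S = "last_free_points (bar f) c"
  obtain l where l: "l \<in> ?S" "card {l' \<in> ?S. l' \<le> l} = i" "curvette_of (points c l) Q"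
    using assms unfolding curvette_def points_def by auto
  have lj: "l \<le> j" by (rule last_free(2)[OF l(1)])
  have "satellite (points c (Suc l))" using l(1) unfolding last_free_points_def points_def by simp
  moreover have "l = j \<longleftrightarrow> i = num_characteristic_pairs (bar f) c"
  proof
    assume "l = j"
    then have "{l' \<in> ?S. l' \<le> l} = ?S" using last_free(2) by auto
    then show "i = num_characteristic_pairs (bar f) c" using l(2) by (simp add: num_characteristic_pairs_def)
  next
    assume "i = num_characteristic_pairs (bar f) c"
    then have "{l' \<in> ?S. l' \<le> l} = ?S"
      using l(2) by (intro card_subset_eq finite_last_free) (auto simp: num_characteristic_pairs_def)
    then have "j \<le> l" using last_free(1) by auto
    then show "l = j" using lj by simp
  qed
  ultimately show ?thesis using that l(3) lj by blast
qed

text \<open>All approximates before the last have left the curve by stage \<open>j\<close>, so their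
  homogenizations have values divisible by \<open>xv j\<close>; so does \<open>v\<close>, whose
  value is \<open>d\<close>.\<close>

lemma xv_dvd_dseq: assumes "1 < g" shows "int (xv j) dvd dseq \<delta> g"
  unfolding dseq_def
proof (rule Gcd_greatest)
  fix b assume "b \<in> \<delta> ` {..<g}"
  then obtain i where i: "i < g" "b = \<delta> i" by auto
  have Vd: "Vv j * xv j = d"
    using pairing_V[of j] expo_unmarked[of "(0, 1)" c j "\<lambda>_. 0"] j by (simp add: xv_0[simplified])
  have "\<exists>k. W (bar (q i)) = enat (k * xv j)"
  proof -
    consider "i = 0" | "i = 1" | "1 < i" by linarith
    then show ?thesis
    proof cases
      case 1 then show ?thesis by (intro exI[of _ 0]) (simp add: q_0 W_1 flip: zero_enat_def)
    next
      case 2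
      \<comment> \<open>The curve starts in the direction of \<open>v = 0\<close>, which the line
        \<open>u = 0\<close> does not share.\<close>
      have "strict_at c uvar 1 = (1 :: 'a poly poly)" unfolding One_nat_def points_Suc points_0 append_Nil strict_transform_snoc[of "[]", unfolded append_Nil]
        using first_step(1) by (simp add: strict_step_exceptionals)
      then have "at_origin (strict_at c uvar 1) \<noteq> (0 :: 'a)" by (simp add: rhom_1[OF rhom_at_origin] del: One_nat_def)
      then show ?thesis using value_multiple[of 1 j uvar] j 2 by (simp add: q_1 del: One_nat_def)
    next
      case 3
      then have "curvette (bar f) c (if (\<delta> 0 - \<delta> 1) dvd \<delta> 0 then i - 1 else i) (bar (q i))"
        using q_curvette i by simp
      then obtain l where l: "curvette_of (points c l) (bar (q i))" "satellite (points c (Suc l))" "l \<le> j"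
        "l = j \<longleftrightarrow> (if (\<delta> 0 - \<delta> 1) dvd \<delta> 0 then i - 1 else i) = num_characteristic_pairs (bar f) c"
        by (rule curvette_index)
      have "l \<noteq> j" using l(4) g_num i(1) 3 by (auto split: if_splits)
      then have "l < j" using l(3) by simp
      then show ?thesis using value_multiple[of "Suc l" j "bar (q i)"] curvette_leaves[OF l(1,2)] j by auto
    qed
  qed
  then obtain k where "W (bar (q i)) = enat (k * xv j)" by blast
  then have "\<delta> i = int (tdeg (q i)) * int d - int (k * xv j)" using \<delta>_eq[of i] i(1) by simp
  also have "\<dots> = int (xv j) * (int (tdeg (q i)) * int (Vv j) - int k)"
    by (simp add: Vd[symmetric] algebra_simps)
  finally show "int (xv j) dvd b" using i(2) by simp
qed

text \<open>\<open>A\<close> is the order of the last approximate along \<open>v = 0\<close> at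
  stage \<open>j\<close>. That approximate follows the curve up to \<open>j\<close> and meets the
  axis once there, so pairing the two germs in both orders yields the square sum. The strict bound
  expresses that \<open>\<delta> g\<close> is positive.\<close>

lemma last_approximate:
  assumes "1 < g"
  obtains A where "sq j = A * xv j * xv j" "A * xv j + e j < tdeg (q g) * d"
proof -
  define Q where "Q = bar (q g)"
  have "curvette (bar f) c (if (\<delta> 0 - \<delta> 1) dvd \<delta> 0 then g - 1 else g) Q"
    unfolding Q_def using q_curvette assms by simp
  then obtain l where l: "curvette_of (points c l) Q" "satellite (points c (Suc l))" "l \<le> j"
    "l = j \<longleftrightarrow> (if (\<delta> 0 - \<delta> 1) dvd \<delta> 0 then g - 1 else g) = num_characteristic_pairs (bar f) c"
    by (rule curvette_index)
  have "l = j" using l(4) g_num by (auto split: if_splits)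
  with l obtain s where s: "irreducible (germ Q)" "transversal (strict_step s (strict_at c Q j)) (exceptional s)" "s \<noteq> c j"
    using curvette_leaves[of l Q] by metis
  obtain z where z: "s = Fin z" using s(3) j by (cases s) auto
  \<comment> \<open>The path of the approximate up to stage \<open>Suc j\<close>: only its last
    direction differs from that of the curve.\<close>
  define c' where "c' = c(j := s)"
  have pc: "points c' i = points c i" if "i \<le> j" for i
    by (rule points_cong) (use that in \<open>auto simp: c'_def\<close>)
  have Sj: "strict_at c' Q (Suc j) = strict_step s (strict_at c Q j)" unfolding points_Suc strict_transform_snoc using pc[of j] by (simp add: c'_def)
  have tr: "transversal (strict_at c' Q (Suc j)) vvar" using s(2) unfolding Sj by (simp add: z)
  have "coeff (coeff Q (tdeg (q g))) 0 = 1"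
    using q_monic[of g] q_tdeg[of g] assms by (simp add: Q_def cf_bar)
  then have "coeff (restr_v Q) (tdeg (q g)) \<noteq> 0" by (simp add: coeff_restr_v)
  then have rQ: "restr_v Q \<noteq> 0" by auto
  interpret Q: curve_path c' "Suc j" "mult_at c' Q" "\<lambda>i. ordu (strict_at c' Q i)" "\<lambda>i. ordv (strict_at c' Q i)"
    by (rule curve_path_of_germ[OF s(1) rQ]) (use tr in \<open>simp add: transversal_def\<close>)
  have xQ: "ordv (strict_at c' Q j) = 1"
    using Q.Fin_step[of j z] transversal_orders(1)[OF tr] by (simp add: c'_def z)
  define A where "A = snd (expo c (mult_at c Q) (0, 0) j)"
  have A0: "fst (expo c (mult_at c Q) (0, 0) j) = 0" by (rule expo_unmarked) (simp_all add: j)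
  have mQ: "mult_at c' Q i = mult_at c Q i" if "i \<le> j" for i using pc[OF that] by simp
  \<comment> \<open>The same sum of products of multiplicities is computed twice: here from the
    orders of the approximate against the curve, below from the orders of the curve against the
    approximate.\<close>
  have pairF: "A * xv j = (\<Sum>i<j. mult_at c Q i * e i)"
    using pairing[of "(0, 0)" j "mult_at c Q"] j A0 by (simp add: A_def)
  have N0: "Nu j = 0" by (rule expo_unmarked) (simp_all add: j)
  have "expo c' e (0, 0) j = expo c e (0, 0) j" by (rule expo_cong) (auto simp: c'_def)
  then have "Nv j = (\<Sum>i<j. e i * mult_at c' Q i)"
    using Q.pairing[of "(0, 0)" j e] N0 xQ by simp
  also have "\<dots> = A * xv j" unfolding pairF by (intro sum.cong refl) (simp add: mQ)
  finally have "Nv j = A * xv j" .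
  then have sqj: "sq j = A * xv j * xv j" using pairing_N[of j] j N0 by simp
  obtain Ws where Ws: "\<And>i. centered_valuation (Ws i)" "\<And>i P. Ws i (total_at c P i) = W P"
    "\<forall>i\<le>Suc n. Ws i vvar = enat (xv i) \<and> (i < Suc n \<longrightarrow> c i = Inf \<longrightarrow> Ws i uvar = enat (e i))"
    using valuations by blast
  interpret Wj: centered_valuation "Ws j" by (rule Ws)
  let ?S = "strict_at c Q j"
  have Q0: "Q \<noteq> 0" using rQ by (auto simp: rhom_0[OF rhom_restr_v])
  obtain U where U: "total_at c Q j = U * uvar ^ fst (expo c (mult_at c Q) (0, 0) j) * vvar ^ A * ?S"
    using monomial_form_total[OF Q0, of c j] by (auto simp: monomial_form_def A_def)
  have vj: "Ws j vvar = enat (xv j)" and uj: "Ws j uvar = enat (e j)" using Ws(3) j by auto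
  have "at_origin ?S = 0" using strict_step_unit[of ?S s] s(2) by (auto simp: transversal_def)
  have exv: "e j \<le> xv j" using Inf_step[of j] j by simp
  \<comment> \<open>The next direction is \<open>Inf\<close>, so \<open>u\<close> has value
    \<open>e j\<close>, no more than that of \<open>v\<close>; this bounds the value of any function
    vanishing at the point.\<close>
  have "enat (1 * e j) \<le> Ws j ?S"
    by (rule Wj.W_order_ge) (use uj vj exv \<open>at_origin ?S = 0\<close> in \<open>auto simp: at_origin_def\<close>)
  moreover have "Ws j (vvar ^ A) = enat (A * xv j)" by (rule Wj.W_power[OF vj])
  ultimately have "enat (A * xv j + e j) \<le> Ws j (vvar ^ A) + Ws j ?S"
    by (metis add_left_mono mult_1 plus_enat_simps(1))
  also have "\<dots> \<le> Ws j (total_at c Q j)" unfolding U A0 by (simp add: Wj.W_mult add.assoc)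
  finally have "enat (A * xv j + e j) \<le> W Q" by (simp add: Ws(2))
  moreover obtain k where k: "W Q = enat k" using q_regular[of g] by (auto simp: Q_def regular_def)
  ultimately have "A * xv j + e j \<le> k" by simp
  moreover have "0 < \<delta> g" using seq by (simp add: delta_sequence_def)
  then have "int k < int (tdeg (q g) * d)" using \<delta>_eq[of g k] k by (simp add: Q_def)
  then have "k < tdeg (q g) * d" by (simp only: of_nat_less_iff)
  ultimately show ?thesis using that[OF sqj] by simp
qed

text \<open>The left side is \<open>(A * xv j + e j) * xv j\<close>. Its first factor is below
  \<open>tdeg (q g) * d\<close>, and \<open>xv j\<close> divides \<open>dseq \<delta> g\<close>,
  which is \<open>d\<close> divided by \<open>tdeg (q g)\<close>.\<close>

lemma block_bound: "sq j + e j * xv j \<le> d * d"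
proof (cases "g = 1")
  \<comment> \<open>For \<open>g = 1\<close> no such \<open>j\<close> exists:
    \<open>\<delta> 0\<close> and \<open>\<delta> 1\<close> are coprime, so after the first chain
    the curve meets the exceptional curve once and no marked point can follow.\<close>
  case True
  then have "dseq \<delta> (Suc 1) = 1" using seq by (simp add: delta_sequence_def)
  then have "gcd (dseq \<delta> 1) (\<delta> 1) = 1" by (simp only: dseq_Suc)
  then have "gcd (int d) (int d - int (e 0)) = 1"
    using dseq_1[of \<delta>] L L_eq first_step(2) by simp
  then have "coprime (int d) (int (e 0))"
    by (metis coprime_iff_gcd_eq_1 diff_diff_eq2 diff_add_cancel gcd_diff2 gcd.commute add_diff_cancel_left')
  then have "coprime (e 0) (xv 0)" unfolding xv_0 by (simp add: coprime_commute)
  from coprime_persists[OF first_step(1) this j(1)] j have "xv j = 1" by simp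
  from smooth_persists[OF j(3) this, of "Suc j"] j have "\<not> umark c (Suc j)" by simp
  then show ?thesis using j by simp
next
  case False
  then have g: "1 < g" using g_pos by simp
  obtain A where A: "sq j = A * xv j * xv j" "A * xv j + e j < tdeg (q g) * d"
    by (rule last_approximate[OF g])
  have "int (xv j) \<le> dseq \<delta> g" using zdvd_imp_le[OF xv_dvd_dseq[OF g] dseq_pos] g by simp
  moreover have "int (tdeg (q g)) * dseq \<delta> g = int d"
    using q_degree[of g] q_tdeg[of g] g dseq_dvd[of 0 g] L L_eq by simp
  ultimately have "int (tdeg (q g)) * int (xv j) \<le> int d"
    by (metis mult_left_mono of_nat_0_le_iff)
  then have D: "tdeg (q g) * xv j \<le> d" by (metis of_nat_le_iff of_nat_mult)
  have "sq j + e j * xv j = (A * xv j + e j) * xv j" by (simp add: A(1) algebra_simps)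
  also have "\<dots> \<le> (tdeg (q g) * d) * xv j" using A(2) by (intro mult_right_mono) auto
  also have "\<dots> = (tdeg (q g) * xv j) * d" by simp
  also have "\<dots> \<le> d * d" using D by (rule mult_right_mono) simp
  finally show ?thesis .
qed

end

text \<open>\<open>r\<close> is the last marked stage and \<open>j\<close> the unmarked stage from
  which its chain starts. The square sum through this chain is at most \<open>d * d\<close>, and the
  unit steps after it reach \<open>d * d\<close> exactly.\<close>

lemma eliminates_before:
  assumes "d * d < sq (Suc n)"
  shows "\<exists>M<n. eliminates_base_points f c M"
proof -
  define r where "r = Max {i. i \<le> Suc n \<and> umark c i}"
  have fin: "finite {i. i \<le> Suc n \<and> umark c i}" by simp
  have 1: "1 \<in> {i. i \<le> Suc n \<and> umark c i}" using first_step(1) by simp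
  have r: "r \<le> Suc n" "umark c r" using Max_in[OF fin] 1 unfolding r_def by blast+
  have after: "\<not> umark c i" if "r < i" "i \<le> Suc n" for i
    by (metis (mono_tags, lifting) Max_ge fin mem_Collect_eq not_le r_def that)
  have "r \<noteq> Suc n" using r(2) unmarked by metis
  then have rn: "r < Suc n" using r(1) by simp
  define j where "j = Max {i. i < r \<and> \<not> umark c i}"
  have fin': "finite {i. i < r \<and> \<not> umark c i}" by simp
  have "0 < r" using r(2) by (cases r) auto
  then have "0 \<in> {i. i < r \<and> \<not> umark c i}" by simp
  then have "j \<in> {i. i < r \<and> \<not> umark c i}" unfolding j_def by (intro Max_in fin') blast
  then have j: "j < r" "\<not> umark c j" by auto
  have between: "umark c i" if "j < i" "i \<le> r" for i
  proof (cases "i = r")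
    case False
    show ?thesis
    proof (rule ccontr)
      assume "\<not> umark c i"
      then have "i \<in> {i. i < r \<and> \<not> umark c i}" using that False by simp
      then have "i \<le> j" unfolding j_def by (rule Max_ge[OF fin'])
      then show False using that by simp
    qed
  qed (use r in simp)
  have cj: "c j = Inf" using between[of "Suc j"] j by auto
  have chain: "sq (Suc r) = sq j + e j * xv j"
    by (rule chain_sum) (use j rn between after[of "Suc r"] in auto)
  have "sq (Suc r) \<le> d * d"
  proof (cases "j = 0")
    \<comment> \<open>For a chain starting at the first point the sum is \<open>e 0 * d\<close>, and
      \<open>e 0\<close> is at most \<open>d\<close>.\<close>
    case True
    then show ?thesis using chain Inf_step[of 0] first_step(1) xv_0 by simp
  next
    case False
    have "sq j + e j * xv j \<le> d * d"
    proof (rule block_bound)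
      fix l assume l: "j < l" "Suc l \<le> Suc n" "umark c (Suc l)"
      then have "Suc l \<le> r" using after[of "Suc l"] by linarith
      then show "umark c l" using between[of l] l(1) by simp
    qed (use False j rn cj in auto)
    then show ?thesis by (simp add: chain)
  qed
  then obtain k where k: "r < k" "k < Suc n" "sq k = d * d"
    using exists_square_sum[OF xv_N after rn _ assms] by blast
  obtain M where M: "k = Suc M" using k(1) by (cases k) auto
  have um: "\<not> umark c (Suc M)" using after[of k] k M by simp
  have "e M = 1" by (rule smooth_tail[of r]) (use xv_N after k M in auto)
  then have "xv (Suc M) = 1" using unmarked_step(2)[of M] um k M by simp
  moreover have "(\<Sum>i<Suc M. e i * e i) = d * d" using k(3) unfolding M sq_def .
  ultimately have "eliminates_base_points f c M"
    using eliminates_at_square[OF irr top pass um] d_pos by blast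
  then show ?thesis using k M by auto
qed

end

section \<open>Generated semigroups and well-orders on sets of integers\<close>

lemma generated_add: "a \<in> generated \<delta> n \<Longrightarrow> b \<in> generated \<delta> n \<Longrightarrow> a + b \<in> generated \<delta> n"
proof -
  assume "a \<in> generated \<delta> n" "b \<in> generated \<delta> n"
  then obtain a' b' where "a = (\<Sum>j<n. int (a' j) * \<delta> j)" "b = (\<Sum>j<n. int (b' j) * \<delta> j)"
    by (auto simp: generated_def)
  then have "a + b = (\<Sum>j<n. int (a' j + b' j) * \<delta> j)" by (simp add: sum.distrib distrib_right)
  then show ?thesis unfolding generated_def by (intro CollectI exI[of _ "\<lambda>j. a' j + b' j"] conjI TrueI)
qed

lemma generated_generator: assumes "i < n" shows "\<delta> i \<in> generated \<delta> n"
proof -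
  have "(\<Sum>j<n. int (if j = i then 1 else 0) * \<delta> j) = (\<Sum>j<n. if j = i then \<delta> j else 0)"
    by (intro sum.cong refl) auto
  also have "\<dots> = \<delta> i" using assms by simp
  finally have "\<delta> i = (\<Sum>j<n. int (if j = i then 1 else 0) * \<delta> j)" by simp
  then show ?thesis unfolding generated_def by (intro CollectI exI[of _ "\<lambda>j. if j = i then 1 else 0"] conjI TrueI)
qed

lemma generated_nonneg: "(\<And>i. i < n \<Longrightarrow> 0 \<le> \<delta> i) \<Longrightarrow> a \<in> generated \<delta> n \<Longrightarrow> 0 \<le> a"
  by (auto simp: generated_def intro!: sum_nonneg mult_nonneg_nonneg)

lemma well_ordered_nonneg: assumes "\<And>a. a \<in> S \<Longrightarrow> 0 \<le> a" shows "well_ordered S"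
proof -
  let ?r = "{(a, b). a \<in> S \<and> b \<in> S \<and> a \<le> b}"
  have "(a, b) \<in> measure nat" if "(a, b) \<in> ?r - Id" for a b using assms[of a] that by auto
  then have "?r - Id \<subseteq> measure nat" by (rule subrelI)
  then have "wf (?r - Id)" using wf_subset wf_measure by blast
  then show ?thesis
    by (auto simp: well_ordered_def well_order_on_def linear_order_on_def partial_order_on_def preorder_on_def
        refl_on_def trans_def antisym_def total_on_def)
qed

text \<open>Adding \<open>s\<close> to a least element would give a smaller one.\<close>

lemma not_well_ordered:
  assumes "s \<in> S" "\<And>a. a \<in> S \<Longrightarrow> a + s \<in> S" "s < 0" shows "\<not> well_ordered S"
proof
  let ?r = "{(a, b). a \<in> S \<and> b \<in> S \<and> a \<le> b}"
  assume "well_ordered S"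
  then have wf: "wf (?r - Id)" by (simp add: well_ordered_def well_order_on_def)
  obtain z where z: "z \<in> S" "\<And>y. (y, z) \<in> ?r - Id \<Longrightarrow> y \<notin> S"
  proof (rule wfE_min[OF wf assms(1)])
    fix z assume "z \<in> S" "\<And>y. (y, z) \<in> ?r - Id \<Longrightarrow> y \<notin> S"
    then show thesis by (rule that)
  qed
  have zs: "z + s \<in> S" by (rule assms(2)[OF z(1)])
  have "(z + s, z) \<in> ?r - Id" using zs z(1) assms(3) by simp
  from z(2)[OF this] zs show False by contradiction
qed

theorem mainTheorem3:
  fixes ps :: "'k::field_char_0 direction list"
    and f :: "'k poly poly"
    and c :: "nat \<Rightarrow> 'k direction"
    and w :: "'k fps fps \<Rightarrow> enat"
    and q :: "nat \<Rightarrow> 'k poly poly"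
    and \<delta> :: "nat \<Rightarrow> int"
    and g m n :: nat
    and \<nu> :: "'k poly poly fract \<Rightarrow> int"
  assumes "valuation_at_infinity ps"
    and "\<nu> = divisorial_valuation ps" and "n = length ps"
    and "delta_sequence_A g \<delta>"
    and "value_semigroup \<nu> = generated \<delta> (g + 2)"
    and "one_place_at_infinity f"
    and "general_element ps (bar f)"
    and "lead_coeff f = 1" and "degree f = tdeg f"
    and "centers_along f c"
    and "germ_valuation (germ (bar f)) w"
    and "family_of_approximates f c w g \<delta> q"
    and "eliminates_base_points f c m"
    and "\<And>m'. m' < m \<Longrightarrow> \<not> eliminates_base_points f c m'"
  shows "(n \<le> m \<longrightarrow> \<delta> (g + 1) \<ge> 0 \<and>
            additive_semigroup (value_semigroup \<nu>) \<and> well_ordered (value_semigroup \<nu>)) \<and>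
         (n > m \<longrightarrow> \<delta> (g + 1) < 0 \<and> \<not> well_ordered (value_semigroup \<nu>))"
proof -
  have seq: "delta_sequence g \<delta>" and g: "0 < g" using assms(4) by (auto simp: delta_sequence_A_def)
  have \<delta>_pos: "0 < \<delta> i" if "i \<le> g" for i using seq that by (simp add: delta_sequence_def)
  have irr: "irreducible (germ (bar f))"
    using assms(6) by (simp add: one_place_at_infinity_def analytically_irreducible_def)
  have top: "restr_v (bar f) = monom 1 (tdeg f)" by (rule restr_v_bar_one_place[OF assms(6,8,9)])
  have pass: "at_origin (strict_at c (bar f) i) = 0" for i
    using assms(10) by (simp add: centers_along_def points_def)
  have f0: "f \<noteq> 0" using assms(8) by auto
  obtain s where s: "transversal (strict_transform (ps @ [s]) (bar f)) (exceptional s)" "\<not> satellite (ps @ [s])"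
    using assms(7) by (auto simp: curvette_of_def)
  \<comment> \<open>As a general element the curve passes through all centers and through the point
    \<open>s\<close> of the last exceptional curve, and its infinitely near points are
    unique.\<close>
  have "ps @ [s] = points c (Suc n)"
    by (rule same_points[OF irr _ pass]) (use s(1) assms(3) in \<open>simp_all add: transversal_def\<close>)
  then have ps: "ps = points c n" and sc: "s = c n" by simp_all
  have S_add: "a + b \<in> value_semigroup \<nu>" if "a \<in> value_semigroup \<nu>" "b \<in> value_semigroup \<nu>" for a b
    using that generated_add unfolding assms(5) by blast
  have S_last: "\<delta> (g + 1) \<in> value_semigroup \<nu>" unfolding assms(5) by (rule generated_generator) simp
  have S_nonneg: "0 \<le> a" if "0 \<le> \<delta> (g + 1)" "a \<in> value_semigroup \<nu>" for a
  proof (rule generated_nonneg)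
    show "a \<in> generated \<delta> (g + 2)" using that(2) assms(5) by simp
    show "0 \<le> \<delta> i" if "i < g + 2" for i
      using \<open>0 \<le> \<delta> (g + 1)\<close> \<delta>_pos[of i] that by (cases "i = g + 1") auto
  qed
  have elements: "- \<nu> (affine_function h) \<in> value_semigroup \<nu>" if "h \<noteq> 0" for h
    using that by (auto simp: value_semigroup_def)
  show ?thesis
  proof (intro conjI impI)
    assume mn: "m < n"
    have "0 < tdeg f" using pass[of 0] top by (metis coeff_monom gr0I points_0 poly_0_coeff_0 poly_restr_v_0 strict_transform_Nil zero_neq_one)
    from eliminates_base_points_positive[OF assms(13) this irr _ pass mn] top
    have "int (tdeg f * mult_origin (total_at c (vvar :: 'k poly poly) n)) < int (mult_origin (total_at c (bar f) n))"
      by (simp only: of_nat_less_iff) simp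
    then have "0 < \<nu> (affine_function f)" using f0 by (simp add: assms(2) ps divisorial_valuation_affine)
    then show neg: "\<delta> (g + 1) < 0" using elements[OF f0] S_nonneg by force
    show "\<not> well_ordered (value_semigroup \<nu>)"
      by (rule not_well_ordered[OF S_last _ neg]) (rule S_add[OF _ S_last])
  next
    assume nm: "n \<le> m"
    show "additive_semigroup (value_semigroup \<nu>)" using S_add by (simp add: additive_semigroup_def)
    \<comment> \<open>\<open>\<delta> (g + 1)\<close> lies in the semigroup, so if it is negative
      some \<open>h\<close> has positive value; this leads to an elimination of the base points
      before \<open>n\<close>, contrary to the minimality of \<open>m\<close>.\<close>
    show nonneg: "0 \<le> \<delta> (g + 1)"
    proof (rule ccontr)
      assume "\<not> 0 \<le> \<delta> (g + 1)"
      moreover obtain h where h: "h \<noteq> 0" "\<delta> (g + 1) = - \<nu> (affine_function h)"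
        using S_last by (auto simp: value_semigroup_def)
      ultimately have pos: "0 < divisorial_valuation (points c n) (affine_function h)" by (simp add: assms(2) ps)
      \<comment> \<open>A finite direction makes \<open>v = 0\<close> exceptional from then on, so
        that a point which is no satellite is unmarked.\<close>
      then have "\<not> (\<forall>i<n. c i = Inf)" using monomial_valuation_nonpos[of n c h] h(1) by force
      then obtain i where "i < n" "c i \<noteq> Inf" by blast
      then have "\<exists>i<Suc n. c i \<noteq> Inf" by (intro exI[of _ i]) simp
      moreover have "\<not> satellite (points c (Suc n))" using s(2) by (simp add: ps sc)
      ultimately have um: "\<not> umark c (Suc n)" using satellite_iff by blast
      then obtain z where z: "c n = Fin z" by (cases "c n") auto
      have tr: "transversal (strict_at c (bar f) (Suc n)) vvar" using s(1) by (simp add: ps sc z)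
      have fam: "\<And>i. i \<le> g \<Longrightarrow> w (germ (bar (q i))) \<noteq> \<infinity> \<and> \<delta> i = - curve_value w (q i)"
        "q 0 = xvar" "q 1 = yvar"
        "\<And>i. 1 < i \<Longrightarrow> i \<le> g \<Longrightarrow> lead_coeff (q i) = 1 \<and> degree (q i) = tdeg (q i) \<and>
          int (tdeg (q i)) = \<delta> 0 div dseq \<delta> i \<and>
          curvette (bar f) c (if (\<delta> 0 - \<delta> 1) dvd \<delta> 0 then i - 1 else i) (bar (q i))"
        "g = num_characteristic_pairs (bar f) c + (if (\<delta> 0 - \<delta> 1) dvd \<delta> 0 then 1 else 0)"
        using assms(12) unfolding family_of_approximates_def by blast+
      \<comment> \<open>\<open>bar xvar\<close> is 1, so a positive \<open>\<delta> 0\<close> can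
        only come from a nonzero value of \<open>v\<close>, which centers the valuation at the
        origin.\<close>
      have "\<delta> 0 = - curve_value w xvar" using fam(1)[of 0] fam(2) by simp
      then have "w (germ vvar) \<noteq> 0"
        using \<delta>_pos[of 0] by (auto simp: curve_value_def zero_enat_def)
      then have v0: "0 < w (germ vvar)" by simp
      have o: "at_origin (bar f) = 0" and r: "restr_v (bar f) \<noteq> 0" using pass[of 0] top by simp_all
      note W = germ_valuation_centered[OF assms(11) o r v0]
      obtain L where L: "w (germ vvar) = enat L" using W(3) by auto
      interpret place_at_infinity "\<lambda>P. w (germ P)" L
        by (intro place_at_infinity.intro W(1) place_at_infinity_axioms.intro L)
      have cv: "curve_value w h = val h" for h by (simp add: curve_value_def val_def L)
      have \<delta>0: "\<delta> 0 = int L" using \<open>\<delta> 0 = - curve_value w xvar\<close> W_1 by (simp add: curve_value_def L zero_enat_def)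
      interpret approximated_curve "\<lambda>P. w (germ P)" L g \<delta> q f c n
      proof unfold_locales
        show "lead_coeff (q i) = 1" if "0 < i" "i \<le> g" for i
        proof (cases "i = 1")
          case False
          then have "1 < i" using that by simp
          then show ?thesis using fam(4) that(2) by blast
        qed (simp add: fam(3) outer_var_def del: One_nat_def)
        show "int (degree (q i)) = \<delta> 0 div dseq \<delta> i" if "0 < i" "i \<le> g" for i
        proof (cases "i = 1")
          case True
          then show ?thesis using \<delta>_pos[of 0] dseq_1[of \<delta>] by (simp add: fam(3) outer_var_def del: One_nat_def)
        next
          case False
          then have "1 < i" using that by simp
          then show ?thesis using fam(4)[of i] that(2) by simp
        qed
        show "regular (q i)" if "i \<le> g" for i using fam(1)[OF that] by (simp add: regular_def)
        show "\<delta> i = - val (q i)" if "i \<le> g" for i using fam(1)[OF that] by (simp add: cv)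
        show "degree (q i) = tdeg (q i)"
          "curvette (bar f) c (if (\<delta> 0 - \<delta> 1) dvd \<delta> 0 then i - 1 else i) (bar (q i))" if "1 < i" "i \<le> g" for i
          using fam(4)[OF that] by blast+
      qed (fact seq \<delta>0 irr top pass assms(8) assms(9) W(2) um tr g fam(2) fam(3) fam(5))+
      have "tdeg f * tdeg f < sq (Suc n)" using \<nu>_nonpos[OF _ h(1)] pos by (meson not_le)
      then obtain M where "M < n" "eliminates_base_points f c M" using eliminates_before by blast
      then show False using assms(14)[of M] nm by simp
    qed
    show "well_ordered (value_semigroup \<nu>)" by (rule well_ordered_nonneg) (rule S_nonneg[OF nonneg])
  qed
qed

end
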